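(* Let $W_E:\mathcal{X}\to\mathcal{D}(\mathcal{K}_E)$ be a classical-quantum channel on a finite set $\mathcal{X}$, let $\mathcal{L}\subset\mathcal{X}$, and let $\{f_s\}_{s\in\mathcal{S}}$, $f_s:\mathcal{L}\to\mathcal{M}'$, be a (balanced) universal hash function family, with $\mathsf{L}_2:=|\mathcal{L}|/|\mathcal{M}'|$. Then the encoders $\Gamma[f_s]$ satisfy $$\bar d(M';ES)[\Gamma[f_S]]\le\min_{0\le t\le1}2^{\frac{1-t}{1+t}}\,2^{\frac{t}{1+t}\left(-\log\mathsf{L}_2+\tilde I^{\downarrow}_{1+t}(X;E|W_E\times P_{\mathcal{L}})\right)}.$$
   Context: Logarithms base 2; $\mathcal{D}(\mathcal{K})$ is the set of density operators on a finite-dimensional Hilbert space $\mathcal{K}$. A family $\{f_s\}_{s\in\mathcal{S}}$ of functions $f_s:\mathcal{L}\to\mathcal{M}'$ between finite sets, with $S$ uniform on the finite set $\mathcal{S}$, is a (balanced) universal hash function family if (C1) $\Pr_S[f_S(l)=f_S(l')]\le 1/|\mathcal{M}'|$ for all $l\ne l'\in\mathcal{L}$, and (C2) $|\{l\in\mathcal{L}:f_s(l)=m'\}|=|\mathcal{L}|/|\mathcal{M}'|$ for all $s\in\mathcal{S}$, $m'\in\mathcal{M}'$. The encoder $\Gamma[f_s]$ maps $m'\in\mathcal{M}'$ to the uniform distribution on $f_s^{-1}(m')$. With $M'$ uniform on $\mathcal{M}'$, define $\tau_{M'E|S=s}=\sum_{m'}\frac{1}{|\mathcal{M}'|}|m'\rangle\langle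 m'|\otimes\frac{1}{\mathsf{L}_2}\sum_{l\in f_s^{-1}(m')}W_E(l)$, $\tau_{E|S=s}=\mathrm{Tr}_{M'}\tau_{M'E|S=s}$, $P_{\mathcal{M}'}$ the uniform distribution (as a diagonal density operator), and $\bar d(M';ES)[\Gamma[f_S]]:=\frac{1}{|\mathcal{S}|}\sum_{s}\|\tau_{M'E|S=s}-P_{\mathcal{M}'}\otimes\tau_{E|S=s}\|_1$. $W_E\times P_{\mathcal{L}}:=\sum_{l\in\mathcal{L}}\frac{1}{|\mathcal{L}|}|l\rangle\langle l|\otimes W_E(l)$. The sandwiched Rényi divergence is $\tilde D_{1+t}(\rho\|\sigma)=\frac1t\log\mathrm{Tr}\big(\sigma^{-\frac{t}{2(1+t)}}\rho\sigma^{-\frac{t}{2(1+t)}}\big)^{1+t}$ (for $t=0$, the limit, i.e. the relative entropy), and for a cq state $\rho_{XE}$, $\tilde I^{\downarrow}_{1+t}(X;E|\rho_{XE}):=\inf_{\sigma_E\in\mathcal{D}(\mathcal{K}_E)}\tilde D_{1+t}(\rho_{XE}\|\rho_X\otimes\sigma_E)$. *)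

theory Defs
  imports Complex_Main "Jordan_Normal_Form.Matrix"
begin

definition adj :: "complex mat \<Rightarrow> complex mat" where
  "adj A = mat (dim_col A) (dim_row A) (\<lambda>(i,j). cnj (A $$ (j,i)))"

definition mtrace :: "complex mat \<Rightarrow> complex" where
  "mtrace A = (\<Sum>i<dim_row A. A $$ (i,i))"

definition hermitian :: "nat \<Rightarrow> complex mat \<Rightarrow> bool" where
  "hermitian d A \<longleftrightarrow> A \<in> carrier_mat d d \<and> adj A = A"

definition unitary :: "nat \<Rightarrow> complex mat \<Rightarrow> bool" where
  "unitary d U \<longleftrightarrow> U \<in> carrier_mat d d \<and> U * adj U = 1\<^sub>m d \<and> adj U * U = 1\<^sub>m d"

definition psd :: "nat \<Rightarrow> complex mat \<Rightarrow> bool" where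
  "psd d A \<longleftrightarrow> hermitian d A \<and>
     (\<forall>v \<in> carrier_vec d. 0 \<le> Re (\<Sum>i<d. cnj (v $ i) * (A *\<^sub>v v) $ i))"

definition density :: "nat \<Rightarrow> complex mat \<Rightarrow> bool" where
  "density d A \<longleftrightarrow> psd d A \<and> mtrace A = 1"

definition mat_fun :: "(real \<Rightarrow> real) \<Rightarrow> nat \<Rightarrow> complex mat \<Rightarrow> complex mat" where
  "mat_fun f d A = (SOME B. \<exists>U ev. unitary d U \<and>
      A = U * mat d d (\<lambda>(i,j). if i = j then complex_of_real (ev i) else 0) * adj U \<and>
      B = U * mat d d (\<lambda>(i,j). if i = j then complex_of_real (f (ev i)) else 0) * adj U)"

text \<open>Powers A^p on the support (generalised inverse convention for negative p).\<close>
definition mpow :: "nat \<Rightarrow> complex mat \<Rightarrow> real \<Rightarrow> complex mat" where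
  "mpow d A p = mat_fun (\<lambda>x. if x > 0 then x powr p else 0) d A"

definition mlog :: "nat \<Rightarrow> complex mat \<Rightarrow> complex mat" where
  "mlog d A = mat_fun (\<lambda>x. if x > 0 then log 2 x else 0) d A"

definition trace_norm :: "nat \<Rightarrow> complex mat \<Rightarrow> real" where
  "trace_norm d A = Re (mtrace (mat_fun sqrt d (adj A * A)))"

text \<open>Support inclusion supp A \<subseteq> supp B (for psd A, B): ker B \<subseteq> ker A.\<close>
definition supp_le :: "nat \<Rightarrow> complex mat \<Rightarrow> complex mat \<Rightarrow> bool" where
  "supp_le d A B \<longleftrightarrow> (\<forall>v \<in> carrier_vec d. B *\<^sub>v v = 0\<^sub>v d \<longrightarrow> A *\<^sub>v v = 0\<^sub>v d)"

definition tensor :: "nat \<Rightarrow> nat \<Rightarrow> complex mat \<Rightarrow> complex mat \<Rightarrow> complex mat" where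
  "tensor n d A B = mat (n*d) (n*d) (\<lambda>(i,j). A $$ (i div d, j div d) * B $$ (i mod d, j mod d))"

definition ptrace1 :: "nat \<Rightarrow> nat \<Rightarrow> complex mat \<Rightarrow> complex mat" where
  "ptrace1 n d M = mat d d (\<lambda>(i,j). \<Sum>k<n. M $$ (k*d + i, k*d + j))"

definition ptrace2 :: "nat \<Rightarrow> nat \<Rightarrow> complex mat \<Rightarrow> complex mat" where
  "ptrace2 n d M = mat n n (\<lambda>(i,j). \<Sum>k<d. M $$ (i*d + k, j*d + k))"

text \<open>A fixed enumeration of a finite set, used to identify C^{|A|} with the span of {|a> : a \<in> A}.\<close>
definition enum_set :: "'b set \<Rightarrow> nat \<Rightarrow> 'b" where
  "enum_set A = (SOME g. bij_betw g {0..<card A} A)"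

text \<open>Classical-quantum operator \<Sum>_{a\<in>A} |a><a| \<otimes> g a  (block diagonal).\<close>
definition cq :: "'b set \<Rightarrow> nat \<Rightarrow> ('b \<Rightarrow> complex mat) \<Rightarrow> complex mat" where
  "cq A d g = mat (card A * d) (card A * d) (\<lambda>(i,j).
      if i div d = j div d then g (enum_set A (i div d)) $$ (i mod d, j mod d) else 0)"

definition msum :: "nat \<Rightarrow> 'b set \<Rightarrow> ('b \<Rightarrow> complex mat) \<Rightarrow> complex mat" where
  "msum d A g = mat d d (\<lambda>ij. \<Sum>a\<in>A. g a $$ ij)"

text \<open>Sandwiched Renyi divergence of order 1+t (t > 0), and the relative entropy for t = 0;
  base-2 logarithm. Only used where supp rho \<subseteq> supp sigma (otherwise the value is +\<infinity>).\<close>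
definition sandwiched_div :: "nat \<Rightarrow> real \<Rightarrow> complex mat \<Rightarrow> complex mat \<Rightarrow> real" where
  "sandwiched_div d t \<rho> \<sigma> =
    (if t = 0 then Re (mtrace (\<rho> * (mlog d \<rho> - mlog d \<sigma>)))
     else (1 / t) * log 2 (Re (mtrace (mpow d
              (mpow d \<sigma> (- t / (2 * (1 + t))) * \<rho> * mpow d \<sigma> (- t / (2 * (1 + t)))) (1 + t)))))"

text \<open>\<tilde>I^\<down>_{1+t}(X;E|\<rho>_{XE}) = inf_{\<sigma>_E} \<tilde>D_{1+t}(\<rho>_XE \<parallel> \<rho>_X \<otimes> \<sigma>_E) for a state on C^n \<otimes> C^d
  (X classical).  Density operators \<sigma> violating the support condition give +\<infinity> and are omitted.\<close>
definition I_down :: "nat \<Rightarrow> nat \<Rightarrow> real \<Rightarrow> complex mat \<Rightarrow> real" where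
  "I_down n d t \<rho> = Inf {sandwiched_div (n*d) t \<rho> (tensor n d (ptrace2 n d \<rho>) \<sigma>) | \<sigma>.
       density d \<sigma> \<and> supp_le (n*d) \<rho> (tensor n d (ptrace2 n d \<rho>) \<sigma>)}"

definition universal_hash :: "'s set \<Rightarrow> ('s \<Rightarrow> 'l \<Rightarrow> 'm) \<Rightarrow> 'l set \<Rightarrow> 'm set \<Rightarrow> bool" where
  "universal_hash S f L M \<longleftrightarrow>
     finite S \<and> S \<noteq> {} \<and> finite L \<and> finite M \<and>
     (\<forall>s\<in>S. \<forall>l\<in>L. f s l \<in> M) \<and>
     (\<forall>l\<in>L. \<forall>l'\<in>L. l \<noteq> l' \<longrightarrow>
        real (card {s\<in>S. f s l = f s l'}) / real (card S) \<le> 1 / real (card M)) \<and>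
     (\<forall>s\<in>S. \<forall>m\<in>M. real (card {l\<in>L. f s l = m}) = real (card L) / real (card M))"

definition tau_ME :: "nat \<Rightarrow> ('x \<Rightarrow> complex mat) \<Rightarrow> 'x set \<Rightarrow> 'm set \<Rightarrow> ('x \<Rightarrow> 'm) \<Rightarrow> complex mat" where
  "tau_ME d W L M fs = cq M d (\<lambda>m. (1 / real (card M)) \<cdot>\<^sub>m
       ((1 / (real (card L) / real (card M))) \<cdot>\<^sub>m msum d {l\<in>L. fs l = m} W))"

definition tau_E :: "nat \<Rightarrow> ('x \<Rightarrow> complex mat) \<Rightarrow> 'x set \<Rightarrow> 'm set \<Rightarrow> ('x \<Rightarrow> 'm) \<Rightarrow> complex mat" where
  "tau_E d W L M fs = ptrace1 (card M) d (tau_ME d W L M fs)"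

definition uniform_op :: "'m set \<Rightarrow> complex mat" where
  "uniform_op M = mat (card M) (card M) (\<lambda>(i,j). if i = j then 1 / real (card M) else 0)"

definition dbar :: "nat \<Rightarrow> ('x \<Rightarrow> complex mat) \<Rightarrow> 'x set \<Rightarrow> 'm set \<Rightarrow> 's set \<Rightarrow> ('s \<Rightarrow> 'x \<Rightarrow> 'm) \<Rightarrow> real" where
  "dbar d W L M S f = (1 / real (card S)) * (\<Sum>s\<in>S.
      trace_norm (card M * d) (tau_ME d W L M (f s) - tensor (card M) d (uniform_op M) (tau_E d W L M (f s))))"

definition cq_uniform :: "nat \<Rightarrow> ('x \<Rightarrow> complex mat) \<Rightarrow> 'x set \<Rightarrow> complex mat" where
  "cq_uniform d W L = cq L d (\<lambda>l. (1 / real (card L)) \<cdot>\<^sub>m W l)"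

end

theory Submission
  imports "HOL-Analysis.Gamma_Function" "HOL-Real_Asymp.Real_Asymp" Defs
    "Jordan_Normal_Form.Schur_Decomposition" "Jordan_Normal_Form.Char_Poly"
begin

text \<open>
  The exponents \<open>t = 0\<close> and \<open>t = 1\<close> are the trace norm and Hilbert--Schmidt estimates of the map that sends
  \<open>(A\<^sub>l)\<close> to the deviations of its fibre sums from their mean; the values in between are reached by complex
  interpolation. With \<open>\<theta> = 2t/(1+t)\<close> and \<open>p = 1+t\<close> one uses the analytic family
  \<open>A\<^sub>l(z) = \<sigma>\<^bsup>z/4\<^esup> X\<^sub>l\<^bsup>p(1-z/2)\<^esup> \<sigma>\<^bsup>z/4\<^esup>\<close>.
  The Hilbert--Schmidt estimate with the sharp constant needs positive \<open>A\<^sub>l\<close>, because only then may the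
  cross terms, whose weights \<open>Pr[f(l) = f(l')] - 1/|M|\<close> are nonpositive, be dropped. On the line
  \<open>Re z = 1\<close> the \<open>A\<^sub>l(z)\<close> carry phases \<open>X\<^sub>l\<^bsup>iy\<^esup>\<close> and the estimate may fail at a given \<open>y\<close>.
  It still holds on average over \<open>y\<close> with respect to the harmonic measure of the strip, because the Fourier
  transform \<open>sinh (\<theta> x) / sinh x\<close> of that measure is nonnegative, and this average is all that the
  three lines theorem requires.
\<close>

text \<open>In finite dimension the tested quantity is a finite exponential sum in z with real
  frequencies. For exp(x z) the Poisson formula at \<theta> reads exp(\<theta> x) = k(1-\<theta>, x)
  + exp(x) k(\<theta>, x) with k(a, x) = sinh(a x) / sinh x, so the averaged three lines theorem
  reduces to positivity of k. Euler's product supplies it: k is a limit of products of factors a^2 +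
  (1 - a^2) / (1 + b x^2), and such Lorentz functions arise from cosines by geometric series and
  limits. Only inequalities whose right side is linear in characters can be averaged. A
  Cauchy-Schwarz bound by the root of the second moment is not, so on Re z = 1 the
  arithmetic-geometric inequality with a fixed parameter replaces it. For the same reason both
  boundary bounds are normalised to 1 before averaging; otherwise an arithmetic instead of a
  geometric mean would come out. Constants: a contraction minus a mean of contractions has norm at
  most 2, and this enters with exponent 1 - \<theta> = (1-t)/(1+t). The Hilbert-Schmidt side
  contributes |M'| tr \<sigma> with exponent \<theta>/2 = t/(1+t); with the weight of the uniform
  marginal absorbed, tr \<sigma> = 1/|L|, which yields 1/L_2.\<close>

section \<open>Positive definite kernels and an averaged three lines theorem\<close>

unbundle no vec_syntax

text \<open>\<open>g\<close> behaves as the Fourier transform of a positive measure: the inequality assumed at every \<open>y\<close> may be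
  integrated. Phrased this way, the harmonic measure itself never has to be constructed.\<close>
definition pd_kernel :: "(real \<Rightarrow> real) \<Rightarrow> bool" where
  "pd_kernel g \<longleftrightarrow> (\<forall>n (c :: nat \<Rightarrow> complex) (\<mu> :: nat \<Rightarrow> real) m (e :: nat \<Rightarrow> complex) (\<nu> :: nat \<Rightarrow> real).
     (\<forall>y. cmod (\<Sum>i<n. c i * cis (\<mu> i * y)) \<le> Re (\<Sum>j<m. e j * cis (\<nu> j * y))) \<longrightarrow>
     cmod (\<Sum>i<n. c i * complex_of_real (g (\<mu> i))) \<le> Re (\<Sum>j<m. e j * complex_of_real (g (\<nu> j))))"

lemma pd_kernelD:
  fixes n m :: nat
  assumes "pd_kernel g"
    and "\<And>y. cmod (\<Sum>i<n. c i * cis (\<mu> i * y)) \<le> Re (\<Sum>j<m. e j * cis (\<nu> j * y))"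
  shows "cmod (\<Sum>i<n. c i * complex_of_real (g (\<mu> i))) \<le> Re (\<Sum>j<m. e j * complex_of_real (g (\<nu> j)))"
  using assms(1)[unfolded pd_kernel_def, rule_format, OF assms(2)] .

lemma pd_kernelD_finite:
  fixes c :: "'i \<Rightarrow> complex" and \<mu> :: "'i \<Rightarrow> real" and e :: "'j \<Rightarrow> complex" and \<nu> :: "'j \<Rightarrow> real"
  assumes g: "pd_kernel g" and I: "finite I" and J: "finite J"
    and le: "\<And>y. cmod (\<Sum>i\<in>I. c i * cis (\<mu> i * y)) \<le> Re (\<Sum>j\<in>J. e j * cis (\<nu> j * y))"
  shows "cmod (\<Sum>i\<in>I. c i * complex_of_real (g (\<mu> i))) \<le> Re (\<Sum>j\<in>J. e j * complex_of_real (g (\<nu> j)))"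
proof -
  obtain h where h: "bij_betw h {..<card I} I"
    using ex_bij_betw_nat_finite[OF I] by (auto simp: atLeast0LessThan)
  obtain k where k: "bij_betw k {..<card J} J"
    using ex_bij_betw_nat_finite[OF J] by (auto simp: atLeast0LessThan)
  have "cmod (\<Sum>i<card I. c (h i) * complex_of_real (g (\<mu> (h i))))
      \<le> Re (\<Sum>j<card J. e (k j) * complex_of_real (g (\<nu> (k j))))"
  proof (rule pd_kernelD[OF g])
    fix y
    show "cmod (\<Sum>i<card I. c (h i) * cis (\<mu> (h i) * y)) \<le> Re (\<Sum>j<card J. e (k j) * cis (\<nu> (k j) * y))"
      using le[of y]
      by (simp only: sum.reindex_bij_betw[OF h, of "\<lambda>i. c i * cis (\<mu> i * y)"]
          sum.reindex_bij_betw[OF k, of "\<lambda>j. e j * cis (\<nu> j * y)"])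
  qed
  then show ?thesis
    by (simp only: sum.reindex_bij_betw[OF h, of "\<lambda>i. c i * complex_of_real (g (\<mu> i))"]
        sum.reindex_bij_betw[OF k, of "\<lambda>j. e j * complex_of_real (g (\<nu> j))"])
qed

text \<open>The constant is the transform of a point mass at y = 0, so the hypothesis at that single
  y suffices.\<close>

lemma pd_kernel_const: "a \<ge> 0 \<Longrightarrow> pd_kernel (\<lambda>_. a)"
  unfolding pd_kernel_def
proof (intro allI impI)
  fix n m :: nat and c e :: "nat \<Rightarrow> complex" and \<mu> \<nu> :: "nat \<Rightarrow> real"
  assume a: "a \<ge> 0" and le: "\<forall>y. cmod (\<Sum>i<n. c i * cis (\<mu> i * y)) \<le> Re (\<Sum>j<m. e j * cis (\<nu> j * y))"
  have "a * cmod (\<Sum>i<n. c i) \<le> a * Re (\<Sum>j<m. e j)"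
    using le[rule_format, of 0] a by (intro mult_left_mono) auto
  then show "cmod (\<Sum>i<n. c i * complex_of_real a) \<le> Re (\<Sum>j<m. e j * complex_of_real a)"
    using a unfolding sum_distrib_right[symmetric] by (simp add: norm_mult mult.commute del: Re_sum)
qed

lemma pd_kernel_add:
  assumes "pd_kernel g" "pd_kernel h" shows "pd_kernel (\<lambda>x. g x + h x)"
  unfolding pd_kernel_def
proof (intro allI impI)
  fix n m :: nat and c e :: "nat \<Rightarrow> complex" and \<mu> \<nu> :: "nat \<Rightarrow> real"
  assume le: "\<forall>y. cmod (\<Sum>i<n. c i * cis (\<mu> i * y)) \<le> Re (\<Sum>j<m. e j * cis (\<nu> j * y))"
  show "cmod (\<Sum>i<n. c i * complex_of_real (g (\<mu> i) + h (\<mu> i)))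
      \<le> Re (\<Sum>j<m. e j * complex_of_real (g (\<nu> j) + h (\<nu> j)))"
    using norm_triangle_ineq[of "\<Sum>i<n. c i * complex_of_real (g (\<mu> i))" "\<Sum>i<n. c i * complex_of_real (h (\<mu> i))"]
      pd_kernelD[OF assms(1) le[rule_format]] pd_kernelD[OF assms(2) le[rule_format]]
    by (simp add: algebra_simps sum.distrib)
qed

text \<open>The product is the transform of a convolution. The hypothesis stays valid when
  translated by a fixed y; averaging over the translation with \<open>g\<close> weights the
  coefficients by \<open>g\<close>, and the result, valid for every y, is the input for
  \<open>h\<close>.\<close>

lemma pd_kernel_mult:
  assumes "pd_kernel g" "pd_kernel h" shows "pd_kernel (\<lambda>x. g x * h x)"
  unfolding pd_kernel_def
proof (intro allI impI)
  fix n m :: nat and c e :: "nat \<Rightarrow> complex" and \<mu> \<nu> :: "nat \<Rightarrow> real"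
  assume le: "\<forall>y. cmod (\<Sum>i<n. c i * cis (\<mu> i * y)) \<le> Re (\<Sum>j<m. e j * cis (\<nu> j * y))"
  have "cmod (\<Sum>i<n. (c i * complex_of_real (g (\<mu> i))) * cis (\<mu> i * y))
      \<le> Re (\<Sum>j<m. (e j * complex_of_real (g (\<nu> j))) * cis (\<nu> j * y))" for y
  proof -
    have "cmod (\<Sum>i<n. (c i * cis (\<mu> i * y)) * complex_of_real (g (\<mu> i)))
      \<le> Re (\<Sum>j<m. (e j * cis (\<nu> j * y)) * complex_of_real (g (\<nu> j)))"
    proof (rule pd_kernelD[OF assms(1)])
      fix x
      show "cmod (\<Sum>i<n. (c i * cis (\<mu> i * y)) * cis (\<mu> i * x))
         \<le> Re (\<Sum>j<m. (e j * cis (\<nu> j * y)) * cis (\<nu> j * x))"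
        using le[rule_format, of "y + x"] by (simp add: distrib_left cis_mult[symmetric] mult.assoc del: Re_sum)
    qed
    then show ?thesis by (simp only: mult_ac)
  qed
  from pd_kernelD[OF assms(2) this]
  show "cmod (\<Sum>i<n. c i * complex_of_real (g (\<mu> i) * h (\<mu> i)))
      \<le> Re (\<Sum>j<m. e j * complex_of_real (g (\<nu> j) * h (\<nu> j)))"
    by (simp only: of_real_mult mult.assoc)
qed

lemma pd_kernel_power: "pd_kernel g \<Longrightarrow> pd_kernel (\<lambda>x. g x ^ k)"
  by (induction k) (auto intro: pd_kernel_mult pd_kernel_const)

lemma pd_kernel_sum: "(\<And>k. k \<in> K \<Longrightarrow> pd_kernel (g k)) \<Longrightarrow> pd_kernel (\<lambda>x. \<Sum>k\<in>K. g k x)"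
  by (induction K rule: infinite_finite_induct) (auto intro: pd_kernel_add pd_kernel_const)

lemma pd_kernel_prod: "(\<And>k. k \<in> K \<Longrightarrow> pd_kernel (g k)) \<Longrightarrow> pd_kernel (\<lambda>x. \<Prod>k\<in>K. g k x)"
  by (induction K rule: infinite_finite_induct) (auto intro: pd_kernel_mult pd_kernel_const)

lemma pd_kernel_limit:
  assumes g: "\<And>k. pd_kernel (g k)" and lim: "\<And>x. (\<lambda>k. g k x) \<longlonglongrightarrow> h x"
  shows "pd_kernel h"
  unfolding pd_kernel_def
proof (intro allI impI)
  fix n m :: nat and c e :: "nat \<Rightarrow> complex" and \<mu> \<nu> :: "nat \<Rightarrow> real"
  assume le: "\<forall>y. cmod (\<Sum>i<n. c i * cis (\<mu> i * y)) \<le> Re (\<Sum>j<m. e j * cis (\<nu> j * y))"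
  have "(\<lambda>k. cmod (\<Sum>i<n. c i * complex_of_real (g k (\<mu> i)))) \<longlonglongrightarrow> cmod (\<Sum>i<n. c i * complex_of_real (h (\<mu> i)))"
    by (intro tendsto_intros lim)
  moreover have "(\<lambda>k. Re (\<Sum>j<m. e j * complex_of_real (g k (\<nu> j)))) \<longlonglongrightarrow> Re (\<Sum>j<m. e j * complex_of_real (h (\<nu> j)))"
    by (intro tendsto_intros lim)
  ultimately show "cmod (\<Sum>i<n. c i * complex_of_real (h (\<mu> i))) \<le> Re (\<Sum>j<m. e j * complex_of_real (h (\<nu> j)))"
    by (rule LIMSEQ_le) (use pd_kernelD[OF g le[rule_format]] in blast)
qed

text \<open>The measure is half a unit mass at t and half at -t.\<close>

lemma pd_kernel_cos: "pd_kernel (\<lambda>x. cos (x * t))"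
  unfolding pd_kernel_def
proof (intro allI impI)
  fix n m :: nat and c e :: "nat \<Rightarrow> complex" and \<mu> \<nu> :: "nat \<Rightarrow> real"
  assume le: "\<forall>y. cmod (\<Sum>i<n. c i * cis (\<mu> i * y)) \<le> Re (\<Sum>j<m. e j * cis (\<nu> j * y))"
  have cos: "complex_of_real (cos z) = (cis z + cis (- z)) / 2" for z
    by (simp add: complex_eq_iff)
  have avg: "(\<Sum>i<k. a i * complex_of_real (cos (x i * t)))
      = ((\<Sum>i<k. a i * cis (x i * t)) + (\<Sum>i<k. a i * cis (x i * (- t)))) / 2"
    for a :: "nat \<Rightarrow> complex" and x :: "nat \<Rightarrow> real" and k
    unfolding cos sum.distrib[symmetric] sum_divide_distrib
    by (intro sum.cong) (auto simp: algebra_simps)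
  have half: "cmod ((A + B) / 2) \<le> Re ((C + D) / 2)"
    if "cmod A \<le> Re C" "cmod B \<le> Re D" for A B C D :: complex
    using that norm_triangle_ineq[of A B] by (simp add: norm_divide)
  show "cmod (\<Sum>i<n. c i * complex_of_real (cos (\<mu> i * t))) \<le> Re (\<Sum>j<m. e j * complex_of_real (cos (\<nu> j * t)))"
    unfolding avg[of c \<mu> n] avg[of e \<nu> m] by (intro half le[rule_format])
qed

text \<open>With r = q/(1+q) cos(x t) the function is 1/(1+q) times the geometric series in r, and
  its partial sums are nonnegative combinations of powers of a cosine.\<close>

lemma pd_kernel_geometric:
  assumes q: "q \<ge> 0" shows "pd_kernel (\<lambda>x. 1 / (1 + q * (1 - cos (x * t))))"
proof (rule pd_kernel_limit)
  let ?r = "\<lambda>x. q / (1 + q) * cos (x * t)"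
  show "pd_kernel (\<lambda>x. 1 / (1 + q) * (\<Sum>k<N. ?r x ^ k))" for N
    using q by (intro pd_kernel_mult pd_kernel_sum pd_kernel_power pd_kernel_const pd_kernel_cos) auto
  fix x
  have "\<bar>?r x\<bar> \<le> q / (1 + q) * 1"
    using q unfolding abs_mult by (intro mult_mono) auto
  also have "\<dots> < 1" using q by simp
  finally have r: "norm (?r x) < 1" by simp
  have "(\<lambda>N. \<Sum>k<N. ?r x ^ k) \<longlonglongrightarrow> 1 / (1 - ?r x)"
    using geometric_sums[OF r] by (simp add: sums_def)
  then have "(\<lambda>N. 1 / (1 + q) * (\<Sum>k<N. ?r x ^ k)) \<longlonglongrightarrow> 1 / (1 + q) * (1 / (1 - ?r x))"
    by (intro tendsto_intros)
  moreover have "1 / (1 + q) * (1 / (1 - ?r x)) = 1 / (1 + q * (1 - cos (x * t)))"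
  proof -
    have "(1 + q) * (1 - ?r x) = 1 + q * (1 - cos (x * t))"
      using q by (simp add: field_simps)
    then show ?thesis by (metis mult_1 times_divide_times_eq)
  qed
  ultimately show "(\<lambda>N. 1 / (1 + q) * (\<Sum>k<N. ?r x ^ k)) \<longlonglongrightarrow> 1 / (1 + q * (1 - cos (x * t)))"
    by simp
qed

text \<open>Since 1 - cos(x u) behaves like x^2 u^2 / 2 near u = 0, the choice q = 2 b / u^2 with u
  = 1/(n+1) makes the kernels of \<open>pd_kernel_geometric\<close> converge to this one.\<close>

lemma pd_kernel_lorentz:
  assumes b: "b \<ge> 0" shows "pd_kernel (\<lambda>x. 1 / (1 + b * x\<^sup>2))"
proof (rule pd_kernel_limit)
  show "pd_kernel (\<lambda>x. 1 / (1 + (2 * b * (real (Suc n))\<^sup>2) * (1 - cos (x * (1 / real (Suc n))))))" for n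
    using b by (intro pd_kernel_geometric) auto
  fix x :: real
  have "((\<lambda>u. (1 - cos (x * u)) / u\<^sup>2) \<longlongrightarrow> x\<^sup>2 / 2) (at_right 0)"
    by (subst power2_eq_square[of x]) real_asymp
  note lim = this
  have "1 + (2 * b) * (x\<^sup>2 / 2) \<noteq> 0" using b by (simp add: add_nonneg_eq_0_iff)
  then have "((\<lambda>u. 1 / (1 + (2 * b) * ((1 - cos (x * u)) / u\<^sup>2))) \<longlongrightarrow> 1 / (1 + (2 * b) * (x\<^sup>2 / 2))) (at_right 0)"
    by (rule tendsto_divide[OF tendsto_const tendsto_add[OF tendsto_const tendsto_mult[OF tendsto_const lim]]])
  moreover have "filterlim (\<lambda>n. 1 / real (Suc n)) (at_right 0) sequentially"
    by real_asymp
  ultimately have "((\<lambda>n. 1 / (1 + (2 * b) * ((1 - cos (x * (1 / real (Suc n)))) / (1 / real (Suc n))\<^sup>2)))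
      \<longlongrightarrow> 1 / (1 + (2 * b) * (x\<^sup>2 / 2))) sequentially"
    by (rule filterlim_compose)
  then show "(\<lambda>n. 1 / (1 + (2 * b * (real (Suc n))\<^sup>2) * (1 - cos (x * (1 / real (Suc n)))))) \<longlonglongrightarrow> 1 / (1 + b * x\<^sup>2)"
    by (simp add: power_divide mult_ac)
qed

section \<open>Euler's product and the harmonic measure of the strip\<close>

lemma sinh_product_formula:
  "(\<lambda>n. pi * x * (\<Prod>k=1..n. 1 + x\<^sup>2 / (real k)\<^sup>2)) \<longlonglongrightarrow> sinh (pi * x)" for x :: real
proof -
  have "(\<lambda>n. of_real pi * (\<i> * of_real x) * (\<Prod>k=1..n. 1 - (\<i> * of_real x)^2 / (of_nat k)^2))
      \<longlonglongrightarrow> sin (of_real pi * (\<i> * of_real x))"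
    by (rule sin_product_formula_complex)
  \<comment> \<open>On the imaginary axis the prefactor is purely imaginary and every factor of the
    product is real, so the imaginary part carries the whole limit.\<close>
  then have "(\<lambda>n. Im (of_real pi * (\<i> * of_real x) * (\<Prod>k=1..n. 1 - (\<i> * of_real x)^2 / (of_nat k)^2)))
      \<longlonglongrightarrow> Im (sin (of_real pi * (\<i> * of_real x)))"
    by (rule tendsto_Im)
  moreover have "Im (of_real pi * (\<i> * of_real x) * (\<Prod>k=1..n. 1 - (\<i> * of_real x)^2 / (of_nat k)^2))
      = pi * x * (\<Prod>k=1..n. 1 + x\<^sup>2 / (real k)\<^sup>2)" for n
  proof -
    have "(\<Prod>k=1..n. 1 - (\<i> * of_real x)^2 / (of_nat k)^2) = complex_of_real (\<Prod>k=1..n. 1 + x\<^sup>2 / (real k)\<^sup>2)"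
      unfolding of_real_prod by (intro prod.cong) (auto simp: power_mult_distrib)
    then show ?thesis by (simp only: mult.assoc[symmetric] of_real_mult[symmetric])
       (simp add: mult_ac del: of_real_prod of_real_mult)
  qed
  moreover have "Im (sin (of_real pi * (\<i> * of_real x))) = sinh (pi * x)"
    using sinh_conv_sin[of "complex_of_real (pi * x)"]
    by (simp add: Im_sin mult_ac sinh_def exp_minus)
  ultimately show ?thesis by (simp only:)
qed

text \<open>The Fourier transform of the part of the harmonic measure of the strip \<open>0 < Re z < 1\<close>, seen from the
  point \<open>a\<close>, that lies on the line \<open>Re z = 1\<close>; it has mass \<open>a\<close>.\<close>
definition strip_kernel :: "real \<Rightarrow> real \<Rightarrow> real" where
  "strip_kernel a x = (if x = 0 then a else sinh (a * x) / sinh x)"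

lemma strip_kernel_0 [simp]: "strip_kernel a 0 = a"
  by (simp add: strip_kernel_def)

lemma strip_kernel_nonneg: "0 \<le> a \<Longrightarrow> 0 \<le> strip_kernel a x"
  by (cases "x \<ge> 0") (auto simp: strip_kernel_def mult_nonneg_nonpos intro!: divide_nonneg_nonneg divide_nonpos_nonpos)

text \<open>This is the Poisson formula of the strip for exp(x z) at the point \<theta>: the first
  term collects the line Re z = 0, the second the line Re z = 1, where the exponential has modulus
  exp x.\<close>

lemma strip_kernel_split:
  "exp (\<theta> * x) = strip_kernel (1 - \<theta>) x + exp x * strip_kernel \<theta> x"
proof (cases "x = 0")
  case False
  then have "sinh x \<noteq> 0" by simp
  moreover have "exp (\<theta> * x) * sinh x = sinh ((1 - \<theta>) * x) + exp x * sinh (\<theta> * x)"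
    by (simp add: sinh_field_def field_simps exp_add[symmetric] exp_diff[symmetric])
  ultimately show ?thesis using False by (simp add: strip_kernel_def field_simps)
qed auto

text \<open>Divide the Euler products of sinh(a x) and sinh x. With u = x^2 / (pi k)^2 the k-th
  quotient is (1 + a^2 u) / (1 + u) = a^2 + (1 - a^2) / (1 + u), a combination of a constant and a
  Lorentz kernel whose weights are nonnegative because a is at most 1.\<close>

lemma pd_kernel_strip:
  assumes "0 \<le> a" "a \<le> 1" shows "pd_kernel (strip_kernel a)"
proof (rule pd_kernel_limit)
  let ?b = "\<lambda>k. 1 / (pi * real k)\<^sup>2"
  let ?f = "\<lambda>k x. a\<^sup>2 + (1 - a\<^sup>2) * (1 / (1 + ?b k * x\<^sup>2))"
  show "pd_kernel (\<lambda>x. a * (\<Prod>k=1..n. ?f k x))" for n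
    using assms
    by (intro pd_kernel_mult pd_kernel_prod pd_kernel_add pd_kernel_const pd_kernel_lorentz)
      (auto simp: power_le_one)
  fix x
  show "(\<lambda>n. a * (\<Prod>k=1..n. ?f k x)) \<longlonglongrightarrow> strip_kernel a x"
  proof (cases "x = 0")
    case False
    define y where "y = x / pi"
    have y: "y \<noteq> 0" and xy: "x = pi * y" using False by (auto simp: y_def)
    let ?P = "\<lambda>z n. pi * z * (\<Prod>k=1..n. 1 + z\<^sup>2 / (real k)\<^sup>2)"
    have lim: "(\<lambda>n. ?P (a * y) n / ?P y n) \<longlonglongrightarrow> sinh (pi * (a * y)) / sinh (pi * y)"
      using y by (intro tendsto_divide sinh_product_formula) auto
    have "?P (a * y) n / ?P y n = a * (\<Prod>k=1..n. ?f k x)" for n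
    proof -
      have "(1 + (a * y)\<^sup>2 / (real k)\<^sup>2) / (1 + y\<^sup>2 / (real k)\<^sup>2) = ?f k x" if "k \<in> {1..n}" for k
      proof -
        have "1 + y\<^sup>2 / (real k)\<^sup>2 > 0" by (intro add_pos_nonneg) auto
        moreover have "?b k * x\<^sup>2 = y\<^sup>2 / (real k)\<^sup>2" by (simp add: xy power_mult_distrib)
        ultimately show ?thesis
          by (simp only: power_mult_distrib[of a y]) (simp add: divide_simps, simp add: algebra_simps)
      qed
      then have "(\<Prod>k=1..n. ?f k x) = (\<Prod>k=1..n. (1 + (a * y)\<^sup>2 / (real k)\<^sup>2) / (1 + y\<^sup>2 / (real k)\<^sup>2))"
        by (intro prod.cong) auto
      then show ?thesis using y by (simp add: prod_dividef)
    qed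
    with lim show ?thesis using False by (simp add: strip_kernel_def xy mult_ac)
  qed auto
qed

text \<open>\<open>strip_kernel_split\<close> writes the value at \<theta> as the sum of the two
  boundary averages. Averaging turns each cosine on the right line into a nonnegative number, so the
  subtracted terms may be dropped, although they need not help at an individual y.\<close>

lemma three_lines_averaged:
  fixes c :: "'i \<Rightarrow> complex" and \<mu> :: "'i \<Rightarrow> real" and D \<nu> :: "'j \<Rightarrow> real"
  assumes fin: "finite I" "finite J" and \<theta>: "0 \<le> \<theta>" "\<theta> \<le> 1"
    and D: "\<And>j. j \<in> J \<Longrightarrow> D j \<ge> 0"
    and left: "\<And>y. cmod (\<Sum>i\<in>I. c i * cis (\<mu> i * y)) \<le> B0"
    and right: "\<And>y. cmod (\<Sum>i\<in>I. c i * exp (\<mu> i) * cis (\<mu> i * y)) \<le> B1 - (\<Sum>j\<in>J. D j * cos (\<nu> j * y))"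
  shows "cmod (\<Sum>i\<in>I. c i * exp (\<theta> * \<mu> i)) \<le> (1 - \<theta>) * B0 + \<theta> * B1"
proof -
  have "cmod (\<Sum>i\<in>I. c i * complex_of_real (strip_kernel (1 - \<theta>) (\<mu> i)))
      \<le> Re (\<Sum>j\<in>{()}. complex_of_real B0 * complex_of_real (strip_kernel (1 - \<theta>) 0))"
    using \<theta> fin left by (intro pd_kernelD_finite pd_kernel_strip) auto
  then have 1: "cmod (\<Sum>i\<in>I. c i * complex_of_real (strip_kernel (1 - \<theta>) (\<mu> i))) \<le> (1 - \<theta>) * B0"
    by (simp add: mult.commute)
  \<comment> \<open>\<open>None\<close> stands for the constant B1 at frequency 0, where the kernel
    has value \<theta>; \<open>Some j\<close> stands for the subtracted cosine with index j.\<close>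
  define e where "e j = complex_of_real (case j of None \<Rightarrow> B1 | Some j \<Rightarrow> - D j)" for j
  define \<nu>' where "\<nu>' j = (case j of None \<Rightarrow> 0 | Some j \<Rightarrow> \<nu> j)" for j
  have sum_opt: "(\<Sum>j\<in>insert None (Some ` J). h j) = h None + (\<Sum>j\<in>J. h (Some j))" for h :: "'j option \<Rightarrow> real"
    using fin by (subst sum.insert) (auto simp: sum.reindex)
  have "cmod (\<Sum>i\<in>I. (c i * exp (\<mu> i)) * complex_of_real (strip_kernel \<theta> (\<mu> i)))
      \<le> Re (\<Sum>j\<in>insert None (Some ` J). e j * complex_of_real (strip_kernel \<theta> (\<nu>' j)))"
  proof (rule pd_kernelD_finite[OF pd_kernel_strip[OF \<theta>] fin(1)])
    fix y
    show "cmod (\<Sum>i\<in>I. c i * exp (\<mu> i) * cis (\<mu> i * y)) \<le> Re (\<Sum>j\<in>insert None (Some ` J). e j * cis (\<nu>' j * y))"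
      using right[of y] unfolding Re_sum sum_opt by (simp add: e_def \<nu>'_def sum_negf)
  qed (use fin in auto)
  also have "\<dots> = \<theta> * B1 - (\<Sum>j\<in>J. D j * strip_kernel \<theta> (\<nu> j))"
    unfolding Re_sum sum_opt by (simp add: e_def \<nu>'_def sum_negf)
  also have "\<dots> \<le> \<theta> * B1"
    using \<theta> D by (simp add: sum_nonneg strip_kernel_nonneg)
  finally have 2: "cmod (\<Sum>i\<in>I. (c i * exp (\<mu> i)) * complex_of_real (strip_kernel \<theta> (\<mu> i))) \<le> \<theta> * B1" .
  have "(\<Sum>i\<in>I. c i * exp (\<theta> * \<mu> i)) = (\<Sum>i\<in>I. c i * complex_of_real (strip_kernel (1 - \<theta>) (\<mu> i)))
      + (\<Sum>i\<in>I. (c i * exp (\<mu> i)) * complex_of_real (strip_kernel \<theta> (\<mu> i)))"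
    unfolding strip_kernel_split sum.distrib[symmetric]
    by (intro sum.cong) (auto simp: algebra_simps exp_of_real)
  then show ?thesis
    using 1 2 norm_triangle_ineq[of "\<Sum>i\<in>I. c i * complex_of_real (strip_kernel (1 - \<theta>) (\<mu> i))"
        "\<Sum>i\<in>I. (c i * exp (\<mu> i)) * complex_of_real (strip_kernel \<theta> (\<mu> i))"] by simp
qed

text \<open>Multiplying F by exp(\<kappa> z) / B0 normalises both boundary bounds to 1, so that the
  weighted arithmetic mean is 1 as well; undoing the factor at \<theta> leaves the geometric mean.
  The modulus of the factor is constant on each line, hence the cosine terms are merely
  rescaled.\<close>

lemma three_lines_geometric:
  fixes c :: "'i \<Rightarrow> complex" and \<mu> :: "'i \<Rightarrow> real" and D \<nu> :: "'j \<Rightarrow> real"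
  assumes fin: "finite I" "finite J" and \<theta>: "0 \<le> \<theta>" "\<theta> \<le> 1"
    and B: "B0 > 0" "B1 > 0"
    and D: "\<And>j. j \<in> J \<Longrightarrow> D j \<ge> 0"
    and F: "\<And>z :: complex. F z = (\<Sum>i\<in>I. c i * exp (\<mu> i * z))"
    and left: "\<And>y. cmod (F (\<i> * complex_of_real y)) \<le> B0"
    and right: "\<And>y. cmod (F (1 + \<i> * complex_of_real y)) \<le> B1 - (\<Sum>j\<in>J. D j * cos (\<nu> j * y))"
  shows "cmod (F (complex_of_real \<theta>)) \<le> B0 powr (1 - \<theta>) * B1 powr \<theta>"
proof -
  \<comment> \<open>With this value the factor exp(\<kappa> z) / B0 has modulus 1/B0 on the left
    line and 1/B1 on the right line.\<close>
  define \<kappa> where "\<kappa> = ln (B0 / B1)"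
  have \<kappa>: "exp \<kappa> = B0 / B1" using B by (simp add: \<kappa>_def)
  have shift: "(\<Sum>i\<in>I. c i / B0 * exp ((\<mu> i + \<kappa>) * z)) = exp (\<kappa> * z) / B0 * F z" for z :: complex
  proof -
    have "exp ((\<mu> i + \<kappa>) * z) = exp (\<kappa> * z) * exp (\<mu> i * z)" for i
      by (simp add: exp_add[symmetric] distrib_right add.commute)
    then show ?thesis by (simp add: F sum_distrib_left mult_ac)
  qed
  have cis: "cis (x * y) = exp (x * (\<i> * complex_of_real y))" for x y :: real
    by (simp add: cis_conv_exp mult_ac)
  have "cmod (\<Sum>i\<in>I. c i / B0 * exp (\<theta> * (\<mu> i + \<kappa>))) \<le> (1 - \<theta>) * 1 + \<theta> * 1"
  proof (rule three_lines_averaged[OF fin \<theta>, where D = "\<lambda>j. D j / B1" and \<nu> = \<nu>])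
    fix y
    show "cmod (\<Sum>i\<in>I. c i / B0 * cis ((\<mu> i + \<kappa>) * y)) \<le> 1"
      unfolding cis shift using left[of y] B by (simp add: norm_mult norm_divide)
    have "(\<Sum>i\<in>I. c i / B0 * exp (\<mu> i + \<kappa>) * cis ((\<mu> i + \<kappa>) * y))
        = (\<Sum>i\<in>I. c i / B0 * exp ((\<mu> i + \<kappa>) * (1 + \<i> * complex_of_real y)))"
      unfolding cis by (intro sum.cong) (auto simp: exp_of_real[symmetric] exp_add[symmetric] algebra_simps)
    also have "\<dots> = exp (\<kappa> * (1 + \<i> * complex_of_real y)) / B0 * F (1 + \<i> * complex_of_real y)"
      by (rule shift)
    also have "cmod \<dots> = cmod (F (1 + \<i> * complex_of_real y)) / B1"
      using B by (simp add: norm_mult norm_divide \<kappa>)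
    also have "\<dots> \<le> (B1 - (\<Sum>j\<in>J. D j * cos (\<nu> j * y))) / B1"
      using right B by (intro divide_right_mono) auto
    also have "\<dots> = 1 - (\<Sum>j\<in>J. D j / B1 * cos (\<nu> j * y))"
      using B by (simp add: diff_divide_distrib sum_divide_distrib)
    finally show "cmod (\<Sum>i\<in>I. c i / B0 * exp (\<mu> i + \<kappa>) * cis ((\<mu> i + \<kappa>) * y))
        \<le> 1 - (\<Sum>j\<in>J. D j / B1 * cos (\<nu> j * y))" .
  qed (use B D in auto)
  also have "(\<Sum>i\<in>I. c i / B0 * exp (\<theta> * (\<mu> i + \<kappa>))) = exp (\<kappa> * \<theta>) / B0 * F \<theta>"
    using shift[of "complex_of_real \<theta>"] by (simp add: exp_of_real[symmetric] mult.commute)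
  finally have "exp (\<kappa> * \<theta>) / B0 * cmod (F \<theta>) \<le> 1"
    using B by (simp add: norm_mult norm_divide)
  then have "cmod (F \<theta>) \<le> B0 / exp (\<kappa> * \<theta>)"
    using B by (simp add: pos_le_divide_eq mult.commute)
  also have "exp (\<kappa> * \<theta>) = B0 powr \<theta> / B1 powr \<theta>"
    using B by (simp add: \<kappa>_def powr_def ln_div exp_diff[symmetric] algebra_simps)
  also have "B0 / (B0 powr \<theta> / B1 powr \<theta>) = B0 powr (1 - \<theta>) * B1 powr \<theta>"
    using B by (simp add: powr_diff)
  finally show ?thesis .
qed

section \<open>Contractions described by their sesquilinear forms\<close>

definition contraction :: "nat \<Rightarrow> (nat \<Rightarrow> nat \<Rightarrow> complex) \<Rightarrow> bool" where
  "contraction d V \<longleftrightarrow> (\<forall>x y. cmod (\<Sum>i<d. \<Sum>j<d. cnj (x i) * V i j * y j)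
     \<le> sqrt (\<Sum>i<d. (cmod (x i))\<^sup>2) * sqrt (\<Sum>j<d. (cmod (y j))\<^sup>2))"

lemma contractionD:
  "contraction d V \<Longrightarrow> cmod (\<Sum>i<d. \<Sum>j<d. cnj (x i) * V i j * y j)
     \<le> sqrt (\<Sum>i<d. (cmod (x i))\<^sup>2) * sqrt (\<Sum>j<d. (cmod (y j))\<^sup>2)"
  by (simp add: contraction_def)

lemma le_one_if_le_sqrt:
  assumes "r \<le> sqrt r" shows "r \<le> (1::real)"
proof (rule ccontr)
  assume "\<not> r \<le> 1"
  then have "1 < sqrt r" by simp
  then have "sqrt r * 1 < sqrt r * sqrt r" by (intro mult_strict_left_mono) auto
  with \<open>\<not> r \<le> 1\<close> assms show False by simp
qed

text \<open>Test the form on the i-th unit vector and the conjugated row itself: the squared norm of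
  the row is then at most its own square root.\<close>

lemma contraction_row:
  assumes "contraction d V" "i < d" shows "(\<Sum>j<d. (cmod (V i j))\<^sup>2) \<le> 1"
proof -
  have "(\<Sum>i'<d. \<Sum>j<d. cnj (if i' = i then 1 else 0) * V i' j * cnj (V i j)) = (\<Sum>j<d. V i j * cnj (V i j))"
    using assms(2) by (subst sum.remove[of _ i]) auto
  also have "\<dots> = complex_of_real (\<Sum>j<d. (cmod (V i j))\<^sup>2)"
    unfolding of_real_sum complex_norm_square ..
  finally have eq: "(\<Sum>i'<d. \<Sum>j<d. cnj (if i' = i then 1 else 0) * V i' j * cnj (V i j)) = complex_of_real (\<Sum>j<d. (cmod (V i j))\<^sup>2)" .
  have "(\<Sum>i'<d. (cmod (if i' = i then 1 else 0))\<^sup>2) = (1::real)"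
    using assms(2) by (subst sum.remove[of _ i]) auto
  with contractionD[OF assms(1), of "\<lambda>i'. if i' = i then 1 else 0" "\<lambda>j. cnj (V i j)"]
  have "(\<Sum>j<d. (cmod (V i j))\<^sup>2) \<le> sqrt (\<Sum>j<d. (cmod (V i j))\<^sup>2)"
    unfolding eq by (simp add: sum_nonneg del: of_real_sum)
  then show ?thesis by (intro le_one_if_le_sqrt)
qed

lemma contraction_col:
  assumes "contraction d V" "j < d" shows "(\<Sum>i<d. (cmod (V i j))\<^sup>2) \<le> 1"
proof -
  have "(\<Sum>i<d. \<Sum>j'<d. cnj (V i j) * V i j' * (if j' = j then 1 else 0)) = (\<Sum>i<d. V i j * cnj (V i j))"
    using assms(2) by (intro sum.cong refl, subst sum.remove[of _ j]) auto
  also have "\<dots> = complex_of_real (\<Sum>i<d. (cmod (V i j))\<^sup>2)"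
    unfolding of_real_sum complex_norm_square ..
  finally have eq: "(\<Sum>i<d. \<Sum>j'<d. cnj (V i j) * V i j' * (if j' = j then 1 else 0)) = complex_of_real (\<Sum>i<d. (cmod (V i j))\<^sup>2)" .
  have "(\<Sum>j'<d. (cmod (if j' = j then 1 else 0))\<^sup>2) = (1::real)"
    using assms(2) by (subst sum.remove[of _ j]) auto
  with contractionD[OF assms(1), of "\<lambda>i. V i j" "\<lambda>j'. if j' = j then 1 else 0"]
  have "(\<Sum>i<d. (cmod (V i j))\<^sup>2) \<le> sqrt (\<Sum>i<d. (cmod (V i j))\<^sup>2)"
    unfolding eq by (simp add: sum_nonneg del: of_real_sum)
  then show ?thesis by (intro le_one_if_le_sqrt)
qed

text \<open>In operator form: \<open>\<parallel>R V R\<parallel>\<^sub>2\<^sup>2 \<le> tr R\<^sup>4\<close> for \<open>R = diag (sqrt r)\<close>.\<close>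
lemma contraction_weighted_frobenius:
  fixes r :: "nat \<Rightarrow> real"
  assumes "contraction d V"
  shows "(\<Sum>i<d. \<Sum>j<d. r i * r j * (cmod (V j i))\<^sup>2) \<le> (\<Sum>i<d. (r i)\<^sup>2)"
proof -
  have "(\<Sum>i<d. \<Sum>j<d. r i * r j * (cmod (V j i))\<^sup>2)
      \<le> (\<Sum>i<d. \<Sum>j<d. ((r i)\<^sup>2 / 2 * (cmod (V j i))\<^sup>2 + (r j)\<^sup>2 / 2 * (cmod (V j i))\<^sup>2))"
  proof (intro sum_mono)
    fix i j
    \<comment> \<open>The symmetric split leaves one half that is summed along columns of V and one
      that is summed along rows, where the contraction bounds apply.\<close>
    have "r i * r j \<le> (r i)\<^sup>2 / 2 + (r j)\<^sup>2 / 2"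
      using sum_squares_bound[of "r i" "r j"] by simp
    from mult_right_mono[OF this, of "(cmod (V j i))\<^sup>2"]
    show "r i * r j * (cmod (V j i))\<^sup>2 \<le> (r i)\<^sup>2 / 2 * (cmod (V j i))\<^sup>2 + (r j)\<^sup>2 / 2 * (cmod (V j i))\<^sup>2"
      by (simp add: distrib_right)
  qed
  also have "\<dots> = (\<Sum>i<d. (r i)\<^sup>2 / 2 * (\<Sum>j<d. (cmod (V j i))\<^sup>2)) + (\<Sum>j<d. (r j)\<^sup>2 / 2 * (\<Sum>i<d. (cmod (V j i))\<^sup>2))"
  proof -
    have "(\<Sum>i<d. \<Sum>j<d. (r j)\<^sup>2 / 2 * (cmod (V j i))\<^sup>2) = (\<Sum>j<d. (r j)\<^sup>2 / 2 * (\<Sum>i<d. (cmod (V j i))\<^sup>2))"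
      by (subst sum.swap) (simp only: sum_distrib_left)
    then show ?thesis by (simp only: sum.distrib sum_distrib_left)
  qed
  also have "\<dots> \<le> (\<Sum>i<d. (r i)\<^sup>2 / 2 * 1) + (\<Sum>j<d. (r j)\<^sup>2 / 2 * 1)"
    by (intro add_mono sum_mono mult_left_mono contraction_col[OF assms] contraction_row[OF assms]) auto
  also have "\<dots> = (\<Sum>i<d. (r i)\<^sup>2)"
    by (simp add: sum.distrib[symmetric])
  finally show ?thesis .
qed

section \<open>Second moment of a balanced universal hash family\<close>

definition collision_prob :: "'s set \<Rightarrow> ('s \<Rightarrow> 'x \<Rightarrow> 'm) \<Rightarrow> 'x \<Rightarrow> 'x \<Rightarrow> real" where
  "collision_prob S f l l' = real (card {s \<in> S. f s l = f s l'}) / real (card S)"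

text \<open>A fibre sum minus the mean of all fibre sums. Entry by entry, and with the weight 1/|L|
  put into z, this is the block at m of the difference whose trace norm \<open>dbar\<close>
  averages.\<close>

definition deviation :: "'x set \<Rightarrow> 'm set \<Rightarrow> ('x \<Rightarrow> 'm) \<Rightarrow> 'm \<Rightarrow> ('x \<Rightarrow> complex) \<Rightarrow> complex" where
  "deviation L M h m z = (\<Sum>l\<in>{l\<in>L. h l = m}. z l) - (\<Sum>l\<in>L. z l) / of_nat (card M)"

lemma sum_fibre_eq:
  fixes z :: "'x \<Rightarrow> complex"
  assumes "finite L"
  shows "(\<Sum>l\<in>{l\<in>L. h l = m}. z l) = (\<Sum>l\<in>L. of_bool (h l = m) * z l)"
  unfolding sum.inter_filter[OF assms] by (intro sum.cong) auto

lemma sum_fibre_all: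
  fixes z :: "'x \<Rightarrow> complex"
  assumes "finite L" "finite M" "\<And>l. l \<in> L \<Longrightarrow> h l \<in> M"
  shows "(\<Sum>m\<in>M. \<Sum>l\<in>{l\<in>L. h l = m}. z l) = (\<Sum>l\<in>L. z l)"
  using assms by (intro sum.group) auto

lemma sum_centred_product:
  fixes w w' :: "'m \<Rightarrow> complex"
  shows "(\<Sum>m\<in>M. (w m - a) * (w' m - b))
    = (\<Sum>m\<in>M. w m * w' m) - (\<Sum>m\<in>M. w m) * b - a * (\<Sum>m\<in>M. w' m) + of_nat (card M) * (a * b)"
  by (simp add: left_diff_distrib right_diff_distrib sum_subtractf sum_distrib_left sum_distrib_right)

text \<open>Centring lowers the sum of the squared fibre sums by |t|^2 / |M|, t being the total; and
  a pair (l, l') contributes to the squared fibre sums exactly when it collides.\<close>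

lemma deviation_square_sum:
  fixes z :: "'x \<Rightarrow> complex"
  assumes "finite L" "finite M" "M \<noteq> {}" "\<And>l. l \<in> L \<Longrightarrow> h l \<in> M"
  shows "complex_of_real (\<Sum>m\<in>M. (cmod (deviation L M h m z))\<^sup>2)
    = (\<Sum>l\<in>L. \<Sum>l'\<in>L. (of_bool (h l = h l') - 1 / of_nat (card M)) * (z l * cnj (z l')))"
proof -
  let ?w = "\<lambda>m. \<Sum>l\<in>{l\<in>L. h l = m}. z l" and ?t = "\<Sum>l\<in>L. z l" and ?n = "of_nat (card M) :: complex"
  have n: "?n \<noteq> 0" using assms by simp
  have "complex_of_real (\<Sum>m\<in>M. (cmod (deviation L M h m z))\<^sup>2)
      = (\<Sum>m\<in>M. (?w m - ?t / ?n) * (cnj (?w m) - cnj ?t / ?n))"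
    unfolding of_real_sum complex_norm_square deviation_def by simp
  also have "\<dots> = (\<Sum>m\<in>M. ?w m * cnj (?w m)) - (\<Sum>m\<in>M. ?w m) * (cnj ?t / ?n) - (?t / ?n) * cnj (\<Sum>m\<in>M. ?w m) + ?n * ((?t / ?n) * (cnj ?t / ?n))"
    unfolding cnj_sum[of _ M] by (rule sum_centred_product)
  also have "\<dots> = (\<Sum>m\<in>M. ?w m * cnj (?w m)) - ?t * cnj ?t / ?n"
  proof -
    have "(\<Sum>m\<in>M. ?w m) = ?t"
      using assms by (intro sum_fibre_all) auto
    then show ?thesis using n by (simp only:) (simp add: divide_simps)
  qed
  also have "(\<Sum>m\<in>M. ?w m * cnj (?w m)) = (\<Sum>m\<in>M. \<Sum>l\<in>L. \<Sum>l'\<in>L. of_bool (h l = m) * (of_bool (h l' = m) * (z l * cnj (z l'))))"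
    unfolding sum_fibre_eq[OF assms(1)] cnj_sum sum_product by (intro sum.cong) (auto simp: mult_ac)
  also have "\<dots> = (\<Sum>l\<in>L. \<Sum>l'\<in>L. \<Sum>m\<in>M. of_bool (h l = m) * (of_bool (h l' = m) * (z l * cnj (z l'))))"
    by (subst sum.swap, intro sum.cong refl, subst sum.swap, rule refl)
  also have "\<dots> = (\<Sum>l\<in>L. \<Sum>l'\<in>L. of_bool (h l = h l') * (z l * cnj (z l')))"
  proof (intro sum.cong refl)
    fix l l' assume l: "l \<in> L"
    have "(\<Sum>m\<in>M. of_bool (h l = m) * (of_bool (h l' = m) * (z l * cnj (z l'))))
       = (\<Sum>m\<in>M. if h l = m then of_bool (h l' = m) * (z l * cnj (z l')) else 0)"
      by (intro sum.cong) auto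
    then show "(\<Sum>m\<in>M. of_bool (h l = m) * (of_bool (h l' = m) * (z l * cnj (z l')))) = of_bool (h l = h l') * (z l * cnj (z l'))"
      using assms(2,4) l by (auto simp: sum.delta)
  qed
  also have "\<dots> - ?t * cnj ?t / ?n = (\<Sum>l\<in>L. \<Sum>l'\<in>L. (of_bool (h l = h l') - 1 / ?n) * (z l * cnj (z l')))"
    unfolding cnj_sum sum_product sum_divide_distrib sum_subtractf[symmetric]
    by (intro sum.cong) (auto simp: algebra_simps)
  finally show ?thesis .
qed

text \<open>Averaging over the seed turns collision indicators into collision probabilities, so
  universality makes precisely the off-diagonal weights nonpositive.\<close>

lemma mean_deviation_square:
  fixes z :: "'x \<Rightarrow> complex"
  assumes "finite S" "S \<noteq> {}" "finite L" "finite M" "M \<noteq> {}" "\<And>s l. s \<in> S \<Longrightarrow> l \<in> L \<Longrightarrow> f s l \<in> M"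
  shows "complex_of_real ((\<Sum>s\<in>S. \<Sum>m\<in>M. (cmod (deviation L M (f s) m z))\<^sup>2) / real (card S))
    = (\<Sum>l\<in>L. \<Sum>l'\<in>L. complex_of_real (collision_prob S f l l' - 1 / real (card M)) * (z l * cnj (z l')))"
proof -
  have "complex_of_real (\<Sum>s\<in>S. \<Sum>m\<in>M. (cmod (deviation L M (f s) m z))\<^sup>2)
      = (\<Sum>s\<in>S. \<Sum>l\<in>L. \<Sum>l'\<in>L. (of_bool (f s l = f s l') - 1 / of_nat (card M)) * (z l * cnj (z l')))"
    unfolding of_real_sum[of _ S] using assms by (intro sum.cong refl deviation_square_sum) auto
  also have "\<dots> = (\<Sum>l\<in>L. \<Sum>l'\<in>L. \<Sum>s\<in>S. (of_bool (f s l = f s l') - 1 / of_nat (card M)) * (z l * cnj (z l')))"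
    by (subst sum.swap, intro sum.cong refl, subst sum.swap, rule refl)
  also have "\<dots> = (\<Sum>l\<in>L. \<Sum>l'\<in>L. of_nat (card S) * (complex_of_real (collision_prob S f l l' - 1 / real (card M)) * (z l * cnj (z l'))))"
  proof (intro sum.cong refl)
    fix l l'
    have "(\<Sum>s\<in>S. of_bool (f s l = f s l')) = (of_nat (card {s\<in>S. f s l = f s l'}) :: complex)"
      using assms(1) by (simp add: of_bool_def sum.If_cases Int_def)
    then have "(\<Sum>s\<in>S. of_bool (f s l = f s l') - 1 / of_nat (card M)) = (of_nat (card S) * complex_of_real (collision_prob S f l l' - 1 / real (card M)))"
      using assms(1,2) by (simp add: sum_subtractf collision_prob_def right_diff_distrib)
    then show "(\<Sum>s\<in>S. (of_bool (f s l = f s l') - 1 / of_nat (card M)) * (z l * cnj (z l')))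
       = of_nat (card S) * (complex_of_real (collision_prob S f l l' - 1 / real (card M)) * (z l * cnj (z l')))"
      unfolding sum_distrib_right[symmetric] by (simp only: mult.assoc)
  qed
  finally show ?thesis
    using assms(1,2) by (simp add: sum_distrib_left[symmetric] del: of_real_sum of_real_diff)
qed

section \<open>Complex powers and the interpolating family\<close>

definition spow :: "real \<Rightarrow> complex \<Rightarrow> complex" where
  "spow x z = (if x > 0 then exp (z * complex_of_real (ln x)) else 0)"

text \<open>At x = 0 both sides are 0 for every exponent, including 0 and negative ones; this
  matches the support convention of \<open>mpow\<close>.\<close>

lemma spow_of_real: "x \<ge> 0 \<Longrightarrow> spow x (complex_of_real a) = complex_of_real (x powr a)"
  by (auto simp: spow_def powr_def exp_of_real[symmetric] mult.commute)

lemma norm_spow: "x \<ge> 0 \<Longrightarrow> cmod (spow x z) = x powr Re z"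
  by (auto simp: spow_def powr_def)

text \<open>Passing to the adjoint moves the deviation from the data z to the test values v. For
  each seed the coefficient of z l is one test value minus the mean of all of them, a quantity that
  can be bounded separately for each l.\<close>

lemma deviation_pairing:
  fixes v :: "'s \<Rightarrow> 'm \<Rightarrow> complex" and z :: "'x \<Rightarrow> complex"
  assumes "finite L" "finite M" "\<And>s l. s \<in> S \<Longrightarrow> l \<in> L \<Longrightarrow> f s l \<in> M"
  shows "(\<Sum>s\<in>S. \<Sum>m\<in>M. v s m * deviation L M (f s) m z)
    = (\<Sum>l\<in>L. (\<Sum>s\<in>S. v s (f s l) - (\<Sum>m\<in>M. v s m) / of_nat (card M)) * z l)"
proof -
  have "(\<Sum>m\<in>M. v s m * deviation L M (f s) m z) = (\<Sum>l\<in>L. (v s (f s l) - (\<Sum>m\<in>M. v s m) / of_nat (card M)) * z l)"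
    if s: "s \<in> S" for s
  proof -
    have "(\<Sum>m\<in>M. v s m * (\<Sum>l\<in>{l\<in>L. f s l = m}. z l)) = (\<Sum>m\<in>M. \<Sum>l\<in>{l\<in>L. f s l = m}. v s (f s l) * z l)"
      by (simp add: sum_distrib_left)
    also have "\<dots> = (\<Sum>l\<in>L. v s (f s l) * z l)"
      using assms s by (intro sum_fibre_all) auto
    finally show ?thesis
      unfolding deviation_def right_diff_distrib left_diff_distrib sum_subtractf
      by (simp add: sum_distrib_left[symmetric] sum_distrib_right[symmetric] sum_divide_distrib[symmetric])
  qed
  then have "(\<Sum>s\<in>S. \<Sum>m\<in>M. v s m * deviation L M (f s) m z) = (\<Sum>s\<in>S. \<Sum>l\<in>L. (v s (f s l) - (\<Sum>m\<in>M. v s m) / of_nat (card M)) * z l)"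
    by (intro sum.cong) auto
  also have "\<dots> = (\<Sum>l\<in>L. (\<Sum>s\<in>S. v s (f s l) - (\<Sum>m\<in>M. v s m) / of_nat (card M)) * z l)"
    by (subst sum.swap) (simp only: sum_distrib_right)
  finally show ?thesis .
qed

lemma deviation_scale: "deviation L M h m (\<lambda>l. c * z l) = c * deviation L M h m z"
  by (simp add: deviation_def right_diff_distrib sum_distrib_left)

text \<open>\<open>\<sigma>\<close> lists the eigenvalues of the reference operator, \<open>\<kappa> l\<close> and \<open>u l\<close> the eigenvalues and the eigenvectors
  (column \<open>k\<close>, written in the eigenbasis of the reference operator) of \<open>X\<^sub>l\<close>, and \<open>V s m\<close> is the contraction
  against which the deviation at \<open>(s, m)\<close> is tested.\<close>
locale hashed_ensemble =
  fixes S :: "'s set" and f :: "'s \<Rightarrow> 'x \<Rightarrow> 'm" and L :: "'x set" and M :: "'m set"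
    and d :: nat and \<sigma> :: "nat \<Rightarrow> real" and \<kappa> :: "'x \<Rightarrow> nat \<Rightarrow> real"
    and u :: "'x \<Rightarrow> nat \<Rightarrow> nat \<Rightarrow> complex" and V :: "'s \<Rightarrow> 'm \<Rightarrow> nat \<Rightarrow> nat \<Rightarrow> complex"
    and p \<tau> :: real
  assumes finite_S: "finite S" "S \<noteq> {}" and finite_L: "finite L"
    and finite_M: "finite M" "M \<noteq> {}"
    and hash_in: "s \<in> S \<Longrightarrow> l \<in> L \<Longrightarrow> f s l \<in> M"
    and collision: "l \<in> L \<Longrightarrow> l' \<in> L \<Longrightarrow> l \<noteq> l' \<Longrightarrow> collision_prob S f l l' \<le> 1 / real (card M)"
    and \<sigma>_nonneg: "\<sigma> i \<ge> 0" and \<sigma>_sum: "(\<Sum>i<d. \<sigma> i) = \<tau>" and \<tau>_pos: "\<tau> > 0"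
    and \<kappa>_nonneg: "\<kappa> l k \<ge> 0"
    and orthonormal: "l \<in> L \<Longrightarrow> k < d \<Longrightarrow> k' < d \<Longrightarrow> (\<Sum>i<d. u l i k * cnj (u l i k')) = of_bool (k = k')"
    and contr: "s \<in> S \<Longrightarrow> m \<in> M \<Longrightarrow> contraction d (V s m)"
begin

definition Z :: "complex \<Rightarrow> 'x \<Rightarrow> nat \<Rightarrow> nat \<Rightarrow> complex" where
  "Z w l i j = (\<Sum>k<d. spow (\<kappa> l k) w * (u l i k * cnj (u l j k)))"

definition A :: "complex \<Rightarrow> 'x \<Rightarrow> nat \<Rightarrow> nat \<Rightarrow> complex" where
  "A z l i j = spow (\<sigma> i) (z / 4) * spow (\<sigma> j) (z / 4) * Z (complex_of_real p * (1 - z / 2)) l i j"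

text \<open>The scalar function to be interpolated. When the V attain the trace norms and A at
  \<theta> is the given ensemble, its real part at \<theta> is \<open>dbar\<close>.\<close>

definition F :: "complex \<Rightarrow> complex" where
  "F z = (\<Sum>s\<in>S. \<Sum>m\<in>M. \<Sum>i<d. \<Sum>j<d. V s m j i * deviation L M (f s) m (\<lambda>l. A z l i j)) / of_nat (card S)"

text \<open>The adjoint of the averaged deviation map applied to the test operators, so that F z
  becomes the sum over l of tr(Y_l A_l(z)).\<close>

definition Y :: "'x \<Rightarrow> nat \<Rightarrow> nat \<Rightarrow> complex" where
  "Y l j i = (\<Sum>s\<in>S. V s (f s l) j i - (\<Sum>m\<in>M. V s m j i) / of_nat (card M)) / of_nat (card S)"

text \<open>The sum of the traces of X_l^p. For p = 1+t and the sandwiched blocks as X_l it is the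
  trace inside the sandwiched divergence.\<close>

definition mass :: real where
  "mass = (\<Sum>l\<in>L. \<Sum>k<d. \<kappa> l k powr p)"

lemma card_pos: "card S > 0" "card M > 0"
  using finite_S finite_M by (auto simp: card_gt_0_iff)

lemma mass_nonneg: "mass \<ge> 0"
  by (simp add: mass_def sum_nonneg)

lemma F_pairing: "F z = (\<Sum>l\<in>L. \<Sum>i<d. \<Sum>j<d. Y l j i * A z l i j)"
proof -
  have "(\<Sum>s\<in>S. \<Sum>m\<in>M. \<Sum>i<d. \<Sum>j<d. V s m j i * deviation L M (f s) m (\<lambda>l. A z l i j))
     = (\<Sum>s\<in>S. \<Sum>i<d. \<Sum>m\<in>M. \<Sum>j<d. V s m j i * deviation L M (f s) m (\<lambda>l. A z l i j))"
    by (intro sum.cong refl sum.swap)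
  also have "\<dots> = (\<Sum>i<d. \<Sum>s\<in>S. \<Sum>j<d. \<Sum>m\<in>M. V s m j i * deviation L M (f s) m (\<lambda>l. A z l i j))"
    by (subst sum.swap) (intro sum.cong refl sum.swap)
  also have "\<dots> = (\<Sum>i<d. \<Sum>j<d. \<Sum>s\<in>S. \<Sum>m\<in>M. V s m j i * deviation L M (f s) m (\<lambda>l. A z l i j))"
    by (intro sum.cong refl sum.swap)
  also have "\<dots> = (\<Sum>i<d. \<Sum>j<d. \<Sum>l\<in>L. (\<Sum>s\<in>S. V s (f s l) j i - (\<Sum>m\<in>M. V s m j i) / of_nat (card M)) * A z l i j)"
    using finite_L finite_M hash_in by (intro sum.cong refl deviation_pairing) auto
  also have "\<dots> = (\<Sum>i<d. \<Sum>l\<in>L. \<Sum>j<d. (\<Sum>s\<in>S. V s (f s l) j i - (\<Sum>m\<in>M. V s m j i) / of_nat (card M)) * A z l i j)"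
    by (intro sum.cong refl sum.swap)
  also have "\<dots> = (\<Sum>l\<in>L. \<Sum>i<d. \<Sum>j<d. (\<Sum>s\<in>S. V s (f s l) j i - (\<Sum>m\<in>M. V s m j i) / of_nat (card M)) * A z l i j)"
    by (rule sum.swap)
  finally show ?thesis
    unfolding F_def by (simp only: Y_def times_divide_eq_left sum_divide_distrib[symmetric])
qed

text \<open>For each seed, Y averages a contraction minus a mean of contractions, hence the norm
  bound 2. This is the origin of the factor \<open>2 powr (1 - \<theta>)\<close>.\<close>

lemma Y_bound:
  assumes l: "l \<in> L"
  shows "cmod (\<Sum>j<d. \<Sum>i<d. cnj (x j) * Y l j i * y i)
    \<le> 2 * (sqrt (\<Sum>i<d. (cmod (x i))\<^sup>2) * sqrt (\<Sum>i<d. (cmod (y i))\<^sup>2))"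
proof -
  let ?b = "\<lambda>W. (\<Sum>j<d. \<Sum>i<d. cnj (x j) * W j i * y i)"
  let ?N = "sqrt (\<Sum>i<d. (cmod (x i))\<^sup>2) * sqrt (\<Sum>i<d. (cmod (y i))\<^sup>2)"
  have bsum: "?b (\<lambda>j i. \<Sum>a\<in>T. W a j i) = (\<Sum>a\<in>T. ?b (W a))" for T :: "'t set" and W
  proof -
    have "?b (\<lambda>j i. \<Sum>a\<in>T. W a j i) = (\<Sum>j<d. \<Sum>i<d. \<Sum>a\<in>T. cnj (x j) * W a j i * y i)"
      by (simp add: sum_distrib_left sum_distrib_right)
    also have "\<dots> = (\<Sum>j<d. \<Sum>a\<in>T. \<Sum>i<d. cnj (x j) * W a j i * y i)"
      by (intro sum.cong refl sum.swap)
    also have "\<dots> = (\<Sum>a\<in>T. ?b (W a))" by (rule sum.swap)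
    finally show ?thesis .
  qed
  have bdiff: "?b (\<lambda>j i. W j i - W' j i / c) = ?b W - ?b W' / c" for W W' and c :: complex
    by (simp add: algebra_simps sum_subtractf sum_divide_distrib)
  have eq: "?b (Y l) = (\<Sum>s\<in>S. ?b (V s (f s l)) - (\<Sum>m\<in>M. ?b (V s m)) / of_nat (card M)) / of_nat (card S)"
  proof -
    have "?b (Y l) = ?b (\<lambda>j i. \<Sum>s\<in>S. V s (f s l) j i - (\<Sum>m\<in>M. V s m j i) / of_nat (card M)) / of_nat (card S)"
      by (simp only: Y_def times_divide_eq_left times_divide_eq_right sum_divide_distrib[symmetric])
    then show ?thesis by (simp only: bsum bdiff)
  qed
  have "cmod (?b (Y l)) \<le> (\<Sum>s\<in>S. cmod (?b (V s (f s l)) - (\<Sum>m\<in>M. ?b (V s m)) / of_nat (card M))) / real (card S)"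
    unfolding eq norm_divide norm_of_nat by (intro divide_right_mono norm_sum) simp
  also have "\<dots> \<le> (\<Sum>s\<in>S. 2 * ?N) / real (card S)"
  proof (intro divide_right_mono sum_mono)
    fix s assume s: "s \<in> S"
    have "cmod (\<Sum>m\<in>M. ?b (V s m)) \<le> (\<Sum>m\<in>M. ?N)"
      using s by (intro sum_norm_le contractionD contr)
    then have "cmod ((\<Sum>m\<in>M. ?b (V s m)) / of_nat (card M)) \<le> ?N"
      using card_pos by (simp add: norm_divide divide_le_eq mult.commute)
    moreover have "cmod (?b (V s (f s l))) \<le> ?N"
      using s l by (intro contractionD contr hash_in)
    ultimately show "cmod (?b (V s (f s l)) - (\<Sum>m\<in>M. ?b (V s m)) / of_nat (card M)) \<le> 2 * ?N"
      using norm_triangle_ineq4[of "?b (V s (f s l))" "(\<Sum>m\<in>M. ?b (V s m)) / of_nat (card M)"] by linarith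
  qed simp
  also have "\<dots> = 2 * ?N" using card_pos by simp
  finally show ?thesis .
qed

lemma norm_spow_le_1: "Re z = 0 \<Longrightarrow> cmod (spow x z) \<le> 1"
  by (simp add: spow_def)

text \<open>At Re z = 0 the powers of \<sigma> are phases, or 0 on the kernel, and the coefficients
  of X_l^(p(1-z/2)) in its eigenbasis have modulus \<kappa>^p. Each eigenvector therefore
  contributes \<kappa>^p times the form of Y_l on two vectors of norm at most 1.\<close>

lemma left_bound: "cmod (F (\<i> * complex_of_real y)) \<le> 2 * mass"
proof -
  let ?z = "\<i> * complex_of_real y"
  define b where "b i = spow (\<sigma> i) (?z / 4)" for i
  define \<zeta> where "\<zeta> l k = spow (\<kappa> l k) (complex_of_real p * (1 - ?z / 2))" for l k
  have b: "cmod (b i) \<le> 1" for i unfolding b_def by (rule norm_spow_le_1) simp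
  have \<zeta>: "cmod (\<zeta> l k) = \<kappa> l k powr p" for l k
    unfolding \<zeta>_def by (subst norm_spow[OF \<kappa>_nonneg]) simp
  have "F ?z = (\<Sum>l\<in>L. \<Sum>i<d. \<Sum>j<d. \<Sum>k<d. \<zeta> l k * (cnj (cnj (b j) * u l j k) * Y l j i * (b i * u l i k)))"
    unfolding F_pairing A_def Z_def b_def[symmetric] \<zeta>_def[symmetric] sum_distrib_left
    by (intro sum.cong) (auto simp: mult_ac)
  also have "\<dots> = (\<Sum>l\<in>L. \<Sum>k<d. \<zeta> l k * (\<Sum>j<d. \<Sum>i<d. cnj (cnj (b j) * u l j k) * Y l j i * (b i * u l i k)))"
  proof (rule sum.cong[OF refl])
    fix l
    let ?g = "\<lambda>i j k. \<zeta> l k * (cnj (cnj (b j) * u l j k) * Y l j i * (b i * u l i k))"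
    have "(\<Sum>i<d. \<Sum>j<d. \<Sum>k<d. ?g i j k) = (\<Sum>j<d. \<Sum>i<d. \<Sum>k<d. ?g i j k)"
      by (rule sum.swap)
    also have "\<dots> = (\<Sum>j<d. \<Sum>k<d. \<Sum>i<d. ?g i j k)"
      by (intro sum.cong refl sum.swap)
    also have "\<dots> = (\<Sum>k<d. \<Sum>j<d. \<Sum>i<d. ?g i j k)"
      by (rule sum.swap)
    finally show "(\<Sum>i<d. \<Sum>j<d. \<Sum>k<d. ?g i j k)
      = (\<Sum>k<d. \<zeta> l k * (\<Sum>j<d. \<Sum>i<d. cnj (cnj (b j) * u l j k) * Y l j i * (b i * u l i k)))"
      by (simp only: sum_distrib_left)
  qed
  finally have eq: "F ?z = (\<Sum>l\<in>L. \<Sum>k<d. \<zeta> l k * (\<Sum>j<d. \<Sum>i<d. cnj (cnj (b j) * u l j k) * Y l j i * (b i * u l i k)))" .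
  have "cmod (F ?z) \<le> (\<Sum>l\<in>L. \<Sum>k<d. \<kappa> l k powr p * 2)"
    unfolding eq
  proof (rule sum_norm_le, rule sum_norm_le)
    fix l k assume l: "l \<in> L" and k: "k \<in> {..<d}"
    have unit: "(\<Sum>i<d. (cmod (u l i k))\<^sup>2) = 1"
    proof -
      have "complex_of_real (\<Sum>i<d. (cmod (u l i k))\<^sup>2) = 1"
        unfolding of_real_sum complex_norm_square using orthonormal[OF l] k by simp
      then show ?thesis using of_real_eq_1_iff by blast
    qed
    have le: "(\<Sum>i<d. (cmod (g i * u l i k))\<^sup>2) \<le> 1" if "\<And>i. cmod (g i) \<le> 1" for g
    proof -
      have "(\<Sum>i<d. (cmod (g i * u l i k))\<^sup>2) \<le> (\<Sum>i<d. (cmod (u l i k))\<^sup>2)"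
        using that by (intro sum_mono power_mono) (auto simp: norm_mult mult_left_le_one_le)
      with unit show ?thesis by simp
    qed
    have "cmod (\<Sum>j<d. \<Sum>i<d. cnj (cnj (b j) * u l j k) * Y l j i * (b i * u l i k))
       \<le> 2 * (sqrt (\<Sum>i<d. (cmod (cnj (b i) * u l i k))\<^sup>2) * sqrt (\<Sum>i<d. (cmod (b i * u l i k))\<^sup>2))"
      by (rule Y_bound[OF l])
    also have "\<dots> \<le> 2 * (1 * 1)"
      using le[of "\<lambda>i. cnj (b i)"] le[of b] b by (intro mult_left_mono mult_mono) (auto simp: sum_nonneg)
    finally show "cmod (\<zeta> l k * (\<Sum>j<d. \<Sum>i<d. cnj (cnj (b j) * u l j k) * Y l j i * (b i * u l i k))) \<le> \<kappa> l k powr p * 2"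
      unfolding norm_mult \<zeta> by (intro mult_left_mono) auto
  qed
  also have "\<dots> = 2 * mass" by (simp add: mass_def sum_distrib_left mult.commute)
  finally show ?thesis .
qed

text \<open>The Hilbert-Schmidt product in terms of two spectral decompositions: the eigenvectors
  enter only through squared overlaps, which are nonnegative, and all phases sit in the eigenvalue
  factors.\<close>

lemma Z_pairing:
  "(\<Sum>i<d. \<Sum>j<d. Z w l i j * cnj (Z w l' i j))
    = (\<Sum>k<d. \<Sum>k'<d. spow (\<kappa> l k) w * cnj (spow (\<kappa> l' k') w) * complex_of_real ((cmod (\<Sum>i<d. u l i k * cnj (u l' i k')))\<^sup>2))"
proof -
  have "(\<Sum>i<d. \<Sum>j<d. Z w l i j * cnj (Z w l' i j))
    = (\<Sum>i<d. \<Sum>j<d. \<Sum>k<d. \<Sum>k'<d. spow (\<kappa> l k) w * cnj (spow (\<kappa> l' k') w) * (u l i k * cnj (u l' i k') * (cnj (u l j k) * u l' j k')))"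
    unfolding Z_def cnj_sum sum_product by (intro sum.cong) (auto simp: mult_ac)
  also have "\<dots> = (\<Sum>i<d. \<Sum>k<d. \<Sum>j<d. \<Sum>k'<d. spow (\<kappa> l k) w * cnj (spow (\<kappa> l' k') w) * (u l i k * cnj (u l' i k') * (cnj (u l j k) * u l' j k')))"
    by (intro sum.cong refl sum.swap)
  also have "\<dots> = (\<Sum>k<d. \<Sum>i<d. \<Sum>k'<d. \<Sum>j<d. spow (\<kappa> l k) w * cnj (spow (\<kappa> l' k') w) * (u l i k * cnj (u l' i k') * (cnj (u l j k) * u l' j k')))"
    by (subst sum.swap) (intro sum.cong refl sum.swap)
  also have "\<dots> = (\<Sum>k<d. \<Sum>k'<d. \<Sum>i<d. \<Sum>j<d. spow (\<kappa> l k) w * cnj (spow (\<kappa> l' k') w) * (u l i k * cnj (u l' i k') * (cnj (u l j k) * u l' j k')))"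
    by (intro sum.cong refl sum.swap)
  also have "\<dots> = (\<Sum>k<d. \<Sum>k'<d. spow (\<kappa> l k) w * cnj (spow (\<kappa> l' k') w) * complex_of_real ((cmod (\<Sum>i<d. u l i k * cnj (u l' i k')))\<^sup>2))"
    unfolding complex_norm_square cnj_sum sum_product sum_distrib_left[symmetric] by simp
  finally show ?thesis .
qed

text \<open>Here w is p (1 - z/2) at z = 1 + i y. If an eigenvalue vanishes, both sides are
  0.\<close>

lemma spow_product_Re:
  assumes "Re w = p / 2" "Im w = - p * y / 2" "a \<ge> 0" "b \<ge> 0"
  shows "Re (spow a w * cnj (spow b w)) = a powr (p / 2) * b powr (p / 2) * cos ((p / 2 * (ln b - ln a)) * y)"
proof (cases "a > 0 \<and> b > 0")
  case True
  have w: "w = complex_of_real (p / 2) + \<i> * complex_of_real (- p * y / 2)"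
    using assms by (simp add: complex_eq_iff)
  have "spow a w * cnj (spow b w) = exp (w * complex_of_real (ln a) + cnj w * complex_of_real (ln b))"
    using True by (simp add: spow_def exp_cnj exp_add)
  also have "Re \<dots> = exp (p / 2 * ln a + p / 2 * ln b) * cos (- p * y / 2 * ln a + p * y / 2 * ln b)"
    unfolding w by (simp add: Re_exp)
  also have "- p * y / 2 * ln a + p * y / 2 * ln b = (p / 2 * (ln b - ln a)) * y"
    by (simp add: algebra_simps)
  finally show ?thesis using True by (simp add: powr_def exp_add)
qed (use assms in \<open>auto simp: spow_def not_less\<close>)

text \<open>Together with \<nu> these are the data of the cosine sum in
  \<open>three_lines_geometric\<close>, up to scaling: an off-diagonal weight with its sign
  reversed, times eigenvalue powers and an overlap. The pairs with l = l' are excluded, since their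
  weight has the other sign; \<open>mass\<close> accounts for them.\<close>

definition Q :: "'x \<times> 'x \<times> nat \<times> nat \<Rightarrow> real" where
  "Q = (\<lambda>(l, l', k, k'). if l = l' then 0 else (1 / real (card M) - collision_prob S f l l')
     * (\<kappa> l k powr (p / 2) * \<kappa> l' k' powr (p / 2) * (cmod (\<Sum>i<d. u l i k * cnj (u l' i k')))\<^sup>2))"

definition \<nu> :: "'x \<times> 'x \<times> nat \<times> nat \<Rightarrow> real" where
  "\<nu> = (\<lambda>(l, l', k, k'). p / 2 * (ln (\<kappa> l' k') - ln (\<kappa> l k)))"

lemma Q_nonneg: "j \<in> L \<times> L \<times> {..<d} \<times> {..<d} \<Longrightarrow> Q j \<ge> 0"
  using collision by (auto simp: Q_def)

text \<open>All off-diagonal terms of the second moment come with a nonpositive weight, multiplied by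
  characters in \<open>y\<close> with nonnegative coefficients: this is where positivity enters.\<close>
lemma second_moment:
  assumes w: "Re w = p / 2" "Im w = - p * y / 2"
  shows "(\<Sum>s\<in>S. \<Sum>m\<in>M. \<Sum>i<d. \<Sum>j<d. (cmod (deviation L M (f s) m (\<lambda>l. Z w l i j)))\<^sup>2) / real (card S)
    \<le> mass - (\<Sum>j\<in>L \<times> L \<times> {..<d} \<times> {..<d}. Q j * cos (\<nu> j * y))"
proof -
  let ?G = "\<lambda>l l'. collision_prob S f l l' - 1 / real (card M)"
  let ?h = "\<lambda>l l' k k'. \<kappa> l k powr (p / 2) * \<kappa> l' k' powr (p / 2) * (cmod (\<Sum>i<d. u l i k * cnj (u l' i k')))\<^sup>2"
  let ?c = "\<lambda>l l' k k'. cos (\<nu> (l, l', k, k') * y)"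
  let ?E = "(\<Sum>s\<in>S. \<Sum>m\<in>M. \<Sum>i<d. \<Sum>j<d. (cmod (deviation L M (f s) m (\<lambda>l. Z w l i j)))\<^sup>2) / real (card S)"
  have "(\<Sum>s\<in>S. \<Sum>m\<in>M. \<Sum>i<d. \<Sum>j<d. (cmod (deviation L M (f s) m (\<lambda>l. Z w l i j)))\<^sup>2)
     = (\<Sum>s\<in>S. \<Sum>i<d. \<Sum>m\<in>M. \<Sum>j<d. (cmod (deviation L M (f s) m (\<lambda>l. Z w l i j)))\<^sup>2)"
    by (intro sum.cong refl sum.swap)
  also have "\<dots> = (\<Sum>i<d. \<Sum>s\<in>S. \<Sum>j<d. \<Sum>m\<in>M. (cmod (deviation L M (f s) m (\<lambda>l. Z w l i j)))\<^sup>2)"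
    by (subst sum.swap) (intro sum.cong refl sum.swap)
  also have "\<dots> = (\<Sum>i<d. \<Sum>j<d. \<Sum>s\<in>S. \<Sum>m\<in>M. (cmod (deviation L M (f s) m (\<lambda>l. Z w l i j)))\<^sup>2)"
    by (intro sum.cong refl sum.swap)
  finally have "complex_of_real ?E
     = (\<Sum>i<d. \<Sum>j<d. complex_of_real ((\<Sum>s\<in>S. \<Sum>m\<in>M. (cmod (deviation L M (f s) m (\<lambda>l. Z w l i j)))\<^sup>2) / real (card S)))"
    by (simp only: of_real_sum[symmetric] sum_divide_distrib)
  also have "\<dots> = (\<Sum>i<d. \<Sum>j<d. \<Sum>l\<in>L. \<Sum>l'\<in>L. complex_of_real (?G l l') * (Z w l i j * cnj (Z w l' i j)))"
    using finite_S finite_L finite_M hash_in by (intro sum.cong refl mean_deviation_square) auto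
  also have "\<dots> = (\<Sum>i<d. \<Sum>l\<in>L. \<Sum>j<d. \<Sum>l'\<in>L. complex_of_real (?G l l') * (Z w l i j * cnj (Z w l' i j)))"
    by (intro sum.cong refl sum.swap)
  also have "\<dots> = (\<Sum>l\<in>L. \<Sum>i<d. \<Sum>l'\<in>L. \<Sum>j<d. complex_of_real (?G l l') * (Z w l i j * cnj (Z w l' i j)))"
    by (subst sum.swap) (intro sum.cong refl sum.swap)
  also have "\<dots> = (\<Sum>l\<in>L. \<Sum>l'\<in>L. complex_of_real (?G l l') * (\<Sum>i<d. \<Sum>j<d. Z w l i j * cnj (Z w l' i j)))"
    unfolding sum_distrib_left by (intro sum.cong refl sum.swap)
  finally have "complex_of_real ?E = (\<Sum>l\<in>L. \<Sum>l'\<in>L. complex_of_real (?G l l') * (\<Sum>i<d. \<Sum>j<d. Z w l i j * cnj (Z w l' i j)))" .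
  from arg_cong[OF this, of Re]
  have "?E = Re (\<Sum>l\<in>L. \<Sum>l'\<in>L. complex_of_real (?G l l') * (\<Sum>i<d. \<Sum>j<d. Z w l i j * cnj (Z w l' i j)))"
    by (simp only: Re_complex_of_real)
  also have "\<dots> = (\<Sum>l\<in>L. \<Sum>l'\<in>L. \<Sum>k<d. \<Sum>k'<d. ?G l l' * (?h l l' k k' * ?c l l' k k'))"
    unfolding Z_pairing Re_sum sum_distrib_left
  proof (intro sum.cong refl)
    fix l l' k k'
    let ?r = "(cmod (\<Sum>i<d. u l i k * cnj (u l' i k')))\<^sup>2"
    have "Re (complex_of_real (?G l l') * (spow (\<kappa> l k) w * cnj (spow (\<kappa> l' k') w) * complex_of_real ?r))
        = ?G l l' * (Re (spow (\<kappa> l k) w * cnj (spow (\<kappa> l' k') w)) * ?r)"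
      by simp
    also have "\<dots> = ?G l l' * (?h l l' k k' * ?c l l' k k')"
      unfolding spow_product_Re[OF w \<kappa>_nonneg \<kappa>_nonneg] by (simp add: \<nu>_def)
    finally show "Re (complex_of_real (?G l l') * (spow (\<kappa> l k) w * cnj (spow (\<kappa> l' k') w) * complex_of_real ?r))
        = ?G l l' * (?h l l' k k' * ?c l l' k k')" .
  qed
  also have "\<dots> \<le> (\<Sum>l\<in>L. \<Sum>l'\<in>L. \<Sum>k<d. \<Sum>k'<d. (if l = l' \<and> k = k' then \<kappa> l k powr p else 0) - Q (l, l', k, k') * ?c l l' k k')"
  proof (intro sum_mono)
    fix l l' k k' assume l: "l \<in> L" "l' \<in> L" and k: "k \<in> {..<d}" "k' \<in> {..<d}"
    show "?G l l' * (?h l l' k k' * ?c l l' k k') \<le> (if l = l' \<and> k = k' then \<kappa> l k powr p else 0) - Q (l, l', k, k') * ?c l l' k k'"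
    \<comment> \<open>On the diagonal the weight 1 - 1/|M| is bounded by 1, and orthonormality
      leaves only k = k', where the frequency is 0 and the cosine 1. Off the diagonal the definition
      of Q gives equality.\<close>
    proof (cases "l = l'")
      case True
      have "collision_prob S f l l = 1"
        using card_pos by (simp add: collision_prob_def)
      moreover have "(cmod (\<Sum>i<d. u l i k * cnj (u l i k')))\<^sup>2 = of_bool (k = k')"
        using orthonormal[OF l(1)] k by simp
      moreover have "\<kappa> l k powr (p / 2) * \<kappa> l k powr (p / 2) = \<kappa> l k powr p"
        by (simp add: powr_add[symmetric])
      moreover have "(1 - 1 / real (card M)) * \<kappa> l k powr p \<le> 1 * \<kappa> l k powr p"
        by (intro mult_right_mono) auto
      ultimately show ?thesis using True by (auto simp: Q_def \<nu>_def)
    qed (simp add: Q_def algebra_simps)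
  qed
  also have "\<dots> = (\<Sum>l\<in>L. \<Sum>l'\<in>L. \<Sum>k<d. \<Sum>k'<d. (if l = l' \<and> k = k' then \<kappa> l k powr p else 0))
      - (\<Sum>l\<in>L. \<Sum>l'\<in>L. \<Sum>k<d. \<Sum>k'<d. Q (l, l', k, k') * ?c l l' k k')"
    by (simp only: sum_subtractf)
  also have "(\<Sum>l\<in>L. \<Sum>l'\<in>L. \<Sum>k<d. \<Sum>k'<d. (if l = l' \<and> k = k' then \<kappa> l k powr p else 0)) = mass"
  proof -
    have "(\<Sum>l'\<in>L. \<Sum>k<d. \<Sum>k'<d. (if l = l' \<and> k = k' then \<kappa> l k powr p else 0)) = (\<Sum>k<d. \<kappa> l k powr p)"
      if l: "l \<in> L" for l
    proof -
      have "(\<Sum>l'\<in>L. \<Sum>k<d. \<Sum>k'<d. (if l = l' \<and> k = k' then \<kappa> l k powr p else 0))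
         = (\<Sum>l'\<in>L. if l = l' then (\<Sum>k<d. \<Sum>k'<d. if k = k' then \<kappa> l k powr p else 0) else 0)"
        by (intro sum.cong) auto
      also have "\<dots> = (\<Sum>k<d. \<kappa> l k powr p)"
        using finite_L l by (simp add: sum.delta)
      finally show ?thesis .
    qed
    then show ?thesis by (simp add: mass_def)
  qed
  also have "(\<Sum>l\<in>L. \<Sum>l'\<in>L. \<Sum>k<d. \<Sum>k'<d. Q (l, l', k, k') * ?c l l' k k')
      = (\<Sum>j\<in>L \<times> L \<times> {..<d} \<times> {..<d}. Q j * cos (\<nu> j * y))"
    by (simp add: sum.cartesian_product split_def)
  finally show ?thesis .
qed

text \<open>Each summand of F is a product of a weighted entry of V and a deviation of X_l^w.
  Splitting it as \<beta>/2 x^2 + t^2 / (2 \<beta>) keeps the bound linear in the second moment, so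
  the cosines of \<open>second_moment\<close> survive as a trigonometric sum. The weights
  |\<sigma>^(z/4)|^2 are square roots of \<sigma>, which is why
  \<open>contraction_weighted_frobenius\<close> bounds the V part by tr \<sigma> for every (s,
  m).\<close>

lemma right_bound:
  assumes mass: "mass > 0"
  shows "cmod (F (1 + \<i> * complex_of_real y)) \<le> sqrt (real (card M) * \<tau> * mass)
    - (\<Sum>j\<in>L \<times> L \<times> {..<d} \<times> {..<d}. Q j / (2 * sqrt (mass / (real (card M) * \<tau>))) * cos (\<nu> j * y))"
proof -
  let ?z = "1 + \<i> * complex_of_real y" and ?n = "real (card M)"
  define w where "w = complex_of_real p * (1 - ?z / 2)"
  define a where "a i = spow (\<sigma> i) (?z / 4)" for i
  define r where "r i = sqrt (\<sigma> i)" for i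
  \<comment> \<open>This value minimises \<beta>/2 |M| \<tau> + mass / (2 \<beta>), the bound
    without the cosine terms, and makes both halves equal. It must not depend on y.\<close>
  define \<beta> where "\<beta> = sqrt (mass / (?n * \<tau>))"
  define T where "T s m i j = deviation L M (f s) m (\<lambda>l. Z w l i j)" for s m i j
  let ?J = "L \<times> L \<times> {..<d} \<times> {..<d}"
  have \<beta>: "\<beta> > 0" using mass \<tau>_pos card_pos by (simp add: \<beta>_def)
  have w: "Re w = p / 2" "Im w = - p * y / 2" by (simp_all add: w_def)
  have a: "(cmod (a i))\<^sup>2 = r i" for i
  proof -
    have "cmod (a i) = \<sigma> i powr (1/4)" unfolding a_def by (subst norm_spow[OF \<sigma>_nonneg]) simp
    then have "(cmod (a i))\<^sup>2 = \<sigma> i powr (1/2)" by (simp add: power2_eq_square powr_add[symmetric])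
    then show ?thesis using \<sigma>_nonneg by (simp add: r_def powr_half_sqrt)
  qed
  have r2: "(\<Sum>i<d. (r i)\<^sup>2) = \<tau>" using \<sigma>_nonneg \<sigma>_sum by (simp add: r_def)
  have term_le: "cmod (V s m j i * deviation L M (f s) m (\<lambda>l. A ?z l i j))
      \<le> \<beta> / 2 * (r i * r j * (cmod (V s m j i))\<^sup>2) + (cmod (T s m i j))\<^sup>2 / (2 * \<beta>)" for s m i j
  proof -
    let ?x = "cmod (a i) * cmod (a j) * cmod (V s m j i)" and ?t = "cmod (T s m i j)"
    have "cmod (V s m j i * deviation L M (f s) m (\<lambda>l. A ?z l i j)) = ?x * ?t"
      unfolding A_def deviation_scale a_def[symmetric] w_def[symmetric] T_def by (simp add: norm_mult)
    also have "\<dots> \<le> \<beta> / 2 * ?x\<^sup>2 + ?t\<^sup>2 / (2 * \<beta>)"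
    proof -
      have "0 \<le> (\<beta> * ?x - ?t)\<^sup>2" by simp
      then have "2 * \<beta> * (?x * ?t) \<le> \<beta>\<^sup>2 * ?x\<^sup>2 + ?t\<^sup>2"
        by (simp add: power2_diff power_mult_distrib mult_ac)
      then show ?thesis using \<beta> by (simp add: field_simps power2_eq_square)
    qed
    also have "?x\<^sup>2 = r i * r j * (cmod (V s m j i))\<^sup>2"
      by (simp add: power_mult_distrib a)
    finally show ?thesis .
  qed
  have "cmod (F ?z) \<le> (\<Sum>s\<in>S. \<Sum>m\<in>M. \<Sum>i<d. \<Sum>j<d. \<beta> / 2 * (r i * r j * (cmod (V s m j i))\<^sup>2) + (cmod (T s m i j))\<^sup>2 / (2 * \<beta>)) / real (card S)"
    unfolding F_def norm_divide norm_of_nat by (intro divide_right_mono sum_norm_le term_le) auto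
  also have "\<dots> = (\<Sum>s\<in>S. \<Sum>m\<in>M. \<beta> / 2 * (\<Sum>i<d. \<Sum>j<d. r i * r j * (cmod (V s m j i))\<^sup>2)) / real (card S)
      + (\<Sum>s\<in>S. \<Sum>m\<in>M. \<Sum>i<d. \<Sum>j<d. (cmod (T s m i j))\<^sup>2) / real (card S) / (2 * \<beta>)"
    by (simp only: sum.distrib add_divide_distrib sum_distrib_left sum_divide_distrib) (simp add: mult_ac)
  also have "\<dots> \<le> \<beta> / 2 * (?n * \<tau>) + (mass - (\<Sum>j\<in>?J. Q j * cos (\<nu> j * y))) / (2 * \<beta>)"
  proof (rule add_mono)
    have "(\<Sum>s\<in>S. \<Sum>m\<in>M. \<beta> / 2 * (\<Sum>i<d. \<Sum>j<d. r i * r j * (cmod (V s m j i))\<^sup>2)) \<le> (\<Sum>s\<in>S. \<Sum>m\<in>M. \<beta> / 2 * \<tau>)"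
      using \<beta> contraction_weighted_frobenius[OF contr, of _ _ r] r2 by (intro sum_mono mult_left_mono) auto
    then show "(\<Sum>s\<in>S. \<Sum>m\<in>M. \<beta> / 2 * (\<Sum>i<d. \<Sum>j<d. r i * r j * (cmod (V s m j i))\<^sup>2)) / real (card S) \<le> \<beta> / 2 * (?n * \<tau>)"
      using card_pos by (simp add: divide_le_eq mult_ac)
    show "(\<Sum>s\<in>S. \<Sum>m\<in>M. \<Sum>i<d. \<Sum>j<d. (cmod (T s m i j))\<^sup>2) / real (card S) / (2 * \<beta>)
        \<le> (mass - (\<Sum>j\<in>?J. Q j * cos (\<nu> j * y))) / (2 * \<beta>)"
      unfolding T_def using \<beta> by (intro divide_right_mono second_moment w) auto
  qed
  also have "\<dots> = sqrt (?n * \<tau> * mass) - (\<Sum>j\<in>?J. Q j / (2 * \<beta>) * cos (\<nu> j * y))"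
  proof -
    have N: "?n * \<tau> > 0" using \<tau>_pos card_pos by simp
    have "\<beta> * (?n * \<tau>) = sqrt (?n * \<tau> * mass)"
      unfolding \<beta>_def real_sqrt_divide real_sqrt_mult[of "?n * \<tau>"]
      using N by (metis mult.commute times_divide_eq_left real_div_sqrt less_imp_le times_divide_eq_right)
    moreover have "mass / \<beta> = sqrt (?n * \<tau> * mass)"
      unfolding \<beta>_def real_sqrt_divide real_sqrt_mult[of "?n * \<tau>"]
      using N mass by (simp add: divide_divide_eq_right) (metis mult.commute times_divide_eq_left real_div_sqrt less_imp_le)
    ultimately show ?thesis
      by (simp add: diff_divide_distrib sum_divide_distrib field_simps)
  qed
  finally show ?thesis unfolding \<beta>_def .
qed

text \<open>Collecting logarithms exhibits F as an exponential sum with real frequencies, as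
  \<open>three_lines_geometric\<close> demands; terms with a vanishing eigenvalue receive the
  coefficient 0.\<close>

lemma F_exponential_sum:
  "F z = (\<Sum>(l, i, j, k)\<in>L \<times> {..<d} \<times> {..<d} \<times> {..<d}.
      (if \<sigma> i > 0 \<and> \<sigma> j > 0 \<and> \<kappa> l k > 0
       then Y l j i * exp (complex_of_real (p * ln (\<kappa> l k))) * (u l i k * cnj (u l j k)) else 0)
      * exp (complex_of_real ((ln (\<sigma> i) + ln (\<sigma> j)) / 4 - p / 2 * ln (\<kappa> l k)) * z))"
proof -
  have "F z = (\<Sum>l\<in>L. \<Sum>i<d. \<Sum>j<d. \<Sum>k<d.
      (if \<sigma> i > 0 \<and> \<sigma> j > 0 \<and> \<kappa> l k > 0
       then Y l j i * exp (complex_of_real (p * ln (\<kappa> l k))) * (u l i k * cnj (u l j k)) else 0)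
      * exp (complex_of_real ((ln (\<sigma> i) + ln (\<sigma> j)) / 4 - p / 2 * ln (\<kappa> l k)) * z))"
    unfolding F_pairing A_def Z_def sum_distrib_left
  proof (intro sum.cong refl)
    fix l i j k
    let ?s = "complex_of_real (ln (\<sigma> i))" and ?t = "complex_of_real (ln (\<sigma> j))" and ?q = "complex_of_real (ln (\<kappa> l k))"
    let ?p = "complex_of_real p"
    have "exp (z / 4 * ?s) * exp (z / 4 * ?t) * exp (?p * (1 - z / 2) * ?q)
        = exp (?p * ?q) * exp (((?s + ?t) / 4 - ?p / 2 * ?q) * z)"
      unfolding exp_add[symmetric] by (rule arg_cong[where f = exp]) (simp add: field_simps)
    then show "Y l j i * (spow (\<sigma> i) (z / 4) * spow (\<sigma> j) (z / 4) * (spow (\<kappa> l k) (complex_of_real p * (1 - z / 2)) * (u l i k * cnj (u l j k))))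
      = (if \<sigma> i > 0 \<and> \<sigma> j > 0 \<and> \<kappa> l k > 0
         then Y l j i * exp (complex_of_real (p * ln (\<kappa> l k))) * (u l i k * cnj (u l j k)) else 0)
        * exp (complex_of_real ((ln (\<sigma> i) + ln (\<sigma> j)) / 4 - p / 2 * ln (\<kappa> l k)) * z)"
      by (auto simp: spow_def mult_ac)
  qed
  then show ?thesis by (simp add: sum.cartesian_product split_def)
qed

theorem interpolated_bound:
  assumes \<theta>: "0 \<le> \<theta>" "\<theta> \<le> 1"
  shows "cmod (F (complex_of_real \<theta>))
    \<le> 2 powr (1 - \<theta>) * (real (card M) * \<tau>) powr (\<theta> / 2) * mass powr (1 - \<theta> / 2)"
proof (cases "mass = 0")
  \<comment> \<open>The normalisation in \<open>three_lines_geometric\<close> divides by the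
    boundary bounds, which vanish here. All \<kappa> that matter are 0, and so is F.\<close>
  case True
  have "(\<Sum>k<d. \<kappa> l k powr p) = 0" if "l \<in> L" for l
    using True that finite_L unfolding mass_def by (subst (asm) sum_nonneg_eq_0_iff) (auto simp: sum_nonneg)
  then have "\<kappa> l k powr p = 0" if "l \<in> L" "k < d" for l k
    using that by (subst (asm) sum_nonneg_eq_0_iff) auto
  then have "\<kappa> l k = 0" if "l \<in> L" "k < d" for l k
    using that by auto
  then have "A z l i j = 0" if "l \<in> L" for z l i j
    using that by (simp add: A_def Z_def spow_def)
  then have "F \<theta> = 0" unfolding F_pairing by simp
  then show ?thesis by simp
next
  case False
  then have mass: "mass > 0" using mass_nonneg by simp
  let ?N = "real (card M) * \<tau>"
  have N: "?N > 0" using \<tau>_pos card_pos by simp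
  have "cmod (F \<theta>) \<le> (2 * mass) powr (1 - \<theta>) * sqrt (?N * mass) powr \<theta>"
    using \<theta> mass N Q_nonneg finite_L left_bound
    by (intro three_lines_geometric[OF _ _ \<theta> _ _ _ F_exponential_sum[unfolded split_def] _ right_bound]) auto
  also have "sqrt (?N * mass) powr \<theta> = ?N powr (\<theta> / 2) * mass powr (\<theta> / 2)"
    using N mass by (simp add: powr_half_sqrt[symmetric] powr_powr powr_mult)
  also have "(2 * mass) powr (1 - \<theta>) * (?N powr (\<theta> / 2) * mass powr (\<theta> / 2))
      = 2 powr (1 - \<theta>) * ?N powr (\<theta> / 2) * (mass powr (1 - \<theta>) * mass powr (\<theta> / 2))"
    by (simp add: powr_mult mult_ac)
  also have "mass powr (1 - \<theta>) * mass powr (\<theta> / 2) = mass powr (1 - \<theta> / 2)"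
    by (simp add: powr_add[symmetric])
  finally show ?thesis .
qed

end

section \<open>Spectral theorem and functional calculus\<close>

lemma adj_dim [simp]: "dim_row (adj A) = dim_col A" "dim_col (adj A) = dim_row A"
  by (auto simp: adj_def)

lemma adj_index [simp]: "i < dim_col A \<Longrightarrow> j < dim_row A \<Longrightarrow> adj A $$ (i,j) = cnj (A $$ (j,i))"
  by (simp add: adj_def)

lemma adj_carrier [simp]: "A \<in> carrier_mat n m \<Longrightarrow> adj A \<in> carrier_mat m n"
  by (simp add: adj_def)

lemma mult_index_sum:
  assumes "A \<in> carrier_mat n m" "B \<in> carrier_mat m k" "i < n" "j < k"
  shows "(A * B) $$ (i,j) = (\<Sum>a<m. A $$ (i,a) * B $$ (a,j))"
  using assms by (auto simp: scalar_prod_def atLeast0LessThan)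

lemma adj_mult:
  assumes "A \<in> carrier_mat n m" "B \<in> carrier_mat m k"
  shows "adj (A * B) = adj B * adj A"
proof (rule eq_matI)
  fix i j assume "i < dim_row (adj B * adj A)" "j < dim_col (adj B * adj A)"
  then show "adj (A * B) $$ (i,j) = (adj B * adj A) $$ (i,j)"
    using assms by (auto simp: scalar_prod_def mult.commute)
qed (use assms in auto)

lemma adj_adj [simp]: "adj (adj A) = A"
  by (rule eq_matI) auto

lemma mtrace_comm:
  assumes "A \<in> carrier_mat n n" "B \<in> carrier_mat n n"
  shows "mtrace (A * B) = mtrace (B * A)"
proof -
  have "mtrace (A * B) = (\<Sum>i<n. \<Sum>j<n. A $$ (i,j) * B $$ (j,i))"
    using assms unfolding mtrace_def by (intro sum.cong) (auto simp: scalar_prod_def atLeast0LessThan)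
  also have "\<dots> = (\<Sum>j<n. \<Sum>i<n. B $$ (j,i) * A $$ (i,j))"
    by (subst sum.swap) (simp only: mult.commute)
  also have "\<dots> = mtrace (B * A)"
    using assms unfolding mtrace_def by (intro sum.cong) (auto simp: scalar_prod_def atLeast0LessThan)
  finally show ?thesis .
qed

text \<open>By a Schur decomposition the trace is the sum of the n roots of the characteristic
  polynomial, so a trace other than n c excludes that all of them equal c.\<close>

lemma exists_eigenvector_neq:
  assumes A: "(A :: complex mat) \<in> carrier_mat n n" and tr: "mtrace A \<noteq> of_nat n * c"
  shows "\<exists>e v. e \<noteq> c \<and> v \<in> carrier_vec n \<and> v \<noteq> 0\<^sub>v n \<and> A *\<^sub>v v = e \<cdot>\<^sub>v v"
proof -
  obtain es where es: "char_poly A = (\<Prod>e\<leftarrow>es. [:- e, 1:])" "length es = n"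
    using char_poly_factorized[OF A] by blast
  obtain B P R where "schur_decomposition A es = (B, P, R)"
    by (cases "schur_decomposition A es") auto
  from schur_decomposition[OF A es(1) this]
  have sim: "similar_mat_wit A B P R" and B: "diag_mat B = es" by auto
  note w = similar_mat_witD2[OF A sim]
  have "mtrace A = mtrace ((P * B) * R)" using w by simp
  also have "\<dots> = mtrace (R * (P * B))" using w by (intro mtrace_comm[of _ n]) auto
  also have "R * (P * B) = (R * P) * B" using w by (intro assoc_mult_mat[symmetric]) auto
  also have "\<dots> = B" unfolding w(2) using w by (intro left_mult_one_mat) auto
  also have "mtrace B = sum_list (diag_mat B)"
    by (simp add: mtrace_def diag_mat_def sum_list_sum_nth atLeast0LessThan)
  finally have "sum_list es \<noteq> of_nat n * c" using tr B by simp
  then have "\<exists>e\<in>set es. e \<noteq> c"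
    using es(2) by (metis (full_types) sum_list_triv map_idI list.map_cong0 map_replicate_const sum_list_replicate replicate_eqI)
  then obtain e where e: "e \<in> set es" "e \<noteq> c" by blast
  have "poly (char_poly A) e = 0"
    unfolding es(1) using e(1) by (induction es) auto
  then have "eigenvalue A e" using eigenvalue_root_char_poly[OF A] by simp
  then show ?thesis using A e(2) unfolding eigenvalue_def eigenvector_def by auto
qed

text \<open>Orthonormal eigenvectors are found one at a time: shifting the eigenvalues already found to a common
  value \<open>c\<close> with \<open>tr \<noteq> n c\<close> leaves an eigenvalue different from \<open>c\<close>, and its eigenvector is orthogonal
  to the previous ones.\<close>
lemma hermitian_eigenvectors:
  assumes A: "hermitian n A" and k: "k \<le> n"
  shows "\<exists>(u :: nat \<Rightarrow> nat \<Rightarrow> complex) (ev :: nat \<Rightarrow> real).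
    (\<forall>j<k. \<forall>a<n. (\<Sum>b<n. A $$ (a,b) * u j b) = ev j * u j a) \<and>
    (\<forall>i<k. \<forall>j<k. (\<Sum>a<n. cnj (u i a) * u j a) = of_bool (i = j))"
  using k
proof (induction k)
  case (Suc k)
  then have "k \<le> n" by simp
  from Suc.IH[OF this] obtain u :: "nat \<Rightarrow> nat \<Rightarrow> complex" and ev :: "nat \<Rightarrow> real" where
    ue: "\<forall>j<k. \<forall>a<n. (\<Sum>b<n. A $$ (a,b) * u j b) = ev j * u j a"
      "\<forall>i<k. \<forall>j<k. (\<Sum>a<n. cnj (u i a) * u j a) = of_bool (i = j)"
    by (elim exE conjE)
  note eig = ue(1)[rule_format] and orth = ue(2)[rule_format]
  have Ac: "A \<in> carrier_mat n n" and Ah: "adj A = A" using A by (auto simp: hermitian_def)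
  have sym: "A $$ (a,b) = cnj (A $$ (b,a))" if "a < n" "b < n" for a b
    using Ah Ac that by (metis adj_index carrier_matD)
  \<comment> \<open>Without the final 1 this would be the value with tr A' = n c. Adding 1 makes tr
    A' = n c - (n - k), which differs from n c because k < n.\<close>
  define c where "c = (mtrace A - (\<Sum>j<k. complex_of_real (ev j))) / of_nat (n - k) + 1"
  define A' where "A' = mat n n (\<lambda>(a,b). A $$ (a,b) + (\<Sum>j<k. (c - ev j) * (u j a * cnj (u j b))))"
  have A'c: "A' \<in> carrier_mat n n" by (simp add: A'_def)
  have "mtrace A' = mtrace A + (\<Sum>j<k. (c - ev j) * (\<Sum>a<n. cnj (u j a) * u j a))"
  proof -
    have "mtrace A' = (\<Sum>a<n. A $$ (a,a) + (\<Sum>j<k. (c - ev j) * (cnj (u j a) * u j a)))"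
      unfolding mtrace_def by (intro sum.cong) (auto simp: A'_def mult.commute)
    also have "\<dots> = (\<Sum>a<n. A $$ (a,a)) + (\<Sum>j<k. \<Sum>a<n. (c - ev j) * (cnj (u j a) * u j a))"
      unfolding sum.distrib by (subst (2) sum.swap) (rule refl)
    finally show ?thesis using Ac by (simp add: mtrace_def sum_distrib_left)
  qed
  also have "\<dots> = mtrace A + of_nat k * c - (\<Sum>j<k. complex_of_real (ev j))"
    using orth by (simp add: sum_subtractf)
  also have "\<dots> = of_nat n * c - of_nat (n - k)"
  proof -
    have "of_nat (n - k) \<noteq> (0::complex)" using Suc.prems by simp
    then have "of_nat (n - k) * (c - 1) = mtrace A - (\<Sum>j<k. complex_of_real (ev j))"
      by (simp add: c_def)
    moreover have "of_nat n = of_nat k + (of_nat (n - k) :: complex)"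
      using Suc.prems by (metis Suc_leD le_add_diff_inverse of_nat_add)
    ultimately show ?thesis by (simp add: algebra_simps)
  qed
  also have "\<dots> \<noteq> of_nat n * c" using Suc.prems by simp
  finally obtain e v where e: "e \<noteq> c" and v: "v \<in> carrier_vec n" "v \<noteq> 0\<^sub>v n" and ev': "A' *\<^sub>v v = e \<cdot>\<^sub>v v"
    using exists_eigenvector_neq[OF A'c] by blast
  have eigA': "(\<Sum>b<n. A' $$ (a,b) * v $ b) = e * v $ a" if "a < n" for a
    using arg_cong[OF ev', of "\<lambda>w. w $ a"] that v A'c by (simp add: scalar_prod_def atLeast0LessThan)
  \<comment> \<open>Each earlier u_j is a left eigenvector of A' for c. Pairing it with the new
    right eigenvector for e, where e differs from c, forces orthogonality.\<close>
  have left: "(\<Sum>a<n. cnj (u j a) * A' $$ (a,b)) = c * cnj (u j b)" if j: "j < k" and b: "b < n" for j b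
  proof -
    have "(\<Sum>a<n. cnj (u j a) * A' $$ (a,b)) = (\<Sum>a<n. cnj (u j a) * A $$ (a,b)) + (\<Sum>a<n. \<Sum>i<k. (c - ev i) * cnj (u i b) * (cnj (u j a) * u i a))"
      unfolding sum.distrib[symmetric] using b by (intro sum.cong) (auto simp: A'_def distrib_left sum_distrib_left mult_ac)
    also have "(\<Sum>a<n. \<Sum>i<k. (c - ev i) * cnj (u i b) * (cnj (u j a) * u i a)) = (\<Sum>i<k. (c - ev i) * cnj (u i b) * (\<Sum>a<n. cnj (u j a) * u i a))"
      by (subst sum.swap) (simp only: sum_distrib_left)
    also have "\<dots> = (\<Sum>i<k. if j = i then (c - ev i) * cnj (u i b) else 0)"
      using orth j by (intro sum.cong) auto
    also have "\<dots> = (c - ev j) * cnj (u j b)" using j by simp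
    also have "(\<Sum>a<n. cnj (u j a) * A $$ (a,b)) = cnj (\<Sum>a<n. A $$ (b,a) * u j a)"
      unfolding cnj_sum
    proof (rule sum.cong[OF refl])
      fix a assume "a \<in> {..<n}"
      then have "A $$ (a,b) = cnj (A $$ (b,a))" using sym b by blast
      then show "cnj (u j a) * A $$ (a,b) = cnj (A $$ (b,a) * u j a)" by simp
    qed
    also have "\<dots> = ev j * cnj (u j b)" using eig[OF j b] by simp
    finally show ?thesis by (simp add: algebra_simps)
  qed
  have perp: "(\<Sum>a<n. cnj (u j a) * v $ a) = 0" if j: "j < k" for j
  proof -
    have "e * (\<Sum>a<n. cnj (u j a) * v $ a) = (\<Sum>a<n. cnj (u j a) * (\<Sum>b<n. A' $$ (a,b) * v $ b))"
      unfolding sum_distrib_left[of e] by (intro sum.cong) (auto simp: eigA')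
    also have "\<dots> = (\<Sum>b<n. (\<Sum>a<n. cnj (u j a) * A' $$ (a,b)) * v $ b)"
      unfolding sum_distrib_left sum_distrib_right by (subst sum.swap) (simp only: mult.assoc)
    also have "\<dots> = c * (\<Sum>a<n. cnj (u j a) * v $ a)"
      unfolding sum_distrib_left using left[OF j] by (intro sum.cong) auto
    finally show ?thesis using e by simp
  qed
  \<comment> \<open>The shift is built from the projections onto the u_j and therefore vanishes on
    v, so v is an eigenvector of A itself.\<close>
  have eigA: "(\<Sum>b<n. A $$ (a,b) * v $ b) = e * v $ a" if a: "a < n" for a
  proof -
    have "e * v $ a = (\<Sum>b<n. A $$ (a,b) * v $ b) + (\<Sum>b<n. \<Sum>j<k. (c - ev j) * u j a * (cnj (u j b) * v $ b))"
      unfolding eigA'[OF a, symmetric] sum.distrib[symmetric] using a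
      by (intro sum.cong) (auto simp: A'_def distrib_right distrib_left sum_distrib_right sum_distrib_left mult_ac)
    also have "(\<Sum>b<n. \<Sum>j<k. (c - ev j) * u j a * (cnj (u j b) * v $ b)) = (\<Sum>j<k. (c - ev j) * u j a * (\<Sum>b<n. cnj (u j b) * v $ b))"
      by (subst sum.swap) (simp only: sum_distrib_left)
    also have "\<dots> = 0" using perp by simp
    finally show ?thesis by simp
  qed
  define N where "N = (\<Sum>a<n. (cmod (v $ a))\<^sup>2)"
  have vv: "(\<Sum>a<n. cnj (v $ a) * v $ a) = complex_of_real N"
    unfolding N_def of_real_sum complex_norm_square by (simp only: mult.commute)
  obtain a0 where "a0 < n" "v $ a0 \<noteq> 0"
    using v by (metis carrier_vecD eq_vecI index_zero_vec)
  then have N: "N > 0" unfolding N_def by (intro sum_pos2[of _ a0]) auto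
  have "e * N = cnj (e * N)"
  proof -
    have "e * N = (\<Sum>a<n. \<Sum>b<n. cnj (v $ a) * (A $$ (a,b) * v $ b))"
      unfolding vv[symmetric] sum_distrib_left[symmetric] using eigA
      by (simp add: sum_distrib_left mult_ac)
    also have "\<dots> = (\<Sum>b<n. \<Sum>a<n. cnj (v $ a) * (A $$ (a,b) * v $ b))"
      by (rule sum.swap)
    also have "\<dots> = cnj (\<Sum>a<n. \<Sum>b<n. cnj (v $ a) * (A $$ (a,b) * v $ b))"
      unfolding cnj_sum
    proof (rule sum.cong[OF refl], rule sum.cong[OF refl])
      fix a b assume "a \<in> {..<n}" "b \<in> {..<n}"
      then have "A $$ (b,a) = cnj (A $$ (a,b))" using sym by blast
      then show "cnj (v $ b) * (A $$ (b,a) * v $ a) = cnj (cnj (v $ a) * (A $$ (a,b) * v $ b))" by simp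
    qed
    also have "(\<Sum>a<n. \<Sum>b<n. cnj (v $ a) * (A $$ (a,b) * v $ b)) = e * N"
      unfolding vv[symmetric] sum_distrib_left[symmetric] using eigA
      by (simp add: sum_distrib_left mult_ac)
    finally show ?thesis .
  qed
  then have "e = cnj e" using N by simp
  then have e_real: "e = complex_of_real (Re e)" by (simp add: complex_eq_iff)
  let ?s = "complex_of_real (1 / sqrt N)"
  define w where "w a = ?s * v $ a" for a
  have ss: "?s * ?s * complex_of_real N = 1"
    using N by (simp add: of_real_mult[symmetric] del: of_real_mult)
  have ww: "(\<Sum>a<n. cnj (w a) * w a) = 1"
  proof -
    have "(\<Sum>a<n. cnj (w a) * w a) = ?s * ?s * (\<Sum>a<n. cnj (v $ a) * v $ a)"
      unfolding w_def sum_distrib_left by (intro sum.cong) (auto simp: mult_ac)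
    then show ?thesis unfolding vv ss .
  qed
  have uw: "(\<Sum>a<n. cnj (u j a) * w a) = 0" if "j < k" for j
  proof -
    have "(\<Sum>a<n. cnj (u j a) * w a) = ?s * (\<Sum>a<n. cnj (u j a) * v $ a)"
      unfolding w_def sum_distrib_left by (intro sum.cong) (auto simp: mult_ac)
    then show ?thesis using perp[OF that] by simp
  qed
  have wu: "(\<Sum>a<n. cnj (w a) * u j a) = 0" if "j < k" for j
    using arg_cong[OF uw[OF that], of cnj] by (simp add: mult.commute)
  have eigw: "(\<Sum>b<n. A $$ (a,b) * w b) = Re e * w a" if "a < n" for a
  proof -
    have "(\<Sum>b<n. A $$ (a,b) * w b) = ?s * (\<Sum>b<n. A $$ (a,b) * v $ b)"
      unfolding w_def sum_distrib_left by (intro sum.cong) (auto simp: mult_ac)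
    then show ?thesis unfolding eigA[OF that] w_def using e_real by (metis mult.left_commute)
  qed
  show ?case
  proof (intro exI[of _ "u(k := w)"] exI[of _ "ev(k := Re e)"] conjI allI impI)
    fix j a assume "j < Suc k" "a < n"
    then show "(\<Sum>b<n. A $$ (a,b) * (u(k := w)) j b) = (ev(k := Re e)) j * (u(k := w)) j a"
      using eig eigw by (auto simp: less_Suc_eq)
  next
    fix i j assume "i < Suc k" "j < Suc k"
    then show "(\<Sum>a<n. cnj ((u(k := w)) i a) * (u(k := w)) j a) = of_bool (i = j)"
      using orth ww uw wu by (auto simp: less_Suc_eq)
  qed
qed auto

section \<open>Diagonalisation and well-definedness of the functional calculus\<close>

definition rdiag :: "nat \<Rightarrow> (nat \<Rightarrow> real) \<Rightarrow> complex mat" where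
  "rdiag d ev = mat d d (\<lambda>(i,j). if i = j then complex_of_real (ev i) else 0)"

lemma rdiag_carrier [simp]: "rdiag d ev \<in> carrier_mat d d"
  by (simp add: rdiag_def)

lemma rdiag_dim [simp]: "dim_row (rdiag d ev) = d" "dim_col (rdiag d ev) = d"
  by (auto simp: rdiag_def)

lemma rdiag_index [simp]: "i < d \<Longrightarrow> j < d \<Longrightarrow> rdiag d ev $$ (i,j) = (if i = j then complex_of_real (ev i) else 0)"
  by (simp add: rdiag_def)

lemma rdiag_cong: "(\<And>i. i < d \<Longrightarrow> e i = e' i) \<Longrightarrow> rdiag d e = rdiag d e'"
  by (rule eq_matI) auto

lemma rdiag_mult_left_index:
  assumes "A \<in> carrier_mat d n" "i < d" "j < n"
  shows "(rdiag d ev * A) $$ (i,j) = complex_of_real (ev i) * A $$ (i,j)"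
proof -
  have "(rdiag d ev * A) $$ (i,j) = (\<Sum>a<d. if i = a then complex_of_real (ev a) * A $$ (a,j) else 0)"
    unfolding mult_index_sum[OF rdiag_carrier assms] using assms by (intro sum.cong) auto
  then show ?thesis using assms by simp
qed

lemma rdiag_mult_right_index:
  assumes "A \<in> carrier_mat n d" "i < n" "j < d"
  shows "(A * rdiag d ev) $$ (i,j) = A $$ (i,j) * complex_of_real (ev j)"
proof -
  have "(A * rdiag d ev) $$ (i,j) = (\<Sum>a<d. if a = j then A $$ (i,a) * complex_of_real (ev a) else 0)"
    unfolding mult_index_sum[OF assms(1) rdiag_carrier assms(2,3)] using assms by (intro sum.cong) auto
  then show ?thesis using assms by simp
qed

lemma adj_rdiag [simp]: "adj (rdiag d ev) = rdiag d ev"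
  by (rule eq_matI) auto

lemma unitaryD:
  assumes "unitary d U"
  shows "U \<in> carrier_mat d d" "adj U \<in> carrier_mat d d" "U * adj U = 1\<^sub>m d" "adj U * U = 1\<^sub>m d"
  using assms by (auto simp: unitary_def)

lemma unitary_cancel:
  assumes "unitary d U" "X \<in> carrier_mat d n"
  shows "adj U * (U * X) = X" "U * (adj U * X) = X"
  using assms unitaryD[OF assms(1)] assoc_mult_mat[of "adj U" d d U d X n] assoc_mult_mat[of U d d "adj U" d X n]
  by auto

lemmas assoc_square = assoc_mult_mat[of _ d d _ d _ d] mult_carrier_mat[of _ d d _ d] for d

theorem spectral_theorem:
  assumes A: "hermitian d A"
  obtains U ev where "unitary d U" "A = U * rdiag d ev * adj U"
proof -
  obtain u :: "nat \<Rightarrow> nat \<Rightarrow> complex" and ev :: "nat \<Rightarrow> real" where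
    eig: "\<And>j a. j < d \<Longrightarrow> a < d \<Longrightarrow> (\<Sum>b<d. A $$ (a,b) * u j b) = ev j * u j a" and
    orth: "\<And>i j. i < d \<Longrightarrow> j < d \<Longrightarrow> (\<Sum>a<d. cnj (u i a) * u j a) = of_bool (i = j)"
    using hermitian_eigenvectors[OF A order.refl] by blast
  have Ac: "A \<in> carrier_mat d d" using A by (simp add: hermitian_def)
  define U where "U = mat d d (\<lambda>(a,j). u j a)"
  have Uc: "U \<in> carrier_mat d d" by (simp add: U_def)
  have UU: "adj U * U = 1\<^sub>m d"
  proof (rule eq_matI)
    fix i j assume "i < dim_row (1\<^sub>m d :: complex mat)" "j < dim_col (1\<^sub>m d :: complex mat)"
    then have ij: "i < d" "j < d" by auto
    have "(adj U * U) $$ (i,j) = (\<Sum>a<d. cnj (u i a) * u j a)"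
      unfolding mult_index_sum[OF adj_carrier[OF Uc] Uc ij] using ij by (intro sum.cong) (auto simp: U_def)
    then show "(adj U * U) $$ (i,j) = 1\<^sub>m d $$ (i,j)" using orth ij by simp
  qed (use Uc in auto)
  have UU': "U * adj U = 1\<^sub>m d"
    using mat_mult_left_right_inverse[OF adj_carrier[OF Uc] Uc UU] .
  have AU: "A * U = U * rdiag d ev"
  proof (rule eq_matI)
    fix i j assume "i < dim_row (U * rdiag d ev)" "j < dim_col (U * rdiag d ev)"
    then have "i < d" "j < d" using Uc by auto
    then have "(A * U) $$ (i,j) = (\<Sum>b<d. A $$ (i,b) * u j b)"
      unfolding mult_index_sum[OF Ac Uc \<open>i < d\<close> \<open>j < d\<close>] by (intro sum.cong) (auto simp: U_def)
    then show "(A * U) $$ (i,j) = (U * rdiag d ev) $$ (i,j)"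
      unfolding rdiag_mult_right_index[OF Uc \<open>i < d\<close> \<open>j < d\<close>] using eig \<open>i < d\<close> \<open>j < d\<close> by (simp add: U_def)
  qed (use Ac Uc in auto)
  have "A = A * (U * adj U)" using Ac UU' by simp
  also have "\<dots> = A * U * adj U" using Ac Uc by (simp add: assoc_mult_mat[OF Ac Uc adj_carrier[OF Uc]])
  finally have "A = U * rdiag d ev * adj U" unfolding AU .
  moreover have "unitary d U" using Uc UU UU' by (simp add: unitary_def)
  ultimately show thesis using that by blast
qed

text \<open>The choice in \<open>mat_fun\<close> is immaterial. For two diagonalisations of A, W =
  adj U * U' intertwines the diagonal matrices, so an entry of W can be nonzero only where the
  eigenvalues agree. There their images under f agree too, hence W also intertwines the transformed
  diagonals.\<close>

lemma mat_fun_eq: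
  assumes U: "unitary d U" and A: "A = U * rdiag d ev * adj U"
  shows "mat_fun f d A = U * rdiag d (\<lambda>i. f (ev i)) * adj U"
proof -
  have unique: "B = U * rdiag d (\<lambda>i. f (ev i)) * adj U"
    if U': "unitary d U'" and A': "A = U' * rdiag d ev' * adj U'" and B: "B = U' * rdiag d (\<lambda>i. f (ev' i)) * adj U'"
    for B U' ev'
  proof -
    note c = unitaryD[OF U] unitaryD[OF U']
    note assoc = assoc_square[where d = d] unitary_cancel[OF U, of _ d] unitary_cancel[OF U', of _ d]
    define W where "W = adj U * U'"
    have Wc: "W \<in> carrier_mat d d" unfolding W_def using c by (meson mult_carrier_mat)
    have "rdiag d ev * W = adj U * (U * rdiag d ev * adj U) * U'"
      using c by (simp add: assoc W_def)
    also have "\<dots> = adj U * (U' * rdiag d ev' * adj U') * U'"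
      using A A' by simp
    also have "\<dots> = W * rdiag d ev'"
      using c by (simp add: assoc W_def)
    finally have comm: "rdiag d ev * W = W * rdiag d ev'" .
    have comm': "rdiag d (\<lambda>i. f (ev i)) * W = W * rdiag d (\<lambda>i. f (ev' i))"
    proof (rule eq_matI)
      fix i j assume "i < dim_row (W * rdiag d (\<lambda>i. f (ev' i)))" "j < dim_col (W * rdiag d (\<lambda>i. f (ev' i)))"
      then have ij: "i < d" "j < d" using Wc by auto
      have "ev i * W $$ (i,j) = W $$ (i,j) * ev' j"
        using arg_cong[OF comm, of "\<lambda>X. X $$ (i,j)"] ij
        by (simp add: rdiag_mult_left_index[OF Wc] rdiag_mult_right_index[OF Wc] del: index_mult_mat(1))
      then have "W $$ (i,j) = 0 \<or> ev i = ev' j" by (auto simp: mult.commute)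
      then have "f (ev i) * W $$ (i,j) = W $$ (i,j) * f (ev' j)" by auto
      then show "(rdiag d (\<lambda>i. f (ev i)) * W) $$ (i,j) = (W * rdiag d (\<lambda>i. f (ev' i))) $$ (i,j)"
        using ij by (simp add: rdiag_mult_left_index[OF Wc] rdiag_mult_right_index[OF Wc] del: index_mult_mat(1))
    qed (use Wc in auto)
    have UW: "U * W = U'"
    proof -
      have "U * W = (U * adj U) * U'" unfolding W_def using c by (simp add: assoc)
      then show ?thesis using c by simp
    qed
    have WU: "W * adj U' = adj U"
    proof -
      have "W * adj U' = adj U * (U' * adj U')" unfolding W_def using c by (simp add: assoc)
      then show ?thesis using c by simp
    qed
    have "B = (U * W) * rdiag d (\<lambda>i. f (ev' i)) * adj U'" unfolding UW B ..
    also have "\<dots> = U * (W * rdiag d (\<lambda>i. f (ev' i))) * adj U'"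
      using c Wc by (simp add: assoc)
    also have "\<dots> = U * rdiag d (\<lambda>i. f (ev i)) * (W * adj U')"
      unfolding comm'[symmetric] using c Wc by (simp add: assoc)
    finally show ?thesis unfolding WU .
  qed
  have ex: "\<exists>B U' ev'. unitary d U' \<and> A = U' * rdiag d ev' * adj U' \<and> B = U' * rdiag d (\<lambda>i. f (ev' i)) * adj U'"
    using U A by blast
  show ?thesis
    unfolding mat_fun_def rdiag_def[symmetric]
    by (rule someI2_ex[OF ex]) (use unique in blast)
qed

section \<open>Bessel's inequality and the dual form of the trace norm\<close>

lemma bessel:
  fixes e :: "nat \<Rightarrow> nat \<Rightarrow> complex" and y :: "nat \<Rightarrow> complex"
  assumes orth: "\<And>k k'. k < n \<Longrightarrow> k' < n \<Longrightarrow> (\<Sum>a<d. cnj (e k a) * e k' a) = of_bool (k = k' \<and> P k)"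
  shows "(\<Sum>k<n. (cmod (\<Sum>a<d. cnj (e k a) * y a))\<^sup>2) \<le> (\<Sum>a<d. (cmod (y a))\<^sup>2)"
proof -
  define \<beta> where "\<beta> k = (\<Sum>a<d. cnj (e k a) * y a)" for k
  let ?p = "\<lambda>a. \<Sum>k<n. \<beta> k * e k a"
  \<comment> \<open>The vectors without P are zero. Allowing them covers the normalised columns of a
    singular matrix.\<close>
  have zero: "\<beta> k = 0" if k: "k < n" "\<not> P k" for k
  proof -
    have "complex_of_real (\<Sum>a<d. (cmod (e k a))\<^sup>2) = 0"
      unfolding of_real_sum complex_norm_square using orth[OF k(1) k(1)] k(2) by (simp add: mult.commute)
    then have "(\<Sum>a<d. (cmod (e k a))\<^sup>2) = 0" using of_real_eq_0_iff by blast
    then have "\<forall>a<d. e k a = 0" by (subst (asm) sum_nonneg_eq_0_iff) auto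
    then show ?thesis by (simp add: \<beta>_def)
  qed
  have \<beta>sq: "\<beta> k * cnj (\<beta> k) = complex_of_real ((cmod (\<beta> k))\<^sup>2)" for k
    by (rule complex_norm_square[symmetric])
  have py: "(\<Sum>a<d. ?p a * cnj (y a)) = (\<Sum>k<n. complex_of_real ((cmod (\<beta> k))\<^sup>2))"
  proof -
    have "(\<Sum>a<d. ?p a * cnj (y a)) = (\<Sum>k<n. \<beta> k * (\<Sum>a<d. e k a * cnj (y a)))"
      unfolding sum_distrib_left sum_distrib_right by (subst sum.swap) (simp only: mult.assoc)
    also have "\<dots> = (\<Sum>k<n. \<beta> k * cnj (\<beta> k))" by (simp add: \<beta>_def)
    finally show ?thesis unfolding \<beta>sq .
  qed
  have yp: "(\<Sum>a<d. y a * cnj (?p a)) = (\<Sum>k<n. complex_of_real ((cmod (\<beta> k))\<^sup>2))"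
    using arg_cong[OF py, of cnj] by (simp add: mult.commute)
  have pp: "(\<Sum>a<d. ?p a * cnj (?p a)) = (\<Sum>k<n. complex_of_real ((cmod (\<beta> k))\<^sup>2))"
  proof -
    have "(\<Sum>a<d. ?p a * cnj (?p a)) = (\<Sum>a<d. \<Sum>k<n. \<Sum>k'<n. \<beta> k * cnj (\<beta> k') * (cnj (e k' a) * e k a))"
      unfolding cnj_sum sum_product by (intro sum.cong) (auto simp: mult_ac)
    also have "\<dots> = (\<Sum>k<n. \<Sum>k'<n. \<beta> k * cnj (\<beta> k') * (\<Sum>a<d. cnj (e k' a) * e k a))"
      unfolding sum_distrib_left by (subst sum.swap, rule sum.cong[OF refl], rule sum.swap)
    also have "\<dots> = (\<Sum>k<n. \<Sum>k'<n. if k' = k then (if P k then \<beta> k * cnj (\<beta> k) else 0) else 0)"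
      using orth by (intro sum.cong) auto
    also have "\<dots> = (\<Sum>k<n. \<beta> k * cnj (\<beta> k))"
      using zero by (intro sum.cong) auto
    finally show ?thesis unfolding \<beta>sq .
  qed
  have "complex_of_real (\<Sum>a<d. (cmod (y a - ?p a))\<^sup>2)
      = (\<Sum>a<d. y a * cnj (y a)) - (\<Sum>a<d. y a * cnj (?p a)) - (\<Sum>a<d. ?p a * cnj (y a)) + (\<Sum>a<d. ?p a * cnj (?p a))"
    unfolding of_real_sum complex_norm_square sum_subtractf[symmetric] sum.distrib[symmetric]
    by (intro sum.cong refl) (simp add: algebra_simps del: cnj_sum)
  also have "\<dots> = complex_of_real ((\<Sum>a<d. (cmod (y a))\<^sup>2) - (\<Sum>k<n. (cmod (\<beta> k))\<^sup>2))"
    unfolding yp py pp of_real_diff of_real_sum complex_norm_square by simp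
  finally have "(\<Sum>a<d. (cmod (y a - ?p a))\<^sup>2) = (\<Sum>a<d. (cmod (y a))\<^sup>2) - (\<Sum>k<n. (cmod (\<beta> k))\<^sup>2)"
    by (simp only: of_real_eq_iff)
  moreover have "0 \<le> (\<Sum>a<d. (cmod (y a - ?p a))\<^sup>2)" by (simp add: sum_nonneg)
  ultimately show ?thesis by (simp add: \<beta>_def)
qed

lemma unitary_columns:
  assumes "unitary d U" "k < d" "k' < d"
  shows "(\<Sum>a<d. cnj (U $$ (a,k)) * U $$ (a,k')) = of_bool (k = k')"
proof -
  note c = unitaryD[OF assms(1)]
  have "(\<Sum>a<d. cnj (U $$ (a,k)) * U $$ (a,k')) = (adj U * U) $$ (k,k')"
    unfolding mult_index_sum[OF c(2) c(1) assms(2,3)] using c assms by (intro sum.cong) auto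
  then show ?thesis using c assms by simp
qed

lemma cauchy_schwarz_complex:
  fixes a b :: "nat \<Rightarrow> complex"
  shows "cmod (\<Sum>k<n. a k * b k) \<le> sqrt (\<Sum>k<n. (cmod (a k))\<^sup>2) * sqrt (\<Sum>k<n. (cmod (b k))\<^sup>2)"
proof -
  have "cmod (\<Sum>k<n. a k * b k) \<le> (\<Sum>k<n. \<bar>cmod (a k)\<bar> * \<bar>cmod (b k)\<bar>)"
    by (intro sum_norm_le) (simp add: norm_mult)
  also have "\<dots> \<le> L2_set (\<lambda>k. cmod (a k)) {..<n} * L2_set (\<lambda>k. cmod (b k)) {..<n}"
    by (rule L2_set_mult_ineq)
  finally show ?thesis by (simp add: L2_set_def)
qed

lemma hermitian_adj_mult: "D \<in> carrier_mat d d \<Longrightarrow> hermitian d (adj D * D)"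
  unfolding hermitian_def by (auto simp: adj_mult[of "adj D" d d D d])

text \<open>Polar decomposition by columns: if U diagonalises adj D * D with eigenvalues ev, the
  columns of D U are orthogonal with norms sqrt ev. With e_k these columns normalised, V = U * adj E
  is a contraction, and tr(V D) is the sum of the sqrt ev.\<close>

theorem trace_norm_attained:
  assumes D: "D \<in> carrier_mat d d"
  shows "\<exists>V. contraction d V \<and> trace_norm d D = Re (\<Sum>i<d. \<Sum>j<d. V j i * D $$ (i,j))"
proof -
  obtain U ev where U: "unitary d U" and DD: "adj D * D = U * rdiag d ev * adj U"
    using spectral_theorem[OF hermitian_adj_mult[OF D]] by blast
  note c = unitaryD[OF U]
  have "trace_norm d D = Re (mtrace (U * rdiag d (\<lambda>i. sqrt (ev i)) * adj U))"
    unfolding trace_norm_def mat_fun_eq[OF U DD] ..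
  also have "mtrace (U * rdiag d (\<lambda>i. sqrt (ev i)) * adj U) = mtrace (adj U * (U * rdiag d (\<lambda>i. sqrt (ev i))))"
    using c by (intro mtrace_comm[of _ d]) auto
  also have "adj U * (U * rdiag d (\<lambda>i. sqrt (ev i))) = rdiag d (\<lambda>i. sqrt (ev i))"
    by (rule unitary_cancel[OF U rdiag_carrier])
  also have "Re (mtrace \<dots>) = (\<Sum>k<d. sqrt (ev k))" by (simp add: mtrace_def)
  finally have tn: "trace_norm d D = (\<Sum>k<d. sqrt (ev k))" .
  define W where "W = D * U"
  have Wc: "W \<in> carrier_mat d d" using D c by (auto simp: W_def)
  have "adj W * W = adj U * (adj D * D) * U"
    unfolding W_def adj_mult[OF D c(1)] using D c by (simp add: assoc_square[where d = d])
  also have "\<dots> = rdiag d ev"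
    unfolding DD using c by (simp add: assoc_square[where d = d] unitary_cancel[OF U, of _ d])
  finally have WW: "adj W * W = rdiag d ev" .
  have Worth: "(\<Sum>a<d. cnj (W $$ (a,k)) * W $$ (a,k')) = (if k = k' then complex_of_real (ev k) else 0)"
    if "k < d" "k' < d" for k k'
  proof -
    have "(\<Sum>a<d. cnj (W $$ (a,k)) * W $$ (a,k')) = (adj W * W) $$ (k,k')"
      unfolding mult_index_sum[OF adj_carrier[OF Wc] Wc that] using Wc that by (intro sum.cong) auto
    then show ?thesis unfolding WW using that by simp
  qed
  have ev: "ev k \<ge> 0" if "k < d" for k
  proof -
    have "complex_of_real (ev k) = complex_of_real (\<Sum>a<d. (cmod (W $$ (a,k)))\<^sup>2)"
      unfolding of_real_sum complex_norm_square using Worth[OF that that] by (simp add: mult.commute)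
    then have "ev k = (\<Sum>a<d. (cmod (W $$ (a,k)))\<^sup>2)" by (simp only: of_real_eq_iff)
    then show ?thesis by (simp add: sum_nonneg)
  qed
  \<comment> \<open>For ev k = 0 the division yields 0, so e k is the zero vector and V is only a
    partial isometry.\<close>
  define e where "e k a = W $$ (a,k) / complex_of_real (sqrt (ev k))" for k a
  define V where "V j i = (\<Sum>k<d. U $$ (j,k) * cnj (e k i))" for j i
  have e_orth: "(\<Sum>a<d. cnj (e k a) * e k' a) = of_bool (k = k' \<and> ev k > 0)" if k: "k < d" "k' < d" for k k'
  proof -
    have "(\<Sum>a<d. cnj (e k a) * e k' a) = (\<Sum>a<d. cnj (W $$ (a,k)) * W $$ (a,k')) / complex_of_real (sqrt (ev k) * sqrt (ev k'))"
      by (simp add: e_def sum_divide_distrib)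
    also have "\<dots> = of_bool (k = k' \<and> ev k > 0)"
      unfolding Worth[OF k] using ev[OF k(1)] by (auto simp flip: of_real_mult)
    finally show ?thesis .
  qed
  have "contraction d V"
    unfolding contraction_def
  proof (intro allI)
    fix x y :: "nat \<Rightarrow> complex"
    have "(\<Sum>j<d. \<Sum>i<d. cnj (x j) * V j i * y i) = (\<Sum>j<d. \<Sum>i<d. \<Sum>k<d. (cnj (x j) * U $$ (j,k)) * (cnj (e k i) * y i))"
      unfolding V_def sum_distrib_left sum_distrib_right by (simp only: mult.assoc)
    also have "\<dots> = (\<Sum>j<d. \<Sum>k<d. \<Sum>i<d. (cnj (x j) * U $$ (j,k)) * (cnj (e k i) * y i))"
      by (rule sum.cong[OF refl], rule sum.swap)
    also have "\<dots> = (\<Sum>k<d. \<Sum>j<d. \<Sum>i<d. (cnj (x j) * U $$ (j,k)) * (cnj (e k i) * y i))"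
      by (rule sum.swap)
    also have "\<dots> = (\<Sum>k<d. (\<Sum>j<d. cnj (x j) * U $$ (j,k)) * (\<Sum>i<d. cnj (e k i) * y i))"
      unfolding sum_product ..
    finally have eq: "(\<Sum>j<d. \<Sum>i<d. cnj (x j) * V j i * y i) = (\<Sum>k<d. (\<Sum>j<d. cnj (x j) * U $$ (j,k)) * (\<Sum>i<d. cnj (e k i) * y i))" .
    have "(\<Sum>k<d. (cmod (\<Sum>j<d. cnj (x j) * U $$ (j,k)))\<^sup>2) = (\<Sum>k<d. (cmod (\<Sum>j<d. cnj (U $$ (j,k)) * x j))\<^sup>2)"
    proof (rule sum.cong[OF refl])
      fix k
      have "(\<Sum>j<d. cnj (x j) * U $$ (j,k)) = cnj (\<Sum>j<d. cnj (U $$ (j,k)) * x j)"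
        by (simp add: mult.commute)
      then show "(cmod (\<Sum>j<d. cnj (x j) * U $$ (j,k)))\<^sup>2 = (cmod (\<Sum>j<d. cnj (U $$ (j,k)) * x j))\<^sup>2"
        by (simp only: complex_mod_cnj)
    qed
    also have "\<dots> \<le> (\<Sum>j<d. (cmod (x j))\<^sup>2)"
      using unitary_columns[OF U] by (intro bessel[where P = "\<lambda>_. True"]) auto
    finally have x: "(\<Sum>k<d. (cmod (\<Sum>j<d. cnj (x j) * U $$ (j,k)))\<^sup>2) \<le> (\<Sum>j<d. (cmod (x j))\<^sup>2)" .
    have y: "(\<Sum>k<d. (cmod (\<Sum>i<d. cnj (e k i) * y i))\<^sup>2) \<le> (\<Sum>i<d. (cmod (y i))\<^sup>2)"
      using e_orth by (intro bessel[where P = "\<lambda>k. ev k > 0"])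
    have "cmod (\<Sum>j<d. \<Sum>i<d. cnj (x j) * V j i * y i)
       \<le> sqrt (\<Sum>k<d. (cmod (\<Sum>j<d. cnj (x j) * U $$ (j,k)))\<^sup>2) * sqrt (\<Sum>k<d. (cmod (\<Sum>i<d. cnj (e k i) * y i))\<^sup>2)"
      unfolding eq by (rule cauchy_schwarz_complex)
    also have "\<dots> \<le> sqrt (\<Sum>j<d. (cmod (x j))\<^sup>2) * sqrt (\<Sum>i<d. (cmod (y i))\<^sup>2)"
      using x y by (intro mult_mono real_sqrt_le_mono) (auto simp: sum_nonneg)
    finally show "cmod (\<Sum>j<d. \<Sum>i<d. cnj (x j) * V j i * y i) \<le> sqrt (\<Sum>j<d. (cmod (x j))\<^sup>2) * sqrt (\<Sum>i<d. (cmod (y i))\<^sup>2)" .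
  qed
  moreover have "(\<Sum>i<d. \<Sum>j<d. V j i * D $$ (i,j)) = complex_of_real (\<Sum>k<d. sqrt (ev k))"
  proof -
    have "(\<Sum>i<d. \<Sum>j<d. V j i * D $$ (i,j)) = (\<Sum>i<d. \<Sum>j<d. \<Sum>k<d. cnj (e k i) * (D $$ (i,j) * U $$ (j,k)))"
      unfolding V_def sum_distrib_right by (intro sum.cong) (auto simp: mult_ac)
    also have "\<dots> = (\<Sum>i<d. \<Sum>k<d. cnj (e k i) * (\<Sum>j<d. D $$ (i,j) * U $$ (j,k)))"
      unfolding sum_distrib_left by (rule sum.cong[OF refl], rule sum.swap)
    also have "\<dots> = (\<Sum>i<d. \<Sum>k<d. cnj (e k i) * W $$ (i,k))"
      using mult_index_sum[OF D c(1)] by (intro sum.cong) (auto simp: W_def simp del: index_mult_mat(1))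
    also have "\<dots> = (\<Sum>k<d. \<Sum>i<d. cnj (e k i) * W $$ (i,k))" by (rule sum.swap)
    also have "\<dots> = (\<Sum>k<d. complex_of_real (sqrt (ev k)))"
    proof (rule sum.cong[OF refl])
      fix k assume "k \<in> {..<d}"
      then have k: "k < d" by simp
      have "(\<Sum>i<d. cnj (e k i) * W $$ (i,k)) = (\<Sum>i<d. cnj (W $$ (i,k)) * W $$ (i,k)) / complex_of_real (sqrt (ev k))"
        by (simp add: e_def sum_divide_distrib)
      also have "\<dots> = complex_of_real (ev k / sqrt (ev k))" unfolding Worth[OF k k] by simp
      also have "ev k / sqrt (ev k) = sqrt (ev k)" using ev[OF k] by (simp add: real_div_sqrt)
      finally show "(\<Sum>i<d. cnj (e k i) * W $$ (i,k)) = complex_of_real (sqrt (ev k))" .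
    qed
    finally show ?thesis by simp
  qed
  ultimately show ?thesis using tn by (intro exI[of _ V]) simp
qed

text \<open>This expresses a test operator in the eigenbasis of the reference operator. Bessel's
  inequality for the rows of U controls both transformed arguments.\<close>

lemma contraction_unitary_conj:
  assumes V: "contraction d V" and U: "unitary d U"
  shows "contraction d (\<lambda>b a. \<Sum>j<d. \<Sum>i<d. cnj (U $$ (j,b)) * V j i * U $$ (i,a))"
  unfolding contraction_def
proof (intro allI)
  fix x y :: "nat \<Rightarrow> complex"
  define T where "T z j = (\<Sum>b<d. U $$ (j,b) * z b)" for z :: "nat \<Rightarrow> complex" and j
  have T: "(\<Sum>j<d. (cmod (T z j))\<^sup>2) \<le> (\<Sum>b<d. (cmod (z b))\<^sup>2)" for z
  proof -
    have "(\<Sum>j<d. (cmod (T z j))\<^sup>2) = (\<Sum>j<d. (cmod (\<Sum>b<d. cnj (cnj (U $$ (j,b))) * z b))\<^sup>2)"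
      by (simp add: T_def)
    also have "\<dots> \<le> (\<Sum>b<d. (cmod (z b))\<^sup>2)"
    proof (rule bessel[where P = "\<lambda>_. True"])
      fix j j' assume j: "j < d" "j' < d"
      note c = unitaryD[OF U]
      have "(\<Sum>b<d. cnj (cnj (U $$ (j,b))) * cnj (U $$ (j',b))) = (U * adj U) $$ (j,j')"
        unfolding mult_index_sum[OF c(1,2) j] using c j by (intro sum.cong) auto
      then show "(\<Sum>b<d. cnj (cnj (U $$ (j,b))) * cnj (U $$ (j',b))) = of_bool (j = j' \<and> True)"
        using c j by simp
    qed
    finally show ?thesis .
  qed
  have "(\<Sum>b<d. \<Sum>a<d. cnj (x b) * (\<Sum>j<d. \<Sum>i<d. cnj (U $$ (j,b)) * V j i * U $$ (i,a)) * y a)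
      = (\<Sum>b<d. \<Sum>a<d. \<Sum>j<d. \<Sum>i<d. cnj (U $$ (j,b) * x b) * V j i * (U $$ (i,a) * y a))"
    unfolding sum_distrib_left sum_distrib_right by (intro sum.cong) (auto simp: mult_ac)
  also have "\<dots> = (\<Sum>b<d. \<Sum>j<d. \<Sum>a<d. \<Sum>i<d. cnj (U $$ (j,b) * x b) * V j i * (U $$ (i,a) * y a))"
    by (rule sum.cong[OF refl], rule sum.swap)
  also have "\<dots> = (\<Sum>j<d. \<Sum>b<d. \<Sum>a<d. \<Sum>i<d. cnj (U $$ (j,b) * x b) * V j i * (U $$ (i,a) * y a))"
    by (rule sum.swap)
  also have "\<dots> = (\<Sum>j<d. \<Sum>b<d. \<Sum>i<d. \<Sum>a<d. cnj (U $$ (j,b) * x b) * V j i * (U $$ (i,a) * y a))"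
    by (rule sum.cong[OF refl], rule sum.cong[OF refl], rule sum.swap)
  also have "\<dots> = (\<Sum>j<d. \<Sum>i<d. \<Sum>b<d. \<Sum>a<d. cnj (U $$ (j,b) * x b) * V j i * (U $$ (i,a) * y a))"
    by (rule sum.cong[OF refl], rule sum.swap)
  also have "\<dots> = (\<Sum>j<d. \<Sum>i<d. cnj (T x j) * V j i * T y i)"
    unfolding T_def cnj_sum sum_distrib_left sum_distrib_right
    by (rule sum.cong[OF refl], rule sum.cong[OF refl], rule sum.swap)
  finally have eq: "(\<Sum>b<d. \<Sum>a<d. cnj (x b) * (\<Sum>j<d. \<Sum>i<d. cnj (U $$ (j,b)) * V j i * U $$ (i,a)) * y a) = (\<Sum>j<d. \<Sum>i<d. cnj (T x j) * V j i * T y i)" .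
  have "cmod (\<Sum>j<d. \<Sum>i<d. cnj (T x j) * V j i * T y i) \<le> sqrt (\<Sum>j<d. (cmod (T x j))\<^sup>2) * sqrt (\<Sum>i<d. (cmod (T y i))\<^sup>2)"
    by (rule contractionD[OF V])
  also have "\<dots> \<le> sqrt (\<Sum>b<d. (cmod (x b))\<^sup>2) * sqrt (\<Sum>a<d. (cmod (y a))\<^sup>2)"
    by (intro mult_mono real_sqrt_le_mono T) (auto simp: sum_nonneg)
  finally show "cmod (\<Sum>b<d. \<Sum>a<d. cnj (x b) * (\<Sum>j<d. \<Sum>i<d. cnj (U $$ (j,b)) * V j i * U $$ (i,a)) * y a)
      \<le> sqrt (\<Sum>b<d. (cmod (x b))\<^sup>2) * sqrt (\<Sum>a<d. (cmod (y a))\<^sup>2)"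
    unfolding eq .
qed

lemma sum_div_mod:
  fixes F :: "nat \<Rightarrow> 'a :: comm_monoid_add"
  shows "(\<Sum>i<n * d. F i) = (\<Sum>a<n. \<Sum>b<d. F (a * d + b))"
proof -
  have "(\<Sum>i<n * d. F i) = (\<Sum>a<n. sum F {a * d..<a * d + d})"
    by (rule sum.nat_group[symmetric])
  also have "\<dots> = (\<Sum>a<n. \<Sum>b<d. F (a * d + b))"
  proof (rule sum.cong[OF refl])
    fix a
    show "sum F {a * d..<a * d + d} = (\<Sum>b<d. F (a * d + b))"
      using sum.shift_bounds_nat_ivl[of F 0 "a * d" d] by (simp add: atLeast0LessThan add.commute[of _ "a * d"])
  qed
  finally show ?thesis .
qed

section \<open>Block diagonal operators\<close>

lemma enum_set_bij: "finite A \<Longrightarrow> bij_betw (enum_set A) {0..<card A} A"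
  unfolding enum_set_def by (rule someI_ex[OF ex_bij_betw_nat_finite])

lemma enum_set_in: "finite A \<Longrightarrow> i < card A \<Longrightarrow> enum_set A i \<in> A"
  using enum_set_bij bij_betwE by fastforce

lemma cq_carrier [simp]: "cq A d g \<in> carrier_mat (card A * d) (card A * d)"
  by (simp add: cq_def)

lemma cq_dim [simp]: "dim_row (cq A d g) = card A * d" "dim_col (cq A d g) = card A * d"
  by (simp_all add: cq_def)

lemma block_offset:
  assumes "a < n" "c < d" shows "a * d + c < n * (d :: nat)"
proof -
  have "a * d + c < Suc a * d" using assms(2) by simp
  also have "\<dots> \<le> n * d" using assms(1) by (intro mult_right_mono) auto
  finally show ?thesis .
qed

lemma block_index:
  assumes "finite A" "i < card A * d"
  shows "i div d < card A" "i mod d < d" "enum_set A (i div d) \<in> A"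
proof -
  have "d > 0" using assms(2) by (cases d) auto
  then show "i mod d < d" by simp
  show "i div d < card A" using assms(2) by (simp add: less_mult_imp_div_less)
  then show "enum_set A (i div d) \<in> A" by (rule enum_set_in[OF assms(1)])
qed

lemma cq_index:
  "i < card A * d \<Longrightarrow> j < card A * d \<Longrightarrow>
    cq A d g $$ (i,j) = (if i div d = j div d then g (enum_set A (i div d)) $$ (i mod d, j mod d) else 0)"
  by (simp add: cq_def)

lemma cq_cong:
  assumes "finite A" "\<And>a. a \<in> A \<Longrightarrow> g a = h a"
  shows "cq A d g = cq A d h"
  by (rule eq_matI) (use assms in \<open>auto simp: cq_index block_index(3)\<close>)

lemma cq_mult:
  assumes A: "finite A" and g: "\<And>a. a \<in> A \<Longrightarrow> g a \<in> carrier_mat d d" and h: "\<And>a. a \<in> A \<Longrightarrow> h a \<in> carrier_mat d d"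
  shows "cq A d g * cq A d h = cq A d (\<lambda>a. g a * h a)"
proof (rule eq_matI)
  fix i j assume "i < dim_row (cq A d (\<lambda>a. g a * h a))" "j < dim_col (cq A d (\<lambda>a. g a * h a))"
  then have ij: "i < card A * d" "j < card A * d" by auto
  note b = block_index[OF A ij(1)] block_index[OF A ij(2)]
  let ?x = "enum_set A (i div d)"
  have "(cq A d g * cq A d h) $$ (i,j) = (\<Sum>k<card A * d. cq A d g $$ (i,k) * cq A d h $$ (k,j))"
    by (rule mult_index_sum[OF cq_carrier cq_carrier ij])
  also have "\<dots> = (\<Sum>a<card A. \<Sum>c<d. cq A d g $$ (i,a * d + c) * cq A d h $$ (a * d + c,j))"
    by (rule sum_div_mod)
  also have "\<dots> = (\<Sum>a<card A. if a = i div d then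
      (\<Sum>c<d. g ?x $$ (i mod d, c) * (if i div d = j div d then h ?x $$ (c, j mod d) else 0)) else 0)"
  proof (rule sum.cong[OF refl])
    fix a assume "a \<in> {..<card A}"
    then have a: "a * d + c < card A * d" if "c < d" for c
      using that by (auto intro: block_offset)
    have "(\<Sum>c<d. cq A d g $$ (i,a * d + c) * cq A d h $$ (a * d + c,j))
      = (\<Sum>c<d. if a = i div d then g ?x $$ (i mod d, c) * (if i div d = j div d then h ?x $$ (c, j mod d) else 0) else 0)"
      using ij a by (intro sum.cong refl) (auto simp: cq_index)
    then show "(\<Sum>c<d. cq A d g $$ (i,a * d + c) * cq A d h $$ (a * d + c,j)) = (if a = i div d then
      (\<Sum>c<d. g ?x $$ (i mod d, c) * (if i div d = j div d then h ?x $$ (c, j mod d) else 0)) else 0)"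
      by simp
  qed
  also have "\<dots> = (if i div d = j div d then (\<Sum>c<d. g ?x $$ (i mod d, c) * h ?x $$ (c, j mod d)) else 0)"
    using b by simp
  also have "\<dots> = cq A d (\<lambda>a. g a * h a) $$ (i,j)"
    unfolding cq_index[OF ij] mult_index_sum[OF g[OF b(3)] h[OF b(3)] b(2) b(5)] ..
  finally show "(cq A d g * cq A d h) $$ (i,j) = cq A d (\<lambda>a. g a * h a) $$ (i,j)" .
qed auto

lemma cq_adj:
  assumes A: "finite A" and g: "\<And>a. a \<in> A \<Longrightarrow> g a \<in> carrier_mat d d"
  shows "adj (cq A d g) = cq A d (\<lambda>a. adj (g a))"
proof (rule eq_matI)
  fix i j assume "i < dim_row (cq A d (\<lambda>a. adj (g a)))" "j < dim_col (cq A d (\<lambda>a. adj (g a)))"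
  then have ij: "i < card A * d" "j < card A * d" by auto
  note b = block_index[OF A ij(1)] block_index[OF A ij(2)]
  show "adj (cq A d g) $$ (i,j) = cq A d (\<lambda>a. adj (g a)) $$ (i,j)"
    using ij b g[OF b(3)] by (auto simp: cq_index)
qed auto

lemma cq_one: "finite A \<Longrightarrow> cq A d (\<lambda>_. 1\<^sub>m d) = 1\<^sub>m (card A * d)"
proof (rule eq_matI)
  fix i j assume A: "finite A" and "i < dim_row (1\<^sub>m (card A * d) :: complex mat)" "j < dim_col (1\<^sub>m (card A * d) :: complex mat)"
  then have ij: "i < card A * d" "j < card A * d" by auto
  note b = block_index[OF A ij(1)] block_index[OF A ij(2)]
  show "cq A d (\<lambda>_. 1\<^sub>m d) $$ (i,j) = 1\<^sub>m (card A * d) $$ (i,j)"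
    using ij b by (auto simp: cq_index) (metis div_mult_mod_eq)
qed auto

lemma cq_rdiag:
  assumes A: "finite A"
  shows "cq A d (\<lambda>a. rdiag d (e a)) = rdiag (card A * d) (\<lambda>i. e (enum_set A (i div d)) (i mod d))"
proof (rule eq_matI)
  fix i j assume "i < dim_row (rdiag (card A * d) (\<lambda>i. e (enum_set A (i div d)) (i mod d)))"
    "j < dim_col (rdiag (card A * d) (\<lambda>i. e (enum_set A (i div d)) (i mod d)))"
  then have ij: "i < card A * d" "j < card A * d" by auto
  note b = block_index[OF A ij(1)] block_index[OF A ij(2)]
  show "cq A d (\<lambda>a. rdiag d (e a)) $$ (i,j) = rdiag (card A * d) (\<lambda>i. e (enum_set A (i div d)) (i mod d)) $$ (i,j)"
    using ij b by (auto simp: cq_index) (metis div_mult_mod_eq)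
qed auto

lemma cq_minus:
  assumes A: "finite A" and g: "\<And>a. a \<in> A \<Longrightarrow> g a \<in> carrier_mat d d" and h: "\<And>a. a \<in> A \<Longrightarrow> h a \<in> carrier_mat d d"
  shows "cq A d g - cq A d h = cq A d (\<lambda>a. g a - h a)"
proof (rule eq_matI)
  fix i j assume "i < dim_row (cq A d (\<lambda>a. g a - h a))" "j < dim_col (cq A d (\<lambda>a. g a - h a))"
  then have ij: "i < card A * d" "j < card A * d" by auto
  note b = block_index[OF A ij(1)] block_index[OF A ij(2)]
  show "(cq A d g - cq A d h) $$ (i,j) = cq A d (\<lambda>a. g a - h a) $$ (i,j)"
    using ij b g[OF b(3)] h[OF b(3)] by (auto simp: cq_index)
qed auto

lemma cq_mtrace:
  assumes A: "finite A" and g: "\<And>a. a \<in> A \<Longrightarrow> g a \<in> carrier_mat d d"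
  shows "mtrace (cq A d g) = (\<Sum>a\<in>A. mtrace (g a))"
proof -
  have "mtrace (cq A d g) = (\<Sum>a<card A. \<Sum>c<d. cq A d g $$ (a * d + c, a * d + c))"
    unfolding mtrace_def by (simp add: sum_div_mod)
  also have "\<dots> = (\<Sum>a<card A. mtrace (g (enum_set A a)))"
  proof (rule sum.cong[OF refl])
    fix a assume "a \<in> {..<card A}"
    then have a: "a * d + c < card A * d" if "c < d" for c
      using that by (auto intro: block_offset)
    have "dim_row (g (enum_set A a)) = d"
      using g[OF enum_set_in[OF A]] \<open>a \<in> {..<card A}\<close> by auto
    then show "(\<Sum>c<d. cq A d g $$ (a * d + c, a * d + c)) = mtrace (g (enum_set A a))"
      unfolding mtrace_def using a by (intro sum.cong) (auto simp: cq_index)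
  qed
  also have "\<dots> = (\<Sum>a\<in>A. mtrace (g a))"
    using sum.reindex_bij_betw[OF enum_set_bij[OF A], of "\<lambda>a. mtrace (g a)"] by (simp add: atLeast0LessThan)
  finally show ?thesis .
qed

lemma cq_unitary:
  assumes A: "finite A" and U: "\<And>a. a \<in> A \<Longrightarrow> unitary d (U a)"
  shows "unitary (card A * d) (cq A d U)"
proof -
  note c = unitaryD[OF U]
  have "cq A d U * adj (cq A d U) = cq A d (\<lambda>a. U a * adj (U a))"
    using A c by (simp add: cq_adj cq_mult)
  also have "\<dots> = 1\<^sub>m (card A * d)"
    unfolding cq_one[OF A, symmetric] using A c by (intro cq_cong) auto
  finally have 1: "cq A d U * adj (cq A d U) = 1\<^sub>m (card A * d)" .
  have "adj (cq A d U) * cq A d U = cq A d (\<lambda>a. adj (U a) * U a)"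
    using A c by (simp add: cq_adj cq_mult)
  also have "\<dots> = 1\<^sub>m (card A * d)"
    unfolding cq_one[OF A, symmetric] using A c by (intro cq_cong) auto
  finally show ?thesis using 1 by (simp add: unitary_def)
qed

text \<open>Diagonalising the blocks separately yields one block diagonal diagonalisation, and
  \<open>mat_fun_eq\<close> permits computing with that one.\<close>

theorem mat_fun_cq:
  assumes A: "finite A" and g: "\<And>a. a \<in> A \<Longrightarrow> hermitian d (g a)"
  shows "mat_fun f (card A * d) (cq A d g) = cq A d (\<lambda>a. mat_fun f d (g a))"
proof -
  have "\<forall>a\<in>A. \<exists>U ev. unitary d U \<and> g a = U * rdiag d ev * adj U"
    using g spectral_theorem by metis
  then obtain U ev where U: "\<And>a. a \<in> A \<Longrightarrow> unitary d (U a)"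
    and ga: "\<And>a. a \<in> A \<Longrightarrow> g a = U a * rdiag d (ev a) * adj (U a)"
    by metis
  note c = unitaryD[OF U]
  have prod: "cq A d (\<lambda>a. U a * rdiag d (e a) * adj (U a)) = cq A d U * cq A d (\<lambda>a. rdiag d (e a)) * adj (cq A d U)" for e
    using A c by (simp add: cq_adj cq_mult mult_carrier_mat[of _ d d _ d])
  have "cq A d g = cq A d U * rdiag (card A * d) (\<lambda>i. ev (enum_set A (i div d)) (i mod d)) * adj (cq A d U)"
    unfolding cq_rdiag[OF A, symmetric] prod[symmetric] using A ga by (intro cq_cong)
  then have "mat_fun f (card A * d) (cq A d g)
      = cq A d U * rdiag (card A * d) (\<lambda>i. f (ev (enum_set A (i div d)) (i mod d))) * adj (cq A d U)"
    using A U by (intro mat_fun_eq cq_unitary)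
  also have "\<dots> = cq A d (\<lambda>a. U a * rdiag d (\<lambda>i. f (ev a i)) * adj (U a))"
    unfolding prod cq_rdiag[OF A] ..
  also have "\<dots> = cq A d (\<lambda>a. mat_fun f d (g a))"
    using A mat_fun_eq[OF U ga] by (intro cq_cong) auto
  finally show ?thesis .
qed

lemma mat_fun_carrier:
  assumes "hermitian d A" shows "mat_fun f d A \<in> carrier_mat d d"
proof -
  obtain U ev where U: "unitary d U" "A = U * rdiag d ev * adj U"
    using spectral_theorem[OF assms] by blast
  then show ?thesis using unitaryD[OF U(1)] by (simp add: mat_fun_eq mult_carrier_mat[of _ d d _ d])
qed

lemma trace_norm_cq:
  assumes A: "finite A" and g: "\<And>a. a \<in> A \<Longrightarrow> g a \<in> carrier_mat d d"
  shows "trace_norm (card A * d) (cq A d g) = (\<Sum>a\<in>A. trace_norm d (g a))"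
proof -
  have "adj (cq A d g) * cq A d g = cq A d (\<lambda>a. adj (g a) * g a)"
    using A g by (simp add: cq_adj cq_mult)
  then show ?thesis
    unfolding trace_norm_def using A g
    by (simp add: mat_fun_cq hermitian_adj_mult cq_mtrace mat_fun_carrier)
qed

lemma tensor_uniform:
  assumes "finite A" "B \<in> carrier_mat d d"
  shows "tensor (card A) d (uniform_op A) B = cq A d (\<lambda>_. (1 / real (card A)) \<cdot>\<^sub>m B)"
proof (rule eq_matI)
  fix i j assume "i < dim_row (cq A d (\<lambda>_. complex_of_real (1 / real (card A)) \<cdot>\<^sub>m B))"
    "j < dim_col (cq A d (\<lambda>_. complex_of_real (1 / real (card A)) \<cdot>\<^sub>m B))"
  then have ij: "i < card A * d" "j < card A * d" by auto
  note b = block_index[OF assms(1) ij(1)] block_index[OF assms(1) ij(2)]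
  show "tensor (card A) d (uniform_op A) B $$ (i,j) = cq A d (\<lambda>_. (1 / real (card A)) \<cdot>\<^sub>m B) $$ (i,j)"
    using ij b assms(2) by (auto simp: tensor_def uniform_op_def cq_index)
qed (auto simp: tensor_def)

lemma ptrace1_cq:
  assumes A: "finite A"
  shows "ptrace1 (card A) d (cq A d g) = msum d A g"
proof (rule eq_matI)
  fix i j assume "i < dim_row (msum d A g)" "j < dim_col (msum d A g)"
  then have ij: "i < d" "j < d" by (auto simp: msum_def)
  have "ptrace1 (card A) d (cq A d g) $$ (i,j) = (\<Sum>k<card A. g (enum_set A k) $$ (i,j))"
    unfolding ptrace1_def index_mat(1)[OF ij] prod.case
  proof (rule sum.cong[OF refl])
    fix k assume "k \<in> {..<card A}"
    then have a: "k * d + c < card A * d" if "c < d" for c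
      using that by (auto intro: block_offset)
    show "cq A d g $$ (k * d + i, k * d + j) = g (enum_set A k) $$ (i,j)"
      using a ij by (auto simp: cq_index)
  qed
  also have "\<dots> = msum d A g $$ (i,j)"
    using sum.reindex_bij_betw[OF enum_set_bij[OF A], of "\<lambda>a. g a $$ (i,j)"] ij by (simp add: msum_def atLeast0LessThan)
  finally show "ptrace1 (card A) d (cq A d g) $$ (i,j) = msum d A g $$ (i,j)" .
qed (auto simp: msum_def ptrace1_def)

lemma ptrace2_cq:
  assumes A: "finite A" and g: "\<And>a. a \<in> A \<Longrightarrow> g a \<in> carrier_mat d d \<and> mtrace (g a) = 1 / real (card A)"
  shows "ptrace2 (card A) d (cq A d g) = uniform_op A"
proof (rule eq_matI)
  fix i j assume "i < dim_row (uniform_op A)" "j < dim_col (uniform_op A)"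
  then have ij: "i < card A" "j < card A" by (auto simp: uniform_op_def)
  have a: "k * d + c < card A * d" if "c < d" "k < card A" for c k
    using that by (auto intro: block_offset)
  have "ptrace2 (card A) d (cq A d g) $$ (i,j) = (\<Sum>k<d. if i = j then g (enum_set A i) $$ (k,k) else 0)"
    unfolding ptrace2_def index_mat(1)[OF ij] prod.case
    using a ij by (intro sum.cong) (auto simp: cq_index)
  also have "\<dots> = (if i = j then mtrace (g (enum_set A i)) else 0)"
    using g[OF enum_set_in[OF A ij(1)]] by (auto simp: mtrace_def)
  also have "\<dots> = uniform_op A $$ (i,j)"
    using g[OF enum_set_in[OF A ij(1)]] ij by (cases "i = j") (auto simp: uniform_op_def)
  finally show "ptrace2 (card A) d (cq A d g) $$ (i,j) = uniform_op A $$ (i,j)" .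
qed (auto simp: ptrace2_def uniform_op_def)

text \<open>A kernel vector of the block h a, placed in the block of a and padded with zeros, is a
  kernel vector of the whole operator; reading off the same block gives the claim.\<close>

lemma supp_le_cq:
  assumes A: "finite A" and g: "\<And>a. a \<in> A \<Longrightarrow> g a \<in> carrier_mat d d" and h: "\<And>a. a \<in> A \<Longrightarrow> h a \<in> carrier_mat d d"
    and le: "supp_le (card A * d) (cq A d g) (cq A d h)" and a: "a \<in> A"
  shows "supp_le d (g a) (h a)"
  unfolding supp_le_def
proof (intro ballI impI)
  fix v assume v: "v \<in> carrier_vec d" and hv: "h a *\<^sub>v v = 0\<^sub>v d"
  obtain n where n: "n < card A" "enum_set A n = a"
    using enum_set_bij[OF A] a by (metis atLeastLessThan_iff bij_betw_iff_bijections)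
  have nd: "n * d + c < card A * d" if "c < d" for c
    using that n(1) by (auto intro: block_offset)
  define w where "w = vec (card A * d) (\<lambda>i. if i div d = n then v $ (i mod d) else 0)"
  have wc: "w \<in> carrier_vec (card A * d)" by (simp add: w_def)
  have cqw: "(cq A d k *\<^sub>v w) $ i = (if i div d = n then (k a *\<^sub>v v) $ (i mod d) else 0)"
    if i: "i < card A * d" and k: "k a \<in> carrier_mat d d" for k i
  proof -
    have "(cq A d k *\<^sub>v w) $ i = (\<Sum>j<card A * d. cq A d k $$ (i,j) * w $ j)"
      using i wc by (simp add: scalar_prod_def atLeast0LessThan)
    also have "\<dots> = (\<Sum>b<card A. \<Sum>c<d. cq A d k $$ (i,b * d + c) * w $ (b * d + c))"
      by (rule sum_div_mod)
    also have "\<dots> = (\<Sum>b<card A. if b = n then (\<Sum>c<d. if i div d = n then k a $$ (i mod d, c) * v $ c else 0) else 0)"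
    proof (rule sum.cong[OF refl])
      fix b assume "b \<in> {..<card A}"
      then have bd: "b * d + c < card A * d" if "c < d" for c
        using that by (auto intro: block_offset)
      show "(\<Sum>c<d. cq A d k $$ (i,b * d + c) * w $ (b * d + c)) = (if b = n then (\<Sum>c<d. if i div d = n then k a $$ (i mod d, c) * v $ c else 0) else 0)"
        using bd i n by (auto simp: w_def cq_index intro!: sum.cong)
    qed
    also have "\<dots> = (\<Sum>c<d. if i div d = n then k a $$ (i mod d, c) * v $ c else 0)"
      using n by simp
    also have "\<dots> = (if i div d = n then (k a *\<^sub>v v) $ (i mod d) else 0)"
      using k v block_index(2)[OF A i] by (auto simp: scalar_prod_def atLeast0LessThan)
    finally show ?thesis .
  qed
  have "cq A d h *\<^sub>v w = 0\<^sub>v (card A * d)"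
  proof (rule eq_vecI)
    fix i assume "i < dim_vec (0\<^sub>v (card A * d) :: complex vec)"
    then have i: "i < card A * d" by simp
    show "(cq A d h *\<^sub>v w) $ i = 0\<^sub>v (card A * d) $ i"
      using cqw[of i h, OF i h[OF a]] i hv block_index(2)[OF A i] by simp
  qed simp
  then have z: "cq A d g *\<^sub>v w = 0\<^sub>v (card A * d)"
    using le wc by (simp add: supp_le_def)
  show "g a *\<^sub>v v = 0\<^sub>v d"
  proof (rule eq_vecI)
    fix c assume "c < dim_vec (0\<^sub>v d :: complex vec)"
    then have c: "c < d" by simp
    then have "(g a *\<^sub>v v) $ c = (cq A d g *\<^sub>v w) $ (n * d + c)"
      using cqw[of "n * d + c" g, OF nd[OF c] g[OF a]] by simp
    then show "(g a *\<^sub>v v) $ c = 0\<^sub>v d $ c" unfolding z using nd[OF c] c by simp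
  qed (use g[OF a] in auto)
qed

section \<open>The distance bound\<close>

lemma conj_index:
  assumes "U \<in> carrier_mat d d" "B \<in> carrier_mat d d" "i < d" "j < d"
  shows "(U * B * adj U) $$ (i,j) = (\<Sum>a<d. \<Sum>b<d. U $$ (i,a) * B $$ (a,b) * cnj (U $$ (j,b)))"
proof -
  have UB: "U * B \<in> carrier_mat d d" using assms by simp
  have "(U * B * adj U) $$ (i,j) = (\<Sum>b<d. (U * B) $$ (i,b) * adj U $$ (b,j))"
    by (rule mult_index_sum[OF UB adj_carrier[OF assms(1)] assms(3,4)])
  also have "\<dots> = (\<Sum>b<d. \<Sum>a<d. U $$ (i,a) * B $$ (a,b) * cnj (U $$ (j,b)))"
    using assms mult_index_sum[OF assms(1,2,3)]
    by (intro sum.cong refl) (simp add: sum_distrib_right del: index_mult_mat(1))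
  finally show ?thesis by (subst sum.swap) simp
qed

lemma conj_rdiag_index:
  assumes "U \<in> carrier_mat d d" "i < d" "j < d"
  shows "(U * rdiag d e * adj U) $$ (i,j) = (\<Sum>k<d. complex_of_real (e k) * (U $$ (i,k) * cnj (U $$ (j,k))))"
proof -
  have "(U * rdiag d e * adj U) $$ (i,j) = (\<Sum>a<d. \<Sum>b<d. if a = b then U $$ (i,a) * e a * cnj (U $$ (j,b)) else 0)"
    unfolding conj_index[OF assms(1) rdiag_carrier assms(2,3)] by (intro sum.cong) auto
  then show ?thesis by (simp add: mult_ac)
qed

lemma sandwich_rdiag_index:
  assumes "B \<in> carrier_mat d d" "i < d" "j < d"
  shows "(rdiag d e * B * rdiag d e) $$ (i,j) = complex_of_real (e i * e j) * B $$ (i,j)"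
proof -
  have "rdiag d e * B \<in> carrier_mat d d" using assms by (simp add: mult_carrier_mat[of _ d d])
  then have "(rdiag d e * B * rdiag d e) $$ (i,j) = (rdiag d e * B) $$ (i,j) * complex_of_real (e j)"
    using assms by (intro rdiag_mult_right_index)
  also have "(rdiag d e * B) $$ (i,j) = complex_of_real (e i) * B $$ (i,j)"
    using assms by (intro rdiag_mult_left_index)
  finally show ?thesis by simp
qed

lemma deviation_sum: "deviation L M h m (\<lambda>l. \<Sum>t\<in>T. z t l) = (\<Sum>t\<in>T. deviation L M h m (z t))"
proof -
  have "(\<Sum>l\<in>K. \<Sum>t\<in>T. z t l) = (\<Sum>t\<in>T. \<Sum>l\<in>K. z t l)" for K by (rule sum.swap)
  then show ?thesis by (simp add: deviation_def sum_subtractf sum_divide_distrib)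
qed

lemma deviation_cong:
  assumes "\<And>l. l \<in> L \<Longrightarrow> z l = z' l" shows "deviation L M h m z = deviation L M h m z'"
  using assms by (simp add: deviation_def)

definition dev_mat :: "nat \<Rightarrow> ('x \<Rightarrow> complex mat) \<Rightarrow> 'x set \<Rightarrow> 'm set \<Rightarrow> ('x \<Rightarrow> 'm) \<Rightarrow> 'm \<Rightarrow> complex mat" where
  "dev_mat d W L M h m = mat d d (\<lambda>ij. deviation L M h m (\<lambda>l. 1 / of_nat (card L) * W l $$ ij))"

text \<open>Both the state and the ideal product state are block diagonal over M, so the trace norm
  splits into those of the blocks. The weights 1/|M| and |M|/|L| combine to 1/|L|.\<close>

lemma dbar_eq_sum_trace_norm:
  assumes hash: "universal_hash S f L M" and L: "L \<noteq> {}"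
  shows "dbar d W L M S f = (\<Sum>s\<in>S. \<Sum>m\<in>M. trace_norm d (dev_mat d W L M (f s) m)) / real (card S)"
proof -
  have fin: "finite L" "finite M" and in_M: "\<And>s l. s \<in> S \<Longrightarrow> l \<in> L \<Longrightarrow> f s l \<in> M"
    using hash by (auto simp: universal_hash_def)
  have "trace_norm (card M * d) (tau_ME d W L M (f s) - tensor (card M) d (uniform_op M) (tau_E d W L M (f s)))
      = (\<Sum>m\<in>M. trace_norm d (dev_mat d W L M (f s) m))" if s: "s \<in> S" for s
  proof -
    have "M \<noteq> {}" using L in_M[OF s] by auto
    then have nz: "card M \<noteq> 0" "card L \<noteq> 0" using fin L by auto
    define g where "g m = complex_of_real (1 / real (card M)) \<cdot>\<^sub>m
       (complex_of_real (1 / (real (card L) / real (card M))) \<cdot>\<^sub>m msum d {l\<in>L. f s l = m} W)" for m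
    have gc: "g m \<in> carrier_mat d d" for m by (simp add: g_def msum_def)
    have gi: "g m $$ (i,j) = 1 / of_nat (card L) * (\<Sum>l\<in>{l\<in>L. f s l = m}. W l $$ (i,j))" if "i < d" "j < d" for m i j
      using that nz by (simp add: g_def msum_def)
    have tau: "tau_ME d W L M (f s) = cq M d g"
      unfolding tau_ME_def g_def ..
    have tE: "tau_E d W L M (f s) = msum d M g"
      unfolding tau_E_def tau ptrace1_cq[OF fin(2)] ..
    have mc: "msum d M g \<in> carrier_mat d d" by (simp add: msum_def)
    have "tau_ME d W L M (f s) - tensor (card M) d (uniform_op M) (tau_E d W L M (f s))
       = cq M d (\<lambda>m. g m - complex_of_real (1 / real (card M)) \<cdot>\<^sub>m msum d M g)"
      unfolding tE tau tensor_uniform[OF fin(2) mc] using fin gc mc by (intro cq_minus) auto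
    also have "\<dots> = cq M d (dev_mat d W L M (f s))"
    proof (rule cq_cong[OF fin(2)])
      fix m assume "m \<in> M"
      show "g m - complex_of_real (1 / real (card M)) \<cdot>\<^sub>m msum d M g = dev_mat d W L M (f s) m"
      proof (rule eq_matI)
        fix i j assume "i < dim_row (dev_mat d W L M (f s) m)" "j < dim_col (dev_mat d W L M (f s) m)"
        then have ij: "i < d" "j < d" by (auto simp: dev_mat_def)
        have "(\<Sum>m\<in>M. g m $$ (i,j)) = 1 / of_nat (card L) * (\<Sum>m\<in>M. \<Sum>l\<in>{l\<in>L. f s l = m}. W l $$ (i,j))"
          unfolding gi[OF ij] sum_distrib_left ..
        also have "(\<Sum>m\<in>M. \<Sum>l\<in>{l\<in>L. f s l = m}. W l $$ (i,j)) = (\<Sum>l\<in>L. W l $$ (i,j))"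
          using fin in_M[OF s] by (intro sum_fibre_all)
        finally have "(g m - complex_of_real (1 / real (card M)) \<cdot>\<^sub>m msum d M g) $$ (i,j)
          = 1 / of_nat (card L) * (\<Sum>l\<in>{l\<in>L. f s l = m}. W l $$ (i,j)) - 1 / of_nat (card M) * (1 / of_nat (card L) * (\<Sum>l\<in>L. W l $$ (i,j)))"
          using ij gc[of m] mc gi[OF ij, of m] by (simp add: msum_def)
        also have "\<dots> = dev_mat d W L M (f s) m $$ (i,j)"
          using ij by (simp add: dev_mat_def deviation_def sum_divide_distrib)
        finally show "(g m - complex_of_real (1 / real (card M)) \<cdot>\<^sub>m msum d M g) $$ (i,j) = dev_mat d W L M (f s) m $$ (i,j)" .
      qed (auto simp: dev_mat_def msum_def)
    qed
    finally show ?thesis using fin by (simp add: trace_norm_cq dev_mat_def)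
  qed
  then show ?thesis unfolding dbar_def by simp
qed

text \<open>The factorisation of W l / |L| identifies it with A_l(\<theta>) in the basis U: the
  condition on p makes the exponent of X_l at z = \<theta> equal to 1, so X_l itself appears between
  the two powers of the reference operator.\<close>

theorem dbar_le:
  assumes hash: "universal_hash S f L M" and L: "L \<noteq> {}"
    and U: "unitary d U" and s: "\<And>i. i < d \<Longrightarrow> s i \<ge> 0" "(\<Sum>i<d. s i) = \<tau>" "\<tau> > 0"
    and R: "\<And>l. l \<in> L \<Longrightarrow> unitary d (R l)" and \<kappa>: "\<And>l k. l \<in> L \<Longrightarrow> k < d \<Longrightarrow> \<kappa> l k \<ge> 0"
    and W: "\<And>l. l \<in> L \<Longrightarrow> complex_of_real (1 / real (card L)) \<cdot>\<^sub>m W l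
        = U * (rdiag d (\<lambda>i. s i powr (\<theta> / 4)) * (R l * rdiag d (\<kappa> l) * adj (R l)) * rdiag d (\<lambda>i. s i powr (\<theta> / 4))) * adj U"
    and Wc: "\<And>l. l \<in> L \<Longrightarrow> W l \<in> carrier_mat d d"
    and \<theta>: "0 \<le> \<theta>" "\<theta> \<le> 1" and p: "p * (1 - \<theta> / 2) = 1"
  shows "dbar d W L M S f
    \<le> 2 powr (1 - \<theta>) * (real (card M) * \<tau>) powr (\<theta> / 2) * (\<Sum>l\<in>L. \<Sum>k<d. \<kappa> l k powr p) powr (1 - \<theta> / 2)"
proof -
  have fin: "finite S" "S \<noteq> {}" "finite L" "finite M" and in_M: "\<And>s l. s \<in> S \<Longrightarrow> l \<in> L \<Longrightarrow> f s l \<in> M"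
    and coll: "\<And>l l'. l \<in> L \<Longrightarrow> l' \<in> L \<Longrightarrow> l \<noteq> l' \<Longrightarrow> collision_prob S f l l' \<le> 1 / real (card M)"
    using hash by (auto simp: universal_hash_def collision_prob_def)
  have M: "M \<noteq> {}" using L fin in_M by blast
  have ex: "\<exists>V. contraction d V \<and> trace_norm d (dev_mat d W L M (f s) m)
      = Re (\<Sum>i<d. \<Sum>j<d. V j i * dev_mat d W L M (f s) m $$ (i,j))" for s m
    by (rule trace_norm_attained) (simp add: dev_mat_def)
  \<comment> \<open>One optimal test operator per seed and message, fixed before interpolation so
    that it does not depend on z.\<close>
  define V where "V s m = (SOME V. contraction d V \<and> trace_norm d (dev_mat d W L M (f s) m)
      = Re (\<Sum>i<d. \<Sum>j<d. V j i * dev_mat d W L M (f s) m $$ (i,j)))" for s m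
  have V: "contraction d (V s m)"
    and tn: "trace_norm d (dev_mat d W L M (f s) m) = Re (\<Sum>i<d. \<Sum>j<d. V s m j i * dev_mat d W L M (f s) m $$ (i,j))" for s m
    using someI_ex[OF ex[of s m]] unfolding V_def by (rule conjunct1, rule conjunct2)
  define V' where "V' s m b a = (\<Sum>j<d. \<Sum>i<d. cnj (U $$ (j,b)) * V s m j i * U $$ (i,a))" for s m b a
  \<comment> \<open>The locale asks for nonnegativity at every index, while s and \<kappa> are
    controlled only below d and on L; outside they are replaced by 0.\<close>
  define \<sigma> where "\<sigma> i = (if i < d then s i else 0)" for i
  define \<kappa>' where "\<kappa>' l k = (if l \<in> L \<and> k < d then \<kappa> l k else 0)" for l k
  define u where "u l i k = R l $$ (i,k)" for l i k
  interpret H: hashed_ensemble S f L M d \<sigma> \<kappa>' u V' p \<tau>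
  proof
    show "contraction d (V' s m)" for s m
      unfolding V'_def using contraction_unitary_conj[OF V U] .
    show "(\<Sum>i<d. u l i k * cnj (u l i k')) = of_bool (k = k')" if "l \<in> L" "k < d" "k' < d" for l k k'
      using unitary_columns[OF R[OF that(1)] that(3,2)] by (auto simp: u_def mult.commute)
  qed (use fin M in_M coll s \<kappa> in \<open>auto simp: \<sigma>_def \<kappa>'_def\<close>)
  note Uc = unitaryD(1)[OF U]
  have A: "1 / of_nat (card L) * W l $$ (i,j) = (\<Sum>a<d. \<Sum>b<d. U $$ (i,a) * cnj (U $$ (j,b)) * H.A \<theta> l a b)"
    if l: "l \<in> L" and ij: "i < d" "j < d" for l i j
  proof -
    note Rc = unitaryD(1)[OF R[OF l]]
    let ?Y = "R l * rdiag d (\<kappa> l) * adj (R l)"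
    let ?B = "rdiag d (\<lambda>i. s i powr (\<theta> / 4)) * ?Y * rdiag d (\<lambda>i. s i powr (\<theta> / 4))"
    have Yc: "?Y \<in> carrier_mat d d" using Rc by (simp add: mult_carrier_mat[of _ d d _ d])
    then have Bc: "?B \<in> carrier_mat d d" by (simp add: mult_carrier_mat[of _ d d _ d])
    have B: "?B $$ (a,b) = H.A \<theta> l a b" if ab: "a < d" "b < d" for a b
    proof -
      have "H.Z (complex_of_real p * (1 - complex_of_real \<theta> / 2)) l a b = ?Y $$ (a,b)"
      proof -
        have "complex_of_real p * (1 - complex_of_real \<theta> / 2) = complex_of_real (p * (1 - \<theta> / 2))" by simp
        also have "\<dots> = complex_of_real 1" unfolding p ..
        finally have e: "complex_of_real p * (1 - complex_of_real \<theta> / 2) = complex_of_real 1" .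
        show ?thesis
          unfolding H.Z_def e conj_rdiag_index[OF Rc ab]
          using \<kappa>[OF l] l by (intro sum.cong refl) (auto simp: spow_of_real \<kappa>'_def u_def simp del: of_real_1)
      qed
      moreover have "spow (\<sigma> i) (complex_of_real \<theta> / 4) = complex_of_real (s i powr (\<theta> / 4))" if "i < d" for i
        using spow_of_real[OF s(1)[OF that], of "\<theta> / 4"] that by (simp add: \<sigma>_def)
      ultimately show ?thesis
        unfolding sandwich_rdiag_index[OF Yc ab] H.A_def using ab by simp
    qed
    have "1 / of_nat (card L) * W l $$ (i,j) = (complex_of_real (1 / real (card L)) \<cdot>\<^sub>m W l) $$ (i,j)"
      using ij Wc[OF l] by simp
    also have "\<dots> = (\<Sum>a<d. \<Sum>b<d. U $$ (i,a) * ?B $$ (a,b) * cnj (U $$ (j,b)))"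
      unfolding W[OF l] by (rule conj_index[OF Uc Bc ij])
    also have "\<dots> = (\<Sum>a<d. \<Sum>b<d. U $$ (i,a) * cnj (U $$ (j,b)) * H.A \<theta> l a b)"
      using B by (intro sum.cong refl) simp
    finally show ?thesis .
  qed
  have pair: "(\<Sum>i<d. \<Sum>j<d. V s m j i * dev_mat d W L M (f s) m $$ (i,j))
      = (\<Sum>a<d. \<Sum>b<d. V' s m b a * deviation L M (f s) m (\<lambda>l. H.A \<theta> l a b))" for s m
  proof -
    let ?D = "\<lambda>a b. deviation L M (f s) m (\<lambda>l. H.A \<theta> l a b)"
    let ?t = "\<lambda>i j a b. cnj (U $$ (j,b)) * V s m j i * U $$ (i,a) * ?D a b"
    have "(\<Sum>i<d. \<Sum>j<d. V s m j i * dev_mat d W L M (f s) m $$ (i,j)) = (\<Sum>i<d. \<Sum>j<d. \<Sum>a<d. \<Sum>b<d. ?t i j a b)"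
    proof (rule sum.cong[OF refl], rule sum.cong[OF refl])
      fix i j assume "i \<in> {..<d}" "j \<in> {..<d}"
      then have ij: "i < d" "j < d" by auto
      have "dev_mat d W L M (f s) m $$ (i,j) = deviation L M (f s) m (\<lambda>l. \<Sum>a<d. \<Sum>b<d. U $$ (i,a) * cnj (U $$ (j,b)) * H.A \<theta> l a b)"
        using ij by (simp add: dev_mat_def) (rule deviation_cong, use A[OF _ ij] in simp)
      also have "\<dots> = (\<Sum>a<d. \<Sum>b<d. U $$ (i,a) * cnj (U $$ (j,b)) * ?D a b)"
        unfolding deviation_sum deviation_scale ..
      finally show "V s m j i * dev_mat d W L M (f s) m $$ (i,j) = (\<Sum>a<d. \<Sum>b<d. ?t i j a b)"
        by (simp add: sum_distrib_left mult_ac)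
    qed
    also have "\<dots> = (\<Sum>i<d. \<Sum>a<d. \<Sum>j<d. \<Sum>b<d. ?t i j a b)"
      by (rule sum.cong[OF refl], rule sum.swap)
    also have "\<dots> = (\<Sum>a<d. \<Sum>i<d. \<Sum>j<d. \<Sum>b<d. ?t i j a b)"
      by (rule sum.swap)
    also have "\<dots> = (\<Sum>a<d. \<Sum>i<d. \<Sum>b<d. \<Sum>j<d. ?t i j a b)"
      by (rule sum.cong[OF refl], rule sum.cong[OF refl], rule sum.swap)
    also have "\<dots> = (\<Sum>a<d. \<Sum>b<d. \<Sum>i<d. \<Sum>j<d. ?t i j a b)"
      by (rule sum.cong[OF refl], rule sum.swap)
    also have "\<dots> = (\<Sum>a<d. \<Sum>b<d. \<Sum>j<d. \<Sum>i<d. ?t i j a b)"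
      by (rule sum.cong[OF refl], rule sum.cong[OF refl], rule sum.swap)
    also have "\<dots> = (\<Sum>a<d. \<Sum>b<d. V' s m b a * ?D a b)"
      unfolding V'_def sum_distrib_right ..
    finally show ?thesis .
  qed
  have "dbar d W L M S f = Re (H.F \<theta>)"
    unfolding dbar_eq_sum_trace_norm[OF hash L] tn pair H.F_def by simp
  also have "\<dots> \<le> cmod (H.F \<theta>)" by (rule complex_Re_le_cmod)
  also have "\<dots> \<le> 2 powr (1 - \<theta>) * (real (card M) * \<tau>) powr (\<theta> / 2) * H.mass powr (1 - \<theta> / 2)"
    by (rule H.interpolated_bound[OF \<theta>])
  also have "H.mass = (\<Sum>l\<in>L. \<Sum>k<d. \<kappa> l k powr p)"
    by (simp add: H.mass_def \<kappa>'_def)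
  finally show ?thesis .
qed

section \<open>Positive semidefinite matrices, their powers and supports\<close>

lemma mult_mat_vec_index_sum:
  "A \<in> carrier_mat n m \<Longrightarrow> v \<in> carrier_vec m \<Longrightarrow> i < n \<Longrightarrow> (A *\<^sub>v v) $ i = (\<Sum>a<m. A $$ (i,a) * v $ a)"
  by (auto simp: scalar_prod_def atLeast0LessThan)

lemma mtrace_smult: "A \<in> carrier_mat d d \<Longrightarrow> mtrace (c \<cdot>\<^sub>m A) = c * mtrace A"
  by (simp add: mtrace_def sum_distrib_left)

lemma psd_carrier: "psd d A \<Longrightarrow> A \<in> carrier_mat d d"
  by (simp add: psd_def hermitian_def)

lemma density_dim_pos: "density d A \<Longrightarrow> d > 0"
  using psd_carrier[of d A] by (cases "d = 0") (auto simp: density_def mtrace_def)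

lemma psd_conj:
  assumes A: "psd d A" and C: "C \<in> carrier_mat d d"
  shows "psd d (adj C * A * C)"
proof -
  have Ac: "A \<in> carrier_mat d d" and Ah: "adj A = A" using A by (auto simp: psd_def hermitian_def)
  have AC: "A * C \<in> carrier_mat d d" using Ac C by simp
  have eq: "adj C * A * C = adj C * (A * C)" using Ac C by (intro assoc_mult_mat) auto
  have h: "hermitian d (adj C * A * C)"
    unfolding eq hermitian_def using Ac C AC
    by (auto simp: adj_mult[OF adj_carrier[OF C] AC] adj_mult[OF Ac C] Ah intro!: assoc_mult_mat)
  moreover have "0 \<le> Re (\<Sum>i<d. cnj (v $ i) * (adj C * A * C *\<^sub>v v) $ i)" if v: "v \<in> carrier_vec d" for v
  proof -
    let ?w = "C *\<^sub>v v"
    have wc: "?w \<in> carrier_vec d" using C v by simp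
    have Aw: "A *\<^sub>v ?w \<in> carrier_vec d" using Ac wc by simp
    have "adj C * A * C *\<^sub>v v = adj C *\<^sub>v (A *\<^sub>v ?w)"
      unfolding eq using Ac C AC v by (simp add: assoc_mult_mat_vec[of _ d d _ d])
    then have "(\<Sum>i<d. cnj (v $ i) * (adj C * A * C *\<^sub>v v) $ i) = (\<Sum>i<d. cnj (v $ i) * (\<Sum>j<d. cnj (C $$ (j,i)) * (A *\<^sub>v ?w) $ j))"
    proof (intro sum.cong refl)
      fix i assume i: "i \<in> {..<d}"
      have "(adj C *\<^sub>v (A *\<^sub>v ?w)) $ i = (\<Sum>j<d. cnj (C $$ (j,i)) * (A *\<^sub>v ?w) $ j)"
        using mult_mat_vec_index_sum[OF adj_carrier[OF C] Aw, of i] i C by (auto intro!: sum.cong simp del: index_mult_mat_vec)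
      then show "cnj (v $ i) * (adj C * A * C *\<^sub>v v) $ i = cnj (v $ i) * (\<Sum>j<d. cnj (C $$ (j,i)) * (A *\<^sub>v ?w) $ j)"
        if "adj C * A * C *\<^sub>v v = adj C *\<^sub>v (A *\<^sub>v ?w)" using that by simp
    qed
    also have "\<dots> = (\<Sum>j<d. \<Sum>i<d. cnj (C $$ (j,i) * v $ i) * (A *\<^sub>v ?w) $ j)"
      unfolding sum_distrib_left by (subst sum.swap) (simp only: complex_cnj_mult mult_ac)
    also have "\<dots> = (\<Sum>j<d. cnj (?w $ j) * (A *\<^sub>v ?w) $ j)"
      unfolding sum_distrib_right[symmetric] cnj_sum[symmetric]
      using mult_mat_vec_index_sum[OF C v] by (intro sum.cong refl) (simp del: index_mult_mat_vec cnj_sum)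
    finally show ?thesis using A wc by (simp add: psd_def)
  qed
  ultimately show ?thesis by (simp add: psd_def)
qed

lemma psd_smult:
  assumes A: "psd d A" and c: "c \<ge> 0"
  shows "psd d (complex_of_real c \<cdot>\<^sub>m A)"
proof -
  have Ac: "A \<in> carrier_mat d d" and Ah: "adj A = A" using A by (auto simp: psd_def hermitian_def)
  have "adj (complex_of_real c \<cdot>\<^sub>m A) = complex_of_real c \<cdot>\<^sub>m adj A"
    by (rule eq_matI) auto
  moreover have "0 \<le> Re (\<Sum>i<d. cnj (v $ i) * ((complex_of_real c \<cdot>\<^sub>m A) *\<^sub>v v) $ i)" if v: "v \<in> carrier_vec d" for v
  proof -
    have "(\<Sum>i<d. cnj (v $ i) * ((complex_of_real c \<cdot>\<^sub>m A) *\<^sub>v v) $ i) = complex_of_real c * (\<Sum>i<d. cnj (v $ i) * (A *\<^sub>v v) $ i)"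
      using Ac v by (simp add: scalar_prod_def sum_distrib_left mult_ac)
    moreover have "0 \<le> Re (\<Sum>i<d. cnj (v $ i) * (A *\<^sub>v v) $ i)" using A v unfolding psd_def by blast
    ultimately show ?thesis using c by (simp only: Re_complex_of_real Im_complex_of_real times_complex.sel) simp
  qed
  ultimately show ?thesis using Ac Ah by (simp add: psd_def hermitian_def)
qed

lemma psd_rdiagD:
  assumes "psd d (rdiag d e)" and k: "k < d" shows "e k \<ge> 0"
proof -
  have "(\<Sum>i<d. cnj (unit_vec d k $ i) * (rdiag d e *\<^sub>v unit_vec d k) $ i) = (\<Sum>i<d. if i = k then complex_of_real (e k) else 0)"
    using k by (intro sum.cong) auto
  then have "Re (\<Sum>i<d. cnj (unit_vec d k $ i) * (rdiag d e *\<^sub>v unit_vec d k) $ i) = e k" using k by simp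
  moreover have "0 \<le> Re (\<Sum>i<d. cnj (unit_vec d k $ i) * (rdiag d e *\<^sub>v unit_vec d k) $ i)"
    using assms(1) unit_vec_carrier unfolding psd_def by blast
  ultimately show ?thesis by simp
qed

lemma unconj_unitary:
  assumes "unitary d U" "B \<in> carrier_mat d d"
  shows "adj U * (U * B * adj U) * U = B"
  using assms unitaryD[OF assms(1)] by (simp add: assoc_square[where d = d] unitary_cancel[OF assms(1), of _ d])

lemma conj_unconj_unitary:
  assumes "unitary d U" "B \<in> carrier_mat d d"
  shows "U * (adj U * B * U) * adj U = B"
  using assms unitaryD[OF assms(1)] by (simp add: assoc_square[where d = d] unitary_cancel[OF assms(1), of _ d])

theorem psd_spectral:
  assumes A: "psd d A"
  obtains U ev where "unitary d U" "A = U * rdiag d ev * adj U" "\<And>k. k < d \<Longrightarrow> ev k \<ge> 0"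
proof -
  have "hermitian d A" using A by (simp add: psd_def)
  then obtain U ev where U: "unitary d U" and eq: "A = U * rdiag d ev * adj U"
    using spectral_theorem by blast
  have "psd d (adj U * A * U)" using psd_conj[OF A unitaryD(1)[OF U]] .
  then have "psd d (rdiag d ev)" unfolding eq unconj_unitary[OF U rdiag_carrier] .
  then show thesis using that[OF U eq] psd_rdiagD by blast
qed

lemma mtrace_conj_rdiag:
  assumes "unitary d U" shows "mtrace (U * rdiag d e * adj U) = complex_of_real (\<Sum>k<d. e k)"
proof -
  note c = unitaryD[OF assms]
  have "mtrace (U * rdiag d e * adj U) = mtrace (adj U * (U * rdiag d e))"
    using c by (intro mtrace_comm[of _ d]) auto
  also have "adj U * (U * rdiag d e) = rdiag d e" by (rule unitary_cancel(1)[OF assms rdiag_carrier])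
  finally show ?thesis by (simp add: mtrace_def)
qed

lemma mpow_eq:
  assumes U: "unitary d U" and A: "A = U * rdiag d ev * adj U" and ev: "\<And>k. k < d \<Longrightarrow> ev k \<ge> 0"
  shows "mpow d A a = U * rdiag d (\<lambda>k. ev k powr a) * adj U"
proof -
  \<comment> \<open>The guard of \<open>mpow\<close> agrees with \<open>powr\<close> on nonnegative
    eigenvalues, because \<open>0 powr a = 0\<close> for every a, negative ones included.\<close>
  have "rdiag d (\<lambda>k. if ev k > 0 then ev k powr a else 0) = rdiag d (\<lambda>k. ev k powr a)"
    using ev by (intro rdiag_cong) (auto simp: not_less antisym)
  then show ?thesis unfolding mpow_def mat_fun_eq[OF U A] by simp
qed

lemma mpow_cq:
  assumes "finite A" "\<And>a. a \<in> A \<Longrightarrow> hermitian d (g a)"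
  shows "mpow (card A * d) (cq A d g) r = cq A d (\<lambda>a. mpow d (g a) r)"
  unfolding mpow_def using assms by (rule mat_fun_cq)

lemma mpow_carrier: "hermitian d A \<Longrightarrow> mpow d A r \<in> carrier_mat d d"
  unfolding mpow_def by (rule mat_fun_carrier)

text \<open>The j-th column of U is an eigenvector of the reference operator for the eigenvalue 0,
  so B annihilates it. In the eigenbasis this says that column j of B vanishes.\<close>

lemma supp_le_conj_zero:
  assumes U: "unitary d U" and B: "B \<in> carrier_mat d d" and le: "supp_le d B (U * rdiag d s * adj U)"
    and ij: "i < d" "j < d" and z: "s j = 0"
  shows "(adj U * B * U) $$ (i,j) = 0"
proof -
  note c = unitaryD[OF U]
  note av = assoc_mult_mat_vec[of _ d d _ d]
  let ?e = "unit_vec d j :: complex vec"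
  let ?v = "U *\<^sub>v ?e"
  have vc: "?v \<in> carrier_vec d" using c by simp
  have de: "rdiag d s *\<^sub>v ?e = 0\<^sub>v d" using ij z by (intro eq_vecI) auto
  have cancel: "adj U *\<^sub>v ?v = ?e"
    using assoc_mult_mat_vec[OF c(2) c(1), of ?e] c(4) by simp
  have "(U * rdiag d s * adj U) *\<^sub>v ?v = U *\<^sub>v (rdiag d s *\<^sub>v (adj U *\<^sub>v ?v))"
    using c vc by (simp add: av mult_carrier_mat[of _ d d _ d] mult_mat_vec_carrier[of _ d d])
  also have "\<dots> = U *\<^sub>v 0\<^sub>v d" unfolding cancel de ..
  also have "\<dots> = 0\<^sub>v d" using c by (intro eq_vecI) (auto simp: scalar_prod_def)
  finally have "B *\<^sub>v ?v = 0\<^sub>v d" using le vc by (simp add: supp_le_def)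
  then have "(adj U * B * U) *\<^sub>v ?e = adj U *\<^sub>v 0\<^sub>v d"
    using c B by (simp add: av mult_carrier_mat[of _ d d _ d])
  then have "((adj U * B * U) *\<^sub>v ?e) $ i = 0"
    using c ij by (simp add: scalar_prod_def)
  moreover have "((adj U * B * U) *\<^sub>v ?e) $ i = (adj U * B * U) $$ (i,j)"
  proof -
    have "adj U * B * U \<in> carrier_mat d d" using c B by (simp add: mult_carrier_mat[of _ d d _ d])
    then have "((adj U * B * U) *\<^sub>v ?e) $ i = (\<Sum>k<d. (adj U * B * U) $$ (i,k) * ?e $ k)"
      using ij by (intro mult_mat_vec_index_sum) auto
    also have "\<dots> = (\<Sum>k<d. if k = j then (adj U * B * U) $$ (i,k) else 0)"
      using ij by (intro sum.cong) (auto simp del: index_mult_mat(1))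
    finally show ?thesis using ij by simp
  qed
  ultimately show ?thesis by simp
qed

section \<open>From the sandwiched divergence to the distance bound\<close>

lemma tensor_marginal:
  assumes fin: "finite L" and W: "\<And>l. l \<in> L \<Longrightarrow> density d (W l)" and B: "B \<in> carrier_mat d d"
  shows "tensor (card L) d (ptrace2 (card L) d (cq_uniform d W L)) B
    = cq L d (\<lambda>_. complex_of_real (1 / real (card L)) \<cdot>\<^sub>m B)"
proof -
  have Wc: "W l \<in> carrier_mat d d" if "l \<in> L" for l
    using W[OF that] by (simp add: density_def psd_carrier)
  have "mtrace (complex_of_real (1 / real (card L)) \<cdot>\<^sub>m W l) = 1 / real (card L)" if "l \<in> L" for l
    using mtrace_smult[OF Wc[OF that], of "complex_of_real (1 / real (card L))"] W[OF that]
    by (simp add: density_def)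
  then have "ptrace2 (card L) d (cq_uniform d W L) = uniform_op L"
    unfolding cq_uniform_def using fin Wc by (intro ptrace2_cq) auto
  then show ?thesis using tensor_uniform[OF fin B] by simp
qed

text \<open>Apply \<open>dbar_le\<close> with p = 1+t and \<theta> = 2t/(1+t), so that \<theta>/4 is
  the exponent t/(2(1+t)) of the sandwich. X_l is then the l-th block sandwiched with negative
  powers of the reference operator, and Q is the sum of its eigenvalues raised to 1+t. The support
  condition ensures that multiplying by the positive powers recovers W l / |L|.\<close>

theorem dbar_le_sandwiched:
  assumes hash: "universal_hash S f L M" and L: "L \<noteq> {}"
    and W: "\<And>l. l \<in> L \<Longrightarrow> density d (W l)" and \<sigma>: "density d \<sigma>"
    and supp: "supp_le (card L * d) (cq_uniform d W L) (tensor (card L) d (ptrace2 (card L) d (cq_uniform d W L)) \<sigma>)"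
    and t: "0 < t" "t \<le> 1"
  defines "P \<equiv> mpow (card L * d) (tensor (card L) d (ptrace2 (card L) d (cq_uniform d W L)) \<sigma>) (- t / (2 * (1 + t)))"
  defines "Q \<equiv> Re (mtrace (mpow (card L * d) (P * cq_uniform d W L * P) (1 + t)))"
  shows "0 \<le> Q"
    and "dbar d W L M S f \<le> 2 powr ((1 - t) / (1 + t)) * (real (card M) / real (card L)) powr (t / (1 + t)) * Q powr (1 / (1 + t))"
proof -
  have fin: "finite L" using hash by (simp add: universal_hash_def)
  let ?n = "real (card L)"
  have n: "?n > 0" using fin L by (simp add: card_gt_0_iff)
  let ?\<alpha> = "t / (2 * (1 + t))"
  define W' where "W' l = complex_of_real (1 / ?n) \<cdot>\<^sub>m W l" for l
  have W'psd: "psd d (W' l)" if "l \<in> L" for l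
    unfolding W'_def using W[OF that] n by (intro psd_smult) (auto simp: density_def)
  have W'c: "W' l \<in> carrier_mat d d" if "l \<in> L" for l using psd_carrier[OF W'psd[OF that]] .
  have \<rho>: "cq_uniform d W L = cq L d W'"
    unfolding cq_uniform_def by (rule cq_cong[OF fin]) (simp only: W'_def)
  have trW: "mtrace (W' l) = 1 / ?n" if "l \<in> L" for l
  proof -
    have "mtrace (W' l) = complex_of_real (1 / ?n) * mtrace (W l)"
      unfolding W'_def using psd_carrier[of d "W l"] W[OF that] by (intro mtrace_smult) (auto simp: density_def)
    then show ?thesis using W[OF that] by (simp add: density_def)
  qed
  \<comment> \<open>The weight 1/|L| of the uniform marginal is absorbed into each block, which
    makes the trace \<tau> of the reference operator 1/|L|.\<close>
  define \<sigma>' where "\<sigma>' = complex_of_real (1 / ?n) \<cdot>\<^sub>m \<sigma>"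
  have \<sigma>'psd: "psd d \<sigma>'" unfolding \<sigma>'_def using \<sigma> n by (intro psd_smult) (auto simp: density_def)
  have \<sigma>'c: "\<sigma>' \<in> carrier_mat d d" using psd_carrier[OF \<sigma>'psd] .
  have tens: "tensor (card L) d (ptrace2 (card L) d (cq_uniform d W L)) \<sigma> = cq L d (\<lambda>_. \<sigma>')"
    unfolding \<sigma>'_def using fin W \<sigma> by (intro tensor_marginal) (auto simp: density_def psd_carrier)
  obtain U s where U: "unitary d U" and \<sigma>'U: "\<sigma>' = U * rdiag d s * adj U" and s: "\<And>k. k < d \<Longrightarrow> s k \<ge> 0"
    using psd_spectral[OF \<sigma>'psd] by blast
  note c = unitaryD[OF U]
  have s_sum: "(\<Sum>k<d. s k) = 1 / ?n"
  proof -
    have "complex_of_real (\<Sum>k<d. s k) = mtrace \<sigma>'" unfolding \<sigma>'U mtrace_conj_rdiag[OF U] ..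
    also have "\<dots> = complex_of_real (1 / ?n) * mtrace \<sigma>"
      unfolding \<sigma>'_def using psd_carrier[of d \<sigma>] \<sigma> by (intro mtrace_smult) (auto simp: density_def)
    also have "\<dots> = complex_of_real (1 / ?n)" using \<sigma> by (simp add: density_def)
    finally show ?thesis by (simp only: of_real_eq_iff)
  qed
  define g where "g k = s k powr (- ?\<alpha>)" for k
  define G where "G = U * rdiag d g * adj U"
  have Gc: "G \<in> carrier_mat d d" unfolding G_def using c by (simp add: mult_carrier_mat[of _ d d _ d])
  have mp: "mpow d \<sigma>' (- t / (2 * (1 + t))) = G"
    unfolding G_def g_def using mpow_eq[OF U \<sigma>'U s] by simp
  have P: "P = cq L d (\<lambda>_. G)"
  proof -
    have "hermitian d \<sigma>'" using \<sigma>'psd by (simp add: psd_def)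
    then have "mpow (card L * d) (cq L d (\<lambda>_. \<sigma>')) r = cq L d (\<lambda>_. mpow d \<sigma>' r)" for r
      using fin by (intro mpow_cq)
    then show ?thesis unfolding P_def tens mp[symmetric] .
  qed
  \<comment> \<open>This is X_l written in the eigenbasis of the reference operator, in the form
    C^dagger W C that makes its positivity immediate.\<close>
  define Y where "Y l = adj (U * rdiag d g) * W' l * (U * rdiag d g)" for l
  have Ypsd: "psd d (Y l)" if "l \<in> L" for l
    unfolding Y_def using c by (intro psd_conj W'psd that) (simp add: mult_carrier_mat[of _ d d _ d])
  have "\<forall>l\<in>L. \<exists>R ev. unitary d R \<and> Y l = R * rdiag d ev * adj R \<and> (\<forall>k<d. ev k \<ge> 0)"
    using psd_spectral[OF Ypsd] by metis
  then obtain R \<kappa> where R: "\<And>l. l \<in> L \<Longrightarrow> unitary d (R l)" and YR: "\<And>l. l \<in> L \<Longrightarrow> Y l = R l * rdiag d (\<kappa> l) * adj (R l)"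
    and \<kappa>: "\<And>l k. l \<in> L \<Longrightarrow> k < d \<Longrightarrow> \<kappa> l k \<ge> 0"
    by metis
  \<comment> \<open>The sandwiched block is unitarily equivalent to Y l, so the \<kappa> are its
    eigenvalues and its power 1+t can be read off.\<close>
  have GWG: "G * W' l * G = (U * R l) * rdiag d (\<kappa> l) * adj (U * R l)" if l: "l \<in> L" for l
  proof -
    note r = unitaryD[OF R[OF l]]
    have "adj (U * rdiag d g) = rdiag d g * adj U"
      using c by (simp add: adj_mult[OF c(1) rdiag_carrier])
    then have "U * Y l * adj U = G * W' l * G"
      unfolding Y_def G_def using c W'c[OF l] by (simp add: assoc_square[where d = d])
    moreover have "U * Y l * adj U = (U * R l) * rdiag d (\<kappa> l) * adj (U * R l)"
      unfolding YR[OF l] using c r by (simp add: assoc_square[where d = d] adj_mult[OF c(1) r(1)])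
    ultimately show ?thesis by simp
  qed
  have UR: "unitary d (U * R l)" if l: "l \<in> L" for l
  proof -
    note r = unitaryD[OF R[OF l]]
    show ?thesis
      unfolding unitary_def using c r
      by (simp add: assoc_square[where d = d] adj_mult[OF c(1) r(1)]
          unitary_cancel[OF U, of _ d] unitary_cancel[OF R[OF l], of _ d])
  qed
  have herm: "hermitian d (G * W' l * G)" if l: "l \<in> L" for l
  proof -
    have "adj G = G" unfolding G_def using c by (simp add: adj_mult[of _ d d _ d] mult_carrier_mat[of _ d d _ d] assoc_square[where d = d])
    then show ?thesis using psd_conj[OF W'psd[OF l] Gc] by (simp add: psd_def)
  qed
  have "P * cq_uniform d W L * P = cq L d (\<lambda>l. G * W' l * G)"
    unfolding P \<rho> using fin Gc W'c by (simp add: cq_mult mult_carrier_mat[of _ d d _ d])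
  then have "mtrace (mpow (card L * d) (P * cq_uniform d W L * P) (1 + t)) = (\<Sum>l\<in>L. mtrace (mpow d (G * W' l * G) (1 + t)))"
    using fin herm by (simp add: mpow_cq cq_mtrace mpow_carrier)
  also have "\<dots> = (\<Sum>l\<in>L. complex_of_real (\<Sum>k<d. \<kappa> l k powr (1 + t)))"
    using mpow_eq[OF UR GWG \<kappa>] mtrace_conj_rdiag[OF UR] by (intro sum.cong) auto
  finally have Q: "Q = (\<Sum>l\<in>L. \<Sum>k<d. \<kappa> l k powr (1 + t))"
    unfolding Q_def by simp
  then show "0 \<le> Q" by (simp add: sum_nonneg)
  let ?\<theta> = "2 * t / (1 + t)"
  have \<theta>: "?\<theta> / 4 = ?\<alpha>" "?\<theta> / 2 = t / (1 + t)" "1 - ?\<theta> = (1 - t) / (1 + t)" "1 - ?\<theta> / 2 = 1 / (1 + t)"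
    using t by (simp_all add: field_simps)
  have W_eq: "complex_of_real (1 / ?n) \<cdot>\<^sub>m W l
      = U * (rdiag d (\<lambda>i. s i powr (?\<theta> / 4)) * (R l * rdiag d (\<kappa> l) * adj (R l)) * rdiag d (\<lambda>i. s i powr (?\<theta> / 4))) * adj U"
    if l: "l \<in> L" for l
  proof -
    let ?V = "adj U * W' l * U" and ?c = "\<lambda>i. s i powr ?\<alpha>"
    have Vc: "?V \<in> carrier_mat d d" using c W'c[OF l] by (simp add: mult_carrier_mat[of _ d d _ d])
    have Yc: "Y l \<in> carrier_mat d d" using psd_carrier[OF Ypsd[OF l]] .
    have YV: "Y l = rdiag d g * ?V * rdiag d g"
      unfolding Y_def using c W'c[OF l] by (simp add: adj_mult[OF c(1) rdiag_carrier] assoc_square[where d = d])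
    have le: "supp_le d (W' l) \<sigma>'"
      by (rule supp_le_cq[OF fin _ _ supp[unfolded tens, unfolded \<rho>] l]) (use W'c \<sigma>'c in auto)
    have z: "?V $$ (i,j) = 0" if "i < d" "j < d" "s j = 0" for i j
      using supp_le_conj_zero[OF U W'c[OF l] le[unfolded \<sigma>'U] that] .
    have Vh: "adj ?V = ?V"
      using psd_conj[OF W'psd[OF l] c(1)] by (simp add: psd_def hermitian_def)
    have z': "?V $$ (i,j) = 0" if "i < d" "j < d" "s i = 0" for i j
      using z[OF that(2,1,3)] Vh Vc that by (metis adj_index carrier_matD complex_cnj_zero)
    have one: "s i powr ?\<alpha> * s i powr (- ?\<alpha>) = 1" if "i < d" "s i \<noteq> 0" for i
      using that s[of i] by (simp add: powr_add[symmetric])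
    have "rdiag d ?c * Y l * rdiag d ?c = ?V"
    proof (rule eq_matI)
      fix i j assume "i < dim_row ?V" "j < dim_col ?V"
      then have ij: "i < d" "j < d" using Vc c by auto
      have "(rdiag d ?c * Y l * rdiag d ?c) $$ (i,j) = complex_of_real ((?c i * g i) * (?c j * g j)) * ?V $$ (i,j)"
        unfolding sandwich_rdiag_index[OF Yc ij] unfolding YV sandwich_rdiag_index[OF Vc ij] by (simp add: mult_ac del: index_mult_mat(1))
      also have "\<dots> = ?V $$ (i,j)"
      \<comment> \<open>On the kernel of the reference operator the generalised inverse gives 0
        instead of 1 for the product of the powers, but there the entry of ?V vanishes: by the
        support condition for columns, and by hermiticity for rows.\<close>
      proof (cases "s i = 0 \<or> s j = 0")
        case True
        then have "?V $$ (i,j) = 0" using z z' ij by blast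
        then show ?thesis by simp
      next
        case False
        then have "(?c i * g i) * (?c j * g j) = 1" using one ij by (simp add: g_def)
        then show ?thesis by (simp del: index_mult_mat(1))
      qed
      finally show "(rdiag d ?c * Y l * rdiag d ?c) $$ (i,j) = ?V $$ (i,j)" .
    qed (use Vc c in auto)
    then show ?thesis
      unfolding \<theta>(1) YR[OF l, symmetric] using conj_unconj_unitary[OF U W'c[OF l]] by (simp add: W'_def)
  qed
  have "dbar d W L M S f \<le> 2 powr (1 - ?\<theta>) * (real (card M) * (1 / ?n)) powr (?\<theta> / 2) * (\<Sum>l\<in>L. \<Sum>k<d. \<kappa> l k powr (1 + t)) powr (1 - ?\<theta> / 2)"
  proof (rule dbar_le[OF hash L U s s_sum _ R \<kappa> W_eq])
    show "(1 + t) * (1 - ?\<theta> / 2) = 1" unfolding \<theta>(4) using t by simp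
    show "W l \<in> carrier_mat d d" if "l \<in> L" for l
      using W[OF that] psd_carrier by (auto simp: density_def)
  qed (use n t in auto)
  then show "dbar d W L M S f \<le> 2 powr ((1 - t) / (1 + t)) * (real (card M) / real (card L)) powr (t / (1 + t)) * Q powr (1 / (1 + t))"
    unfolding \<theta>(4) unfolding \<theta>(2,3) Q by simp
qed

text \<open>The endpoint t = 0, that is \<theta> = 0 and p = 1, with the identity as reference
  operator: the factorisation is trivial, the factor |M| d has exponent 0, and the mass is the total
  trace 1.\<close>

lemma dbar_le_2:
  assumes hash: "universal_hash S f L M" and L: "L \<noteq> {}" and W: "\<And>l. l \<in> L \<Longrightarrow> density d (W l)"
  shows "dbar d W L M S f \<le> 2"
proof -
  have fin: "finite L" using hash by (simp add: universal_hash_def)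
  let ?n = "real (card L)"
  have n: "?n > 0" using fin L by (simp add: card_gt_0_iff)
  define W' where "W' l = complex_of_real (1 / ?n) \<cdot>\<^sub>m W l" for l
  have W'psd: "psd d (W' l)" if "l \<in> L" for l
    unfolding W'_def using W[OF that] n by (intro psd_smult) (auto simp: density_def)
  have trW: "mtrace (W' l) = complex_of_real (1 / ?n)" if "l \<in> L" for l
  proof -
    have "mtrace (W' l) = complex_of_real (1 / ?n) * mtrace (W l)"
      unfolding W'_def using psd_carrier[of d "W l"] W[OF that] by (intro mtrace_smult) (auto simp: density_def)
    then show ?thesis using W[OF that] by (simp add: density_def)
  qed
  obtain l0 where l0: "l0 \<in> L" using L by blast
  have d: "d > 0" using density_dim_pos[OF W[OF l0]] .
  have "\<forall>l\<in>L. \<exists>R ev. unitary d R \<and> W' l = R * rdiag d ev * adj R \<and> (\<forall>k<d. ev k \<ge> 0)"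
    using psd_spectral[OF W'psd] by metis
  then obtain R \<kappa> where R: "\<And>l. l \<in> L \<Longrightarrow> unitary d (R l)" and WR: "\<And>l. l \<in> L \<Longrightarrow> W' l = R l * rdiag d (\<kappa> l) * adj (R l)"
    and \<kappa>: "\<And>l k. l \<in> L \<Longrightarrow> k < d \<Longrightarrow> \<kappa> l k \<ge> 0"
    by metis
  have one: "rdiag d (\<lambda>i. 1 powr (0 / 4)) = 1\<^sub>m d" by (rule eq_matI) auto
  have adj1: "adj (1\<^sub>m d) = 1\<^sub>m d" by (rule eq_matI) auto
  have "dbar d W L M S f \<le> 2 powr (1 - 0) * (real (card M) * real d) powr (0 / 2) * (\<Sum>l\<in>L. \<Sum>k<d. \<kappa> l k powr 1) powr (1 - 0 / 2)"
  proof (rule dbar_le[OF hash L, where U = "1\<^sub>m d" and s = "\<lambda>_. 1" and R = R])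
    show "unitary d (1\<^sub>m d)" by (simp add: unitary_def adj1)
    show "complex_of_real (1 / ?n) \<cdot>\<^sub>m W l = 1\<^sub>m d * (rdiag d (\<lambda>i. 1 powr (0 / 4)) * (R l * rdiag d (\<kappa> l) * adj (R l)) * rdiag d (\<lambda>i. 1 powr (0 / 4))) * adj (1\<^sub>m d)"
      if l: "l \<in> L" for l
      unfolding one adj1 WR[OF l, symmetric] W'_def[of l, symmetric] using psd_carrier[OF W'psd[OF l]] by simp
    show "W l \<in> carrier_mat d d" if "l \<in> L" for l
      using W[OF that] psd_carrier by (auto simp: density_def)
  qed (use d R \<kappa> in auto)
  also have "(\<Sum>l\<in>L. \<Sum>k<d. \<kappa> l k powr 1) = (\<Sum>l\<in>L. 1 / ?n)"
  proof (rule sum.cong[OF refl])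
    fix l assume l: "l \<in> L"
    have "complex_of_real (\<Sum>k<d. \<kappa> l k) = complex_of_real (1 / ?n)"
      using mtrace_conj_rdiag[OF R[OF l], of "\<kappa> l"] trW[OF l] WR[OF l] by simp
    then have "(\<Sum>k<d. \<kappa> l k) = 1 / ?n" by (simp only: of_real_eq_iff)
    then show "(\<Sum>k<d. \<kappa> l k powr 1) = 1 / ?n" using \<kappa>[OF l] by simp
  qed
  also have "\<dots> = 1" using n by simp
  also have "2 powr (1 - 0) * (real (card M) * real d) powr (0 / 2) * 1 powr (1 - 0 / 2) \<le> (2::real)"
    by simp
  finally show ?thesis .
qed

text \<open>Its full rank makes it admissible in the infimum defining \<open>I_down\<close> for any
  ensemble, so that infimum is taken over a nonempty set.\<close>

lemma maximally_mixed:
  assumes d: "d > 0"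
  shows "density d (complex_of_real (1 / real d) \<cdot>\<^sub>m 1\<^sub>m d)"
proof -
  have "hermitian d (1\<^sub>m d)" unfolding hermitian_def by (auto intro!: eq_matI)
  moreover have "0 \<le> Re (\<Sum>i<d. cnj (v $ i) * (1\<^sub>m d *\<^sub>v v) $ i)" if "v \<in> carrier_vec d" for v
    using that by (simp add: sum_nonneg)
  ultimately have "psd d (1\<^sub>m d)" by (simp add: psd_def)
  then have "psd d (complex_of_real (1 / real d) \<cdot>\<^sub>m 1\<^sub>m d)" by (rule psd_smult) simp
  moreover have "mtrace (complex_of_real (1 / real d) \<cdot>\<^sub>m 1\<^sub>m d) = 1"
    unfolding mtrace_smult[OF one_carrier_mat] using d by (simp add: mtrace_def)
  ultimately show ?thesis by (simp add: density_def)
qed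

theorem theorem1:
  fixes d :: nat and W :: "'x \<Rightarrow> complex mat" and X L :: "'x set"
    and M :: "'m set" and S :: "'s set" and f :: "'s \<Rightarrow> 'x \<Rightarrow> 'm"
  assumes "finite X" and "\<forall>x\<in>X. density d (W x)"
    and "L \<subseteq> X" and "L \<noteq> {}"
    and "universal_hash S f L M"
  shows "dbar d W L M S f \<le>
    (INF t\<in>{0..1::real}. 2 powr ((1 - t) / (1 + t)) *
       2 powr (t / (1 + t) * (- log 2 (real (card L) / real (card M))
                + I_down (card L) d t (cq_uniform d W L))))"
proof (rule cINF_greatest)
  fix t :: real assume "t \<in> {0..1}"
  then have t: "0 \<le> t" "t \<le> 1" by auto
  have W: "density d (W l)" if "l \<in> L" for l using assms(2,3) that by blast
  have fin: "finite L" "finite M" using assms(5) by (auto simp: universal_hash_def)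
  have "M \<noteq> {}" using assms(4,5) by (fastforce simp: universal_hash_def)
  then have pos: "real (card L) > 0" "real (card M) > 0" using fin assms(4) by (auto simp: card_gt_0_iff)
  let ?x = "dbar d W L M S f" and ?\<rho> = "cq_uniform d W L"
  let ?n = "card L"
  show "?x \<le> 2 powr ((1 - t) / (1 + t)) * 2 powr (t / (1 + t) * (- log 2 (real (card L) / real (card M)) + I_down ?n d t ?\<rho>))"
  \<comment> \<open>At t = 0 the divergence has the factor 0, whatever its value. Otherwise ?x must
    be positive before logarithms are taken.\<close>
  proof (cases "t = 0 \<or> ?x \<le> 0")
    case True
    then show ?thesis
    proof
      assume "t = 0"
      then show ?thesis using dbar_le_2[OF assms(5,4) W] by simp
    next
      assume "?x \<le> 0"
      then show ?thesis by (rule order.trans) simp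
    qed
  next
    case False
    then have t0: "t > 0" and x: "?x > 0" using t by auto
    let ?T = "\<lambda>\<sigma>. tensor ?n d (ptrace2 ?n d ?\<rho>) \<sigma>"
    \<comment> \<open>The claimed inequality solved for \<open>I_down\<close>. It thus suffices to
      show that ?b is a lower bound for the divergence at each admissible \<sigma>, without a
      minimiser having to exist.\<close>
    let ?b = "(1 + t) / t * (log 2 ?x - (1 - t) / (1 + t)) + log 2 (real (card L) / real (card M))"
    have "?b \<le> I_down ?n d t ?\<rho>"
      unfolding I_down_def
    proof (rule cInf_greatest)
      obtain l0 where l0: "l0 \<in> L" using assms(4) by blast
      have d: "d > 0" using density_dim_pos[OF W[OF l0]] .
      let ?\<sigma> = "complex_of_real (1 / real d) \<cdot>\<^sub>m 1\<^sub>m d"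
      let ?c = "1 / real ?n * (1 / real d)"
      have "?T ?\<sigma> = cq L d (\<lambda>_. complex_of_real (1 / real ?n) \<cdot>\<^sub>m ?\<sigma>)"
        using fin W by (intro tensor_marginal) auto
      also have "(\<lambda>_. complex_of_real (1 / real ?n) \<cdot>\<^sub>m ?\<sigma>) = (\<lambda>_. rdiag d (\<lambda>_. ?c))"
        by (intro ext eq_matI) auto
      also have "cq L d (\<lambda>_. rdiag d (\<lambda>_. ?c)) = rdiag (?n * d) (\<lambda>_. ?c)"
        using cq_rdiag[OF fin(1), of d "\<lambda>_ _. ?c"] by simp
      finally have T: "?T ?\<sigma> = rdiag (?n * d) (\<lambda>_. ?c)" .
      have "supp_le (?n * d) ?\<rho> (?T ?\<sigma>)"
        unfolding supp_le_def T
      proof (intro ballI impI)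
        fix v :: "complex vec"
        assume v: "v \<in> carrier_vec (?n * d)" and z: "rdiag (?n * d) (\<lambda>_. ?c) *\<^sub>v v = 0\<^sub>v (?n * d)"
        have "v = 0\<^sub>v (?n * d)"
        proof (rule eq_vecI)
          fix i assume "i < dim_vec (0\<^sub>v (?n * d) :: complex vec)"
          then have i: "i < ?n * d" by simp
          have "(rdiag (?n * d) (\<lambda>_. ?c) *\<^sub>v v) $ i = (\<Sum>a<?n * d. if a = i then complex_of_real ?c * v $ a else 0)"
            unfolding mult_mat_vec_index_sum[OF rdiag_carrier v i] using i by (intro sum.cong) auto
          then have "complex_of_real ?c * v $ i = 0" unfolding z using i by simp
          then show "v $ i = 0\<^sub>v (?n * d) $ i" using pos d i by simp
        qed (use v in simp)
        then show "?\<rho> *\<^sub>v v = 0\<^sub>v (?n * d)"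
          by (intro eq_vecI) (auto simp: cq_uniform_def scalar_prod_def)
      qed
      then show "{sandwiched_div (?n * d) t ?\<rho> (?T \<sigma>) |\<sigma>. density d \<sigma> \<and> supp_le (?n * d) ?\<rho> (?T \<sigma>)} \<noteq> {}"
        using maximally_mixed[OF d] by blast
    next
      fix D assume "D \<in> {sandwiched_div (?n * d) t ?\<rho> (?T \<sigma>) |\<sigma>. density d \<sigma> \<and> supp_le (?n * d) ?\<rho> (?T \<sigma>)}"
      then obtain \<sigma> where \<sigma>: "density d \<sigma>" "supp_le (?n * d) ?\<rho> (?T \<sigma>)" and D: "D = sandwiched_div (?n * d) t ?\<rho> (?T \<sigma>)"
        by blast
      define P where "P = mpow (?n * d) (?T \<sigma>) (- t / (2 * (1 + t)))"
      define Q where "Q = Re (mtrace (mpow (?n * d) (P * ?\<rho> * P) (1 + t)))"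
      have Q: "0 \<le> Q" "?x \<le> 2 powr ((1 - t) / (1 + t)) * (real (card M) / real (card L)) powr (t / (1 + t)) * Q powr (1 / (1 + t))"
        unfolding Q_def P_def using dbar_le_sandwiched[OF assms(5,4) W \<sigma> t0 t(2)] by auto
      \<comment> \<open>For Q = 0 the bound on ?x would be 0.\<close>
      have Qpos: "Q > 0" using Q x by (cases "Q = 0") auto
      have "log 2 ?x \<le> log 2 (2 powr ((1 - t) / (1 + t)) * (real (card M) / real (card L)) powr (t / (1 + t)) * Q powr (1 / (1 + t)))"
        using x Q by simp
      also have "\<dots> = (1 - t) / (1 + t) + t / (1 + t) * log 2 (real (card M) / real (card L)) + 1 / (1 + t) * log 2 Q"
        using pos Qpos by (simp add: log_mult log_powr)
      finally have le: "log 2 ?x \<le> (1 - t) / (1 + t) + t / (1 + t) * log 2 (real (card M) / real (card L)) + 1 / (1 + t) * log 2 Q" .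
      have "(1 + t) / t * (log 2 ?x - (1 - t) / (1 + t)) \<le> (1 + t) / t * (t / (1 + t) * log 2 (real (card M) / real (card L)) + 1 / (1 + t) * log 2 Q)"
        using le t0 by (intro mult_left_mono) auto
      also have "\<dots> = log 2 (real (card M) / real (card L)) + 1 / t * log 2 Q"
      proof -
        have "(1 + t) / t * (t / (1 + t)) = 1" "(1 + t) / t * (1 / (1 + t)) = 1 / t" using t0 by simp_all
        then show ?thesis by (simp only: distrib_left mult.assoc[symmetric] mult_1)
      qed
      also have "log 2 (real (card M) / real (card L)) = - log 2 (real (card L) / real (card M))"
        using pos by (simp add: log_divide)
      finally have "?b \<le> 1 / t * log 2 Q" by simp
      then show "?b \<le> D" unfolding D sandwiched_div_def Q_def P_def using t0 by simp
    qed
    then have "log 2 ?x \<le> (1 - t) / (1 + t) + t / (1 + t) * (- log 2 (real (card L) / real (card M)) + I_down ?n d t ?\<rho>)"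
    proof -
      assume b: "?b \<le> I_down ?n d t ?\<rho>"
      then have "(1 + t) / t * (log 2 ?x - (1 - t) / (1 + t)) \<le> - log 2 (real (card L) / real (card M)) + I_down ?n d t ?\<rho>"
        by simp
      then have "t / (1 + t) * ((1 + t) / t * (log 2 ?x - (1 - t) / (1 + t))) \<le> t / (1 + t) * (- log 2 (real (card L) / real (card M)) + I_down ?n d t ?\<rho>)"
        using t0 by (intro mult_left_mono) auto
      moreover have "t / (1 + t) * ((1 + t) / t * (log 2 ?x - (1 - t) / (1 + t))) = log 2 ?x - (1 - t) / (1 + t)"
        using t0 by simp
      ultimately show ?thesis by simp
    qed
    then have "2 powr log 2 ?x \<le> 2 powr ((1 - t) / (1 + t) + t / (1 + t) * (- log 2 (real (card L) / real (card M)) + I_down ?n d t ?\<rho>))"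
      by simp
    then show ?thesis using x by (simp add: powr_add)
  qed
qed simp

end
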